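(* Let $M$ be a $\mathbf{Z}^n$-persistence module of finite total dimension and let $U_1,\dots,U_n$ be graded matrices. The following are equivalent: 1. $U_1,\dots,U_n$ represent a free resolution $\cdots 0\to F_n\xrightarrow{U_n}\cdots\xrightarrow{U_1}F_0$ of $M$; 2. $U_1\langle\epsilon\rangle,\dots,U_n\langle\epsilon\rangle$ represent an injective resolution $I^0\xrightarrow{U_n\langle\epsilon\rangle}\cdots\xrightarrow{U_1\langle\epsilon\rangle}I^n\to0\cdots$ of $M$; 3. $U_1\langle\epsilon\rangle^T,\dots,U_n\langle\epsilon\rangle^T$ represent a free resolution $\cdots0\to G_n\xrightarrow{U_1\langle\epsilon\rangle^T}\cdots\xrightarrow{U_n\langle\epsilon\rangle^T}G_0$ of $M^*$. In this case $I^q=\nu F_{n-q}\langle\epsilon\rangle=G_q^*$ for all $q$.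
   Context: Let $k$ be a field. A $\mathbf{Z}^n$-persistence module is a functor $M\colon \mathbf{Z}^n \to \mathbf{vec}$ from the poset $\mathbf{Z}^n$ (product order) to finite-dimensional $k$-vector spaces; morphisms are natural transformations. Its total dimension is $\sum_{z} \dim M_z$. The dual $M^*$ has $(M^* )_z = (M_{-z})^*$ and $(M^* )_{z\le z'} = (M_{-z'\le -z})^*$. The shift $M\langle z\rangle$ has components $M\langle z\rangle_w = M_{z+w}$. For $z\in\mathbf{Z}^n$, $F(z)$ is the module with $F(z)_w = k$ if $z\le w$ and $0$ otherwise, with identity structure maps between nonzero components; $I(z)=F(-z)^*$ is the injective module with $I(z)_w=k$ if $w\le z$ and $0$ otherwise, with identity structure maps between nonzero components. A module is free if it is isomorphic to a direct sum of modules $F(z_i)$. A free (resp. injective) resolution of $M$ is a chain complex of free modules (resp. cochain complex of injective modules) concentrated in nonnegative degrees that is quasi-isomorphic to $M$. $\epsilon=(1,\dots,1)\in\mathbf{Z}^n$. A graded matrix $A$ is a (finite, possibly empty) matrix over $k$ with row grades $\mathrm{rg}^A_i\in\mathbf{Z}^n$ and column grades $\mathrm{cg}^A_j\in\mathbf{Z}^n$. It represents the morphism of free modules $\bigoplus_jF(\mathrm{cg}^A_j)\to\bigoplus_iF(\mathrm{rg}^A_i)$ (resp. of injective modules $\bigoplus_jI(\mathrm{cg}^A_j)\to\bigoplus_iI(\mathrm{rg}^A_i)$) whose $(i,j)$ component is $A_{ij}$ times the canonical map $F(\mathrm{cg}^A_j)\to F(\mathrm{rg}^A_i)$ (resp.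 $I(\mathrm{cg}^A_j)\to I(\mathrm{rg}^A_i)$), which exists when $\mathrm{rg}^A_i\le\mathrm{cg}^A_j$; entries with $\mathrm{rg}^A_i\not\le\mathrm{cg}^A_j$ are required to be $0$. Matrices represent a complex if consecutive ones have matching grades and each represents the corresponding (co)boundary map. $A\langle z\rangle$ is the graded matrix with the same entries and with row grades $\mathrm{rg}^A_i-z$ and column grades $\mathrm{cg}^A_j-z$ (so that it represents the shift by $\langle z\rangle$ of the morphism represented by $A$). The graded transpose of a graded $m\times l$-matrix $A$ is the graded $l\times m$-matrix $A^T$ with $(A^T)_{ij}=A_{m+1-j,\,l+1-i}$, $\mathrm{rg}^{A^T}_i=-\mathrm{cg}^A_{l+1-i}$, $\mathrm{cg}^{A^T}_j=-\mathrm{rg}^A_{m+1-j}$. The Nakayama functor is $\nu=\mathsf{Hom}(-,F(0))^*$, where $\mathsf{Hom}(M,N)_z=\mathrm{Hom}(M,N\langle z\rangle)$; it sends $F(z)$ to $I(z)$ and a morphism represented by a graded matrix to the morphism of injectives represented by the same matrix. *)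

theory Defs
  imports "HOL-Analysis.Analysis" "HOL-Library.Function_Algebras"
begin

section \<open>Persistence modules\<close>

text \<open>
  The poset \<open>Z^n\<close> is the type \<open>int ^ 'n\<close> with its componentwise order, where \<open>n = CARD('n) \<ge> 1\<close>.

  The components of a module are subspaces of one ambient vector space on the type \<open>'v\<close>, whose
  scalar multiplication is \<open>scl\<close>. This is no restriction: an arbitrary family of vector spaces
  embeds into its direct sum. Structure maps are only meaningful on the components.
\<close>

record ('k, 'v, 'n :: finite) pmod =
  scl :: "'k \<Rightarrow> 'v \<Rightarrow> 'v"
  cmp :: "int ^ 'n \<Rightarrow> 'v set"
  str :: "int ^ 'n \<Rightarrow> int ^ 'n \<Rightarrow> 'v \<Rightarrow> 'v"

definition linear_on ::
  "('k \<Rightarrow> 'v \<Rightarrow> 'v) \<Rightarrow> ('k \<Rightarrow> 'w \<Rightarrow> 'w) \<Rightarrow> 'v set \<Rightarrow> 'w set \<Rightarrow> ('v :: ab_group_add \<Rightarrow> 'w :: ab_group_add) \<Rightarrow> bool"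
where
  "linear_on s t V W f \<longleftrightarrow> (\<forall>x\<in>V. f x \<in> W) \<and> (\<forall>x\<in>V. \<forall>y\<in>V. f (x + y) = f x + f y) \<and>
     (\<forall>c. \<forall>x\<in>V. f (s c x) = t c (f x))"

definition persistence_module ::
  "('k :: field, 'v :: ab_group_add, 'n :: finite) pmod \<Rightarrow> bool"
where
  "persistence_module M \<longleftrightarrow> vector_space (scl M) \<and>
     (\<forall>z. module.subspace (scl M) (cmp M z)) \<and>
     (\<forall>z. \<exists>B. finite B \<and> module.span (scl M) B = cmp M z) \<and>
     (\<forall>z w. z \<le> w \<longrightarrow> linear_on (scl M) (scl M) (cmp M z) (cmp M w) (str M z w)) \<and>
     (\<forall>z. \<forall>x\<in>cmp M z. str M z z x = x) \<and>
     (\<forall>z w u. z \<le> w \<longrightarrow> w \<le> u \<longrightarrow> (\<forall>x\<in>cmp M z. str M w u (str M z w x) = str M z u x))"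

definition total_dim :: "('k :: field, 'v :: ab_group_add, 'n :: finite) pmod \<Rightarrow> enat" where
  "total_dim M = (\<Sum>\<^sub>\<infinity>z\<in>UNIV. enat (vector_space.dim (scl M) (cmp M z)))"

definition morphism ::
  "('k, 'v :: ab_group_add, 'n :: finite) pmod \<Rightarrow> ('k, 'w :: ab_group_add, 'n) pmod \<Rightarrow> (int ^ 'n \<Rightarrow> 'v \<Rightarrow> 'w) \<Rightarrow> bool"
where
  "morphism M N f \<longleftrightarrow> (\<forall>z. linear_on (scl M) (scl N) (cmp M z) (cmp N z) (f z)) \<and>
     (\<forall>z w. z \<le> w \<longrightarrow> (\<forall>x\<in>cmp M z. f w (str M z w x) = str N z w (f z x)))"

definition isomorphism ::
  "('k, 'v :: ab_group_add, 'n :: finite) pmod \<Rightarrow> ('k, 'w :: ab_group_add, 'n) pmod \<Rightarrow> (int ^ 'n \<Rightarrow> 'v \<Rightarrow> 'w) \<Rightarrow> bool"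
where
  "isomorphism M N f \<longleftrightarrow> morphism M N f \<and> (\<forall>z. bij_betw (f z) (cmp M z) (cmp N z))"

definition is_zero :: "('k, 'v :: zero, 'n :: finite) pmod \<Rightarrow> bool" where
  "is_zero M \<longleftrightarrow> (\<forall>z. cmp M z = {0})"

definition shift :: "int ^ 'n \<Rightarrow> ('k, 'v, 'n :: finite) pmod \<Rightarrow> ('k, 'v, 'n) pmod" where
  "shift z M = \<lparr>scl = scl M, cmp = (\<lambda>w. cmp M (z + w)), str = (\<lambda>w u. str M (z + w) (z + u))\<rparr>"

text \<open>
  Linear functionals on a component, and likewise elements of \<open>Hom\<close> below, are represented by
  functions that vanish outside their domain, so that each has exactly one representative.
\<close>

definition dual ::
  "('k :: field, 'v :: ab_group_add, 'n :: finite) pmod \<Rightarrow> ('k, 'v \<Rightarrow> 'k, 'n) pmod"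
where
  "dual M = \<lparr>scl = (\<lambda>c p x. c * p x),
     cmp = (\<lambda>z. {p. linear_on (scl M) (*) (cmp M (- z)) UNIV p \<and> (\<forall>x. x \<notin> cmp M (- z) \<longrightarrow> p x = 0)}),
     str = (\<lambda>z w p x. if x \<in> cmp M (- w) then p (str M (- w) (- z) x) else 0)\<rparr>"

text \<open>The dual \<open>N\<^sup>* \<rightarrow> M\<^sup>*\<close> of a morphism \<open>f : M \<rightarrow> N\<close>.\<close>

definition dual_map ::
  "('k :: field, 'v :: ab_group_add, 'n :: finite) pmod \<Rightarrow> (int ^ 'n \<Rightarrow> 'v \<Rightarrow> 'w) \<Rightarrow> int ^ 'n \<Rightarrow> ('w \<Rightarrow> 'k) \<Rightarrow> 'v \<Rightarrow> 'k"
where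
  "dual_map M f z p x = (if x \<in> cmp M (- z) then p (f (- z) x) else 0)"

subsection \<open>Free and injective modules\<close>

definition F :: "int ^ 'n \<Rightarrow> ('k :: field, 'k, 'n :: finite) pmod" where
  "F z = \<lparr>scl = (*), cmp = (\<lambda>w. if z \<le> w then UNIV else {0}), str = (\<lambda>w u x. x)\<rparr>"

definition I :: "int ^ 'n \<Rightarrow> ('k :: field, 'k, 'n :: finite) pmod" where
  "I z = \<lparr>scl = (*), cmp = (\<lambda>w. if w \<le> z then UNIV else {0}), str = (\<lambda>w u x. if u \<le> z then x else 0)\<rparr>"

definition direct_sum ::
  "nat set \<Rightarrow> (nat \<Rightarrow> ('k, 'v :: zero, 'n :: finite) pmod) \<Rightarrow> ('k, nat \<Rightarrow> 'v, 'n) pmod"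
where
  "direct_sum S M = \<lparr>scl = (\<lambda>c f j. scl (M j) c (f j)),
     cmp = (\<lambda>z. {f. (\<forall>j\<in>S. f j \<in> cmp (M j) z) \<and> (\<forall>j. j \<notin> S \<longrightarrow> f j = 0) \<and> finite {j. f j \<noteq> 0}}),
     str = (\<lambda>z w f j. if j \<in> S then str (M j) z w (f j) else 0)\<rparr>"

text \<open>
  Index sets inside \<open>nat\<close> suffice: components are finite-dimensional, so only finitely many
  summands \<open>F z\<close> can occur for each of the countably many grades \<open>z\<close>.
\<close>

definition free_module :: "('k :: field, 'v :: ab_group_add, 'n :: finite) pmod \<Rightarrow> bool" where
  "free_module M \<longleftrightarrow> (\<exists>S g f. isomorphism M (direct_sum S (\<lambda>j. F (g j))) f)"

text \<open>
  Injective objects of the category of persistence modules. Up to isomorphism, every persistence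
  module has ambient type \<open>nat \<Rightarrow> 'k\<close>, since the sum of its components has countable dimension.
  The test objects \<open>A\<close> and \<open>B\<close> therefore range over all persistence modules.
\<close>

definition injective_module :: "('k :: field, 'v :: ab_group_add, 'n :: finite) pmod \<Rightarrow> bool" where
  "injective_module E \<longleftrightarrow> persistence_module E \<and>
     (\<forall>(A :: ('k, nat \<Rightarrow> 'k, 'n) pmod) (B :: ('k, nat \<Rightarrow> 'k, 'n) pmod) i g.
        persistence_module A \<longrightarrow> persistence_module B \<longrightarrow>
        morphism A B i \<longrightarrow> (\<forall>z. inj_on (i z) (cmp A z)) \<longrightarrow> morphism A E g \<longrightarrow>
        (\<exists>h. morphism B E h \<and> (\<forall>z. \<forall>x\<in>cmp A z. h z (i z x) = g z x)))"

subsection \<open>The Nakayama functor\<close>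

definition Hom ::
  "('k, 'v :: ab_group_add, 'n :: finite) pmod \<Rightarrow> ('k, 'w :: ab_group_add, 'n) pmod \<Rightarrow> ('k, int ^ 'n \<Rightarrow> 'v \<Rightarrow> 'w, 'n) pmod"
where
  "Hom M N = \<lparr>scl = (\<lambda>c f w x. scl N c (f w x)),
     cmp = (\<lambda>z. {f. morphism M (shift z N) f \<and> (\<forall>w x. x \<notin> cmp M w \<longrightarrow> f w x = 0)}),
     str = (\<lambda>z u f w x. if x \<in> cmp M w then str N (z + w) (u + w) (f w x) else 0)\<rparr>"

text \<open>For \<open>f : M \<rightarrow> N\<close>, the precomposition \<open>Hom N P \<rightarrow> Hom M P\<close>.\<close>

definition Hom_map ::
  "('k, 'v, 'n :: finite) pmod \<Rightarrow> (int ^ 'n \<Rightarrow> 'v \<Rightarrow> 'w) \<Rightarrow> int ^ 'n \<Rightarrow> (int ^ 'n \<Rightarrow> 'w \<Rightarrow> 'u :: zero) \<Rightarrow> int ^ 'n \<Rightarrow> 'v \<Rightarrow> 'u"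
where
  "Hom_map M f z g w x = (if x \<in> cmp M w then g w (f w x) else 0)"

definition nu ::
  "('k :: field, 'v :: ab_group_add, 'n :: finite) pmod \<Rightarrow> ('k, (int ^ 'n \<Rightarrow> 'v \<Rightarrow> 'k) \<Rightarrow> 'k, 'n) pmod"
where
  "nu M = dual (Hom M (F 0))"

definition nu_map ::
  "('k :: field, 'v :: ab_group_add, 'n :: finite) pmod \<Rightarrow> ('k, 'w :: ab_group_add, 'n) pmod \<Rightarrow> (int ^ 'n \<Rightarrow> 'v \<Rightarrow> 'w) \<Rightarrow>
    int ^ 'n \<Rightarrow> ((int ^ 'n \<Rightarrow> 'v \<Rightarrow> 'k) \<Rightarrow> 'k) \<Rightarrow> (int ^ 'n \<Rightarrow> 'w \<Rightarrow> 'k) \<Rightarrow> 'k"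
where
  "nu_map M N f = dual_map (Hom N (F 0)) (Hom_map M f)"

section \<open>Complexes and resolutions\<close>

text \<open>
  All complexes are indexed homologically by the integers: \<open>bd C q\<close> maps \<open>obj C q\<close> to
  \<open>obj C (q - 1)\<close>. A cochain complex \<open>I\<^sup>\<bullet>\<close> is stored with \<open>I\<^sup>q\<close> in degree \<open>- q\<close>.
\<close>

record ('k, 'v, 'n :: finite) cplx =
  obj :: "int \<Rightarrow> ('k, 'v, 'n) pmod"
  bd :: "int \<Rightarrow> int ^ 'n \<Rightarrow> 'v \<Rightarrow> 'v"

definition complex :: "('k :: field, 'v :: ab_group_add, 'n :: finite) cplx \<Rightarrow> bool" where
  "complex C \<longleftrightarrow> (\<forall>q. persistence_module (obj C q)) \<and>
     (\<forall>q. morphism (obj C q) (obj C (q - 1)) (bd C q)) \<and>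
     (\<forall>q z. \<forall>x\<in>cmp (obj C q) z. bd C (q - 1) z (bd C q z x) = 0)"

definition chain_map ::
  "(int \<Rightarrow> int ^ 'n \<Rightarrow> 'v \<Rightarrow> 'w) \<Rightarrow> ('k, 'v :: ab_group_add, 'n :: finite) cplx \<Rightarrow> ('k, 'w :: ab_group_add, 'n) cplx \<Rightarrow> bool"
where
  "chain_map f C D \<longleftrightarrow> (\<forall>q. morphism (obj C q) (obj D q) (f q)) \<and>
     (\<forall>q z. \<forall>x\<in>cmp (obj C q) z. f (q - 1) z (bd C q z x) = bd D q z (f q z x))"

definition complex_iso ::
  "(int \<Rightarrow> int ^ 'n \<Rightarrow> 'v \<Rightarrow> 'w) \<Rightarrow> ('k, 'v :: ab_group_add, 'n :: finite) cplx \<Rightarrow> ('k, 'w :: ab_group_add, 'n) cplx \<Rightarrow> bool"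
where
  "complex_iso f C D \<longleftrightarrow> chain_map f C D \<and> (\<forall>q. isomorphism (obj C q) (obj D q) (f q))"

definition cycles :: "('k, 'v :: ab_group_add, 'n :: finite) cplx \<Rightarrow> int \<Rightarrow> int ^ 'n \<Rightarrow> 'v set" where
  "cycles C q z = {x \<in> cmp (obj C q) z. bd C q z x = 0}"

definition boundaries :: "('k, 'v :: ab_group_add, 'n :: finite) cplx \<Rightarrow> int \<Rightarrow> int ^ 'n \<Rightarrow> 'v set" where
  "boundaries C q z = bd C (q + 1) z ` cmp (obj C (q + 1)) z"

definition homologous ::
  "('k, 'v :: ab_group_add, 'n :: finite) cplx \<Rightarrow> int \<Rightarrow> int ^ 'n \<Rightarrow> ('v \<times> 'v) set"
where
  "homologous C q z = {(x, y). x \<in> cycles C q z \<and> y \<in> cycles C q z \<and> x - y \<in> boundaries C q z}"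

definition homology :: "('k, 'v :: ab_group_add, 'n :: finite) cplx \<Rightarrow> int \<Rightarrow> int ^ 'n \<Rightarrow> 'v set set" where
  "homology C q z = cycles C q z // homologous C q z"

definition homology_map ::
  "('k, 'w :: ab_group_add, 'n :: finite) cplx \<Rightarrow> (int \<Rightarrow> int ^ 'n \<Rightarrow> 'v \<Rightarrow> 'w) \<Rightarrow> int \<Rightarrow> int ^ 'n \<Rightarrow> 'v set \<Rightarrow> 'w set"
where
  "homology_map D f q z X = homologous D q z `` (f q z ` X)"

definition quasi_isomorphism ::
  "(int \<Rightarrow> int ^ 'n \<Rightarrow> 'v \<Rightarrow> 'w) \<Rightarrow> ('k, 'v :: ab_group_add, 'n :: finite) cplx \<Rightarrow> ('k, 'w :: ab_group_add, 'n) cplx \<Rightarrow> bool"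
where
  "quasi_isomorphism f C D \<longleftrightarrow> chain_map f C D \<and>
     (\<forall>q z. bij_betw (homology_map D f q z) (homology C q z) (homology D q z))"

text \<open>A module regarded as a complex concentrated in degree \<open>0\<close>.\<close>

definition stalk :: "('k, 'v :: ab_group_add, 'n :: finite) pmod \<Rightarrow> ('k, 'v, 'n) cplx" where
  "stalk M = \<lparr>obj = (\<lambda>q. if q = 0 then M else M\<lparr>cmp := \<lambda>z. {0}\<rparr>), bd = (\<lambda>q z x. 0)\<rparr>"

definition free_resolution ::
  "('k :: field, 'v :: ab_group_add, 'n :: finite) cplx \<Rightarrow> ('k, 'w :: ab_group_add, 'n) pmod \<Rightarrow> bool"
where
  "free_resolution C M \<longleftrightarrow> complex C \<and> (\<forall>q. free_module (obj C q)) \<and>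
     (\<forall>q<0. is_zero (obj C q)) \<and> (\<exists>f. quasi_isomorphism f C (stalk M))"

text \<open>Nonnegative cohomological degrees are the nonpositive homological ones.\<close>

definition injective_resolution ::
  "('k :: field, 'v :: ab_group_add, 'n :: finite) cplx \<Rightarrow> ('k, 'w :: ab_group_add, 'n) pmod \<Rightarrow> bool"
where
  "injective_resolution C M \<longleftrightarrow> complex C \<and> (\<forall>q. injective_module (obj C q)) \<and>
     (\<forall>q>0. is_zero (obj C q)) \<and> (\<exists>f. quasi_isomorphism f (stalk M) C)"

text \<open>The translation introduces no signs.\<close>

definition translate :: "int \<Rightarrow> ('k, 'v, 'n :: finite) cplx \<Rightarrow> ('k, 'v, 'n) cplx" where
  "translate p C = \<lparr>obj = (\<lambda>q. obj C (q + p)), bd = (\<lambda>q. bd C (q + p))\<rparr>"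

definition shift_complex :: "int ^ 'n \<Rightarrow> ('k, 'v, 'n :: finite) cplx \<Rightarrow> ('k, 'v, 'n) cplx" where
  "shift_complex z C = \<lparr>obj = (\<lambda>q. shift z (obj C q)), bd = (\<lambda>q w. bd C q (z + w))\<rparr>"

definition nu_complex ::
  "('k :: field, 'v :: ab_group_add, 'n :: finite) cplx \<Rightarrow> ('k, (int ^ 'n \<Rightarrow> 'v \<Rightarrow> 'k) \<Rightarrow> 'k, 'n) cplx"
where
  "nu_complex C = \<lparr>obj = (\<lambda>q. nu (obj C q)), bd = (\<lambda>q. nu_map (obj C q) (obj C (q - 1)) (bd C q))\<rparr>"

definition dual_complex ::
  "('k :: field, 'v :: ab_group_add, 'n :: finite) cplx \<Rightarrow> ('k, 'v \<Rightarrow> 'k, 'n) cplx"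
where
  "dual_complex C = \<lparr>obj = (\<lambda>q. dual (obj C (- q))), bd = (\<lambda>q. dual_map (obj C (1 - q)) (bd C (1 - q)))\<rparr>"

section \<open>Graded matrices\<close>

text \<open>
  The size of a graded matrix is given by the lengths of its grade lists. Rows and columns are
  counted from \<open>0\<close>, and entries outside the size are irrelevant.
\<close>

record ('k, 'n :: finite) gmat =
  rg :: "(int ^ 'n) list"
  cg :: "(int ^ 'n) list"
  ent :: "nat \<Rightarrow> nat \<Rightarrow> 'k"

definition graded_matrix :: "('k :: field, 'n :: finite) gmat \<Rightarrow> bool" where
  "graded_matrix A \<longleftrightarrow> (\<forall>i<length (rg A). \<forall>j<length (cg A). \<not> rg A ! i \<le> cg A ! j \<longrightarrow> ent A i j = 0)"

definition gm_shift :: "int ^ 'n \<Rightarrow> ('k, 'n :: finite) gmat \<Rightarrow> ('k, 'n) gmat" where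
  "gm_shift z A = \<lparr>rg = map (\<lambda>a. a - z) (rg A), cg = map (\<lambda>a. a - z) (cg A), ent = ent A\<rparr>"

definition gm_transpose :: "('k, 'n :: finite) gmat \<Rightarrow> ('k, 'n) gmat" where
  "gm_transpose A = \<lparr>rg = rev (map uminus (cg A)), cg = rev (map uminus (rg A)),
     ent = (\<lambda>i j. ent A (length (rg A) - 1 - j) (length (cg A) - 1 - i))\<rparr>"

definition free_sum :: "(int ^ 'n) list \<Rightarrow> ('k :: field, nat \<Rightarrow> 'k, 'n :: finite) pmod" where
  "free_sum gs = direct_sum {..<length gs} (\<lambda>j. F (gs ! j))"

definition inj_sum :: "(int ^ 'n) list \<Rightarrow> ('k :: field, nat \<Rightarrow> 'k, 'n :: finite) pmod" where
  "inj_sum gs = direct_sum {..<length gs} (\<lambda>j. I (gs ! j))"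

text \<open>
  The canonical map \<open>F c \<rightarrow> F r\<close>, for \<open>r \<le> c\<close>, is an inclusion; the canonical map \<open>I c \<rightarrow> I r\<close> is
  the identity at the grades \<open>w \<le> r\<close> and zero elsewhere.
\<close>

definition free_map :: "('k :: field, 'n :: finite) gmat \<Rightarrow> int ^ 'n \<Rightarrow> (nat \<Rightarrow> 'k) \<Rightarrow> nat \<Rightarrow> 'k" where
  "free_map A w x i = (if i < length (rg A) then \<Sum>j<length (cg A). ent A i j * x j else 0)"

definition inj_map :: "('k :: field, 'n :: finite) gmat \<Rightarrow> int ^ 'n \<Rightarrow> (nat \<Rightarrow> 'k) \<Rightarrow> nat \<Rightarrow> 'k" where
  "inj_map A w x i =
     (if i < length (rg A) \<and> w \<le> rg A ! i then \<Sum>j<length (cg A). ent A i j * x j else 0)"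

text \<open>
  A sequence \<open>U 1, \<dots>, U N\<close> with \<open>N \<ge> 1\<close> of matrices with matching grades determines grade lists
  in the degrees \<open>0, \<dots>, N\<close>, where \<open>U q\<close> has its columns in degree \<open>q\<close> and its rows in
  degree \<open>q - 1\<close>.
\<close>

definition matching :: "nat \<Rightarrow> (nat \<Rightarrow> ('k, 'n :: finite) gmat) \<Rightarrow> bool" where
  "matching N U \<longleftrightarrow> (\<forall>q. 1 \<le> q \<and> q < N \<longrightarrow> rg (U (q + 1)) = cg (U q))"

definition grades :: "nat \<Rightarrow> (nat \<Rightarrow> ('k, 'n :: finite) gmat) \<Rightarrow> int \<Rightarrow> (int ^ 'n) list" where
  "grades N U q = (if q = 0 then rg (U 1) else if 1 \<le> q \<and> q \<le> int N then cg (U (nat q)) else [])"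

definition free_complex ::
  "nat \<Rightarrow> (nat \<Rightarrow> ('k :: field, 'n :: finite) gmat) \<Rightarrow> ('k, nat \<Rightarrow> 'k, 'n) cplx"
where
  "free_complex N U = \<lparr>obj = (\<lambda>q. free_sum (grades N U q)),
     bd = (\<lambda>q. if 1 \<le> q \<and> q \<le> int N then free_map (U (nat q)) else (\<lambda>z x. 0))\<rparr>"

text \<open>
  The cochain complex \<open>I\<^sup>0 \<rightarrow> \<dots> \<rightarrow> I\<^sup>N\<close> with coboundaries \<open>U N, \<dots>, U 1\<close>: the term \<open>I\<^sup>p\<close>, of
  homological degree \<open>q = - p\<close>, has the grades of degree \<open>N - p = N + q\<close>, and \<open>U (N - p)\<close> starts
  there.
\<close>

definition inj_complex ::
  "nat \<Rightarrow> (nat \<Rightarrow> ('k :: field, 'n :: finite) gmat) \<Rightarrow> ('k, nat \<Rightarrow> 'k, 'n) cplx"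
where
  "inj_complex N U = \<lparr>obj = (\<lambda>q. inj_sum (grades N U (int N + q))),
     bd = (\<lambda>q. if 1 \<le> int N + q \<and> q \<le> 0 then inj_map (U (nat (int N + q))) else (\<lambda>z x. 0))\<rparr>"

definition represents_free_resolution ::
  "nat \<Rightarrow> (nat \<Rightarrow> ('k :: field, 'n :: finite) gmat) \<Rightarrow> ('k, 'v :: ab_group_add, 'n) pmod \<Rightarrow> bool"
where
  "represents_free_resolution N U M \<longleftrightarrow> (\<forall>q\<in>{1..N}. graded_matrix (U q)) \<and> matching N U \<and>
     free_resolution (free_complex N U) M"

definition represents_injective_resolution ::
  "nat \<Rightarrow> (nat \<Rightarrow> ('k :: field, 'n :: finite) gmat) \<Rightarrow> ('k, 'v :: ab_group_add, 'n) pmod \<Rightarrow> bool"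
where
  "represents_injective_resolution N U M \<longleftrightarrow> (\<forall>q\<in>{1..N}. graded_matrix (U q)) \<and> matching N U \<and>
     injective_resolution (inj_complex N U) M"

end

theory Submission
  imports Defs
begin

text \<open>
  For a complex of graded matrices, a set \<open>T\<close> of coordinates and a grade \<open>z\<close>, consider the subquotient
  spanned by the generators whose grade \<open>g\<close> satisfies \<open>g\<^sub>i > z\<^sub>i\<close> for \<open>i \<in> T\<close> and \<open>g\<^sub>i \<le> z\<^sub>i\<close> for
  \<open>i \<notin> T\<close>. For \<open>T = {}\<close> this is the free complex at \<open>z\<close>; for \<open>T\<close> the set of all coordinates it is the
  injective complex with grades shifted by \<open>\<epsilon>\<close>. The subquotients for \<open>T\<close> and \<open>T \<union> {i}\<close> are the
  sub- and quotient complex of a complex in which the \<open>i\<close>-th coordinate is unconstrained. Since there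
  are finitely many generators, the latter also arises from either of them by moving \<open>z\<close> far up or
  down in direction \<open>i\<close>, so it is acyclic when one of them has homology \<open>M\<close>, which has finite support.
  The connecting homomorphism is then a natural isomorphism that raises the degree by one, and after
  \<open>n\<close> steps the homology \<open>M\<close> in degree \<open>0\<close> has become homology \<open>M\<close> in degree \<open>n\<close>.

  The third condition is the dual of the second one: the injective complex is the dual of the free
  complex of the transposed matrices, by the evident pairing of the generators.
\<close>

section \<open>Linear algebra on subspaces\<close>

text \<open>The shift by \<open>\<epsilon>\<close> comes from the strict inequalities: over the
  integers, \<open>z \<le> g - \<epsilon>\<close> means \<open>z $ i < g $ i\<close> for all
  \<open>i\<close>.

  All subquotients use the same coordinates \<open>nat \<Rightarrow> 'k\<close>, so inclusions,
  projections and structure maps are all truncations \<open>res\<close>, and in the snake lemma a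
  cycle is its own lift. The price is that a truncation commutes with the differentials only under
  \<open>compat\<close>, and that generators passing from the quotient to the subcomplex as
  \<open>z\<close> grows spoil strict naturality of the connecting map. After
  \<open>quasi_isomorphism_iff\<close> no homology quotient is formed: an isomorphism from homology
  to \<open>M\<close> is a linear map on cycles whose kernel consists of the boundaries.

  A further obstacle is that being a complex is part of each condition and cannot be presupposed. It
  is first shown to hold on both sides or on neither: by the matrix products in
  \<open>square_zero\<close> for the first two conditions, by transport along the pairing for the
  last two.\<close>

lemma vector_space_mult: "vector_space ((*) :: 'k :: field \<Rightarrow> 'k \<Rightarrow> 'k)"
  by unfold_locales

lemma vector_space_fun:
  assumes "vector_space (s :: 'k :: field \<Rightarrow> 'v :: ab_group_add \<Rightarrow> 'v)"
  shows "vector_space (\<lambda>c (f :: 'a \<Rightarrow> 'v) x. s c (f x))"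
proof -
  interpret vector_space s by fact
  show ?thesis
    by unfold_locales (auto simp: fun_eq_iff algebra_simps)
qed

lemma linear_onD:
  assumes "linear_on s t V W f"
  shows "x \<in> V \<Longrightarrow> f x \<in> W"
    and "x \<in> V \<Longrightarrow> y \<in> V \<Longrightarrow> f (x + y) = f x + f y"
    and "x \<in> V \<Longrightarrow> f (s c x) = t c (f x)"
  using assms by (auto simp: linear_on_def)

lemma linear_on_zero:
  assumes "linear_on s t V W f" and "(0 :: 'v :: ab_group_add) \<in> V"
  shows "f 0 = (0 :: 'w :: ab_group_add)"
  using linear_onD(2)[OF assms(1) assms(2,2)] by simp

lemma linear_on_minus:
  fixes f :: "'v :: ab_group_add \<Rightarrow> 'w :: ab_group_add"
  assumes "linear_on s t V W f" "x \<in> V" "- x \<in> V" "0 \<in> V"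
  shows "f (- x) = - f x"
  using linear_onD(2)[OF assms(1,2,3)] linear_on_zero[OF assms(1,4)]
  by (simp add: minus_unique)

lemma linear_on_diff:
  assumes "linear_on s t V W f" "x \<in> V" "y \<in> V" "vector_space s" "module.subspace s V"
  shows "f (x - y) = f x - f y"
proof -
  interpret vector_space s by fact
  have "- y \<in> V" "0 \<in> V"
    using assms subspace_neg subspace_0 by auto
  then show ?thesis
    using linear_onD(2)[OF assms(1,2), of "- y"] linear_on_minus[OF assms(1,3)] by simp
qed

lemma linear_on_comp:
  assumes "linear_on s t V W f" "linear_on t u W X g"
  shows "linear_on s u V X (\<lambda>x. g (f x))"
  using assms by (auto simp: linear_on_def)

lemma linear_on_mono:
  assumes "linear_on s t V W f" "V' \<subseteq> V" "W \<subseteq> W'"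
  shows "linear_on s t V' W' f"
  using assms unfolding linear_on_def by blast

lemma linear_on_cong:
  assumes "linear_on s t V W f" "\<And>x. x \<in> V \<Longrightarrow> f x = g x" "vector_space s" "module.subspace s V"
  shows "linear_on s t V W g"
proof -
  interpret vector_space s by fact
  show ?thesis
    using assms(1,2,4) subspace_add subspace_scale by (simp add: linear_on_def)
qed

lemma linear_on_subspace_image:
  assumes "linear_on s t V W f" "vector_space s" "vector_space t" "module.subspace s V"
  shows "module.subspace t (f ` V)"
proof -
  interpret s: vector_space s by fact
  interpret t: vector_space t by fact
  note V = s.subspace_0[OF assms(4)] s.subspace_add[OF assms(4)] s.subspace_scale[OF assms(4)]
  show ?thesis
  proof (rule t.subspaceI)
    show "0 \<in> f ` V"
      using linear_on_zero[OF assms(1) V(1)] V(1) by force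
    show "x + y \<in> f ` V" if "x \<in> f ` V" "y \<in> f ` V" for x y
      using that V(2) by (auto simp flip: linear_onD(2)[OF assms(1)])
    show "t c x \<in> f ` V" if "x \<in> f ` V" for x c
      using that V(3) by (auto simp flip: linear_onD(3)[OF assms(1)])
  qed
qed

lemma linear_on_inj_on_iff:
  assumes "vector_space s" "module.subspace s V" "linear_on s t V W f"
  shows "inj_on f V \<longleftrightarrow> (\<forall>x\<in>V. f x = 0 \<longrightarrow> x = 0)"
proof -
  interpret vector_space s by fact
  have 0: "0 \<in> V" "f 0 = 0"
    using subspace_0[OF assms(2)] linear_on_zero[OF assms(3)] by auto
  show ?thesis
  proof
    assume "inj_on f V"
    then show "\<forall>x\<in>V. f x = 0 \<longrightarrow> x = 0"
      using 0 by (metis inj_onD)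
  next
    assume ker: "\<forall>x\<in>V. f x = 0 \<longrightarrow> x = 0"
    show "inj_on f V"
    proof (rule inj_onI)
      fix x y assume xy: "x \<in> V" "y \<in> V" "f x = f y"
      then have "f (x - y) = 0" "x - y \<in> V"
        using subspace_diff[OF assms(2) xy(1,2)] linear_on_diff[OF assms(3) xy(1,2) assms(1,2)] by simp_all
      then have "x - y = 0"
        using ker by blast
      then show "x = y" by simp
    qed
  qed
qed

lemma linear_on_inv_into:
  assumes s: "vector_space s" "module.subspace s V" and f: "linear_on s t V W f" "bij_betw f V W"
  shows "linear_on t s W V (inv_into V f)"
proof -
  interpret vector_space s by fact
  let ?g = "inv_into V f"
  have g: "?g y \<in> V" "f (?g y) = y" if "y \<in> W" for y
    using f(2) that by (auto simp: bij_betw_def inv_into_into f_inv_into_f)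
  have eqI: "?g y = x" if "x \<in> V" "y = f x" for x y
    using bij_betw_inv_into_left[OF f(2) that(1)] that(2) by simp
  show ?thesis
    unfolding linear_on_def
  proof (intro conjI ballI allI)
    fix x y assume "x \<in> W" "y \<in> W"
    then show "?g (x + y) = ?g x + ?g y"
      using g by (intro eqI) (auto simp: linear_onD(2)[OF f(1)] intro: subspace_add[OF s(2)])
  next
    fix c x assume "x \<in> W"
    then show "?g (t c x) = s c (?g x)"
      using g by (intro eqI) (auto simp: linear_onD(3)[OF f(1)] intro: subspace_scale[OF s(2)])
  qed (rule g)
qed

lemma linear_on_sum_scale:
  assumes "linear_on s t V W f" "vector_space s" "vector_space t" "module.subspace s V"
    and "finite A" "\<And>a. a \<in> A \<Longrightarrow> g a \<in> V"
  shows "(\<Sum>a\<in>A. s (c a) (g a)) \<in> V \<and> f (\<Sum>a\<in>A. s (c a) (g a)) = (\<Sum>a\<in>A. t (c a) (f (g a)))"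
  using assms(5,6)
proof (induction A rule: finite_induct)
  case empty
  interpret s: vector_space s by fact
  show ?case
    using linear_on_zero[OF assms(1)] s.subspace_0[OF assms(4)] by simp
next
  case (insert a A)
  interpret s: vector_space s by fact
  have *: "s (c a) (g a) \<in> V" "g a \<in> V"
    using insert s.subspace_scale[OF assms(4)] by auto
  have IH: "(\<Sum>a\<in>A. s (c a) (g a)) \<in> V"
      "f (\<Sum>a\<in>A. s (c a) (g a)) = (\<Sum>a\<in>A. t (c a) (f (g a)))"
    using insert by auto
  have "f (s (c a) (g a) + (\<Sum>a\<in>A. s (c a) (g a))) = t (c a) (f (g a)) + (\<Sum>a\<in>A. t (c a) (f (g a)))"
    using linear_onD(2)[OF assms(1) *(1) IH(1)] linear_onD(3)[OF assms(1) *(2)] IH(2) by metis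
  then show ?case
    using insert(1,2) s.subspace_add[OF assms(4) *(1) IH(1)] by simp
qed

lemma functional_extend:
  fixes s :: "'k :: field \<Rightarrow> 'v :: ab_group_add \<Rightarrow> 'v"
  assumes "vector_space s" "module.subspace s W" "linear_on s (*) W UNIV p"
  obtains r where "linear_on s (*) UNIV UNIV r" "\<And>x. x \<in> W \<Longrightarrow> r x = p x"
proof -
  interpret vector_space_pair s "(*) :: 'k \<Rightarrow> 'k \<Rightarrow> 'k"
    using assms(1) vector_space_mult by (simp add: vector_space_pair_def)
  obtain B where B: "vs1.independent B" "B \<subseteq> W" "W \<subseteq> vs1.span B"
    using vs1.maximal_independent_subset by metis
  obtain r where r: "Vector_Spaces.linear s (*) r" "\<forall>x\<in>B. r x = p x"
    using linear_independent_extend[OF B(1)] by blast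
  interpret r: Vector_Spaces.linear s "(*) :: 'k \<Rightarrow> 'k \<Rightarrow> 'k" r by fact
  have lin: "linear_on s (*) UNIV UNIV r"
    by (simp add: linear_on_def r.add r.scale)
  have "vs1.subspace {x \<in> W. r x = p x}"
    using assms(2,3) linear_on_zero[OF assms(3)]
    by (auto simp: vs1.subspace_def linear_on_def r.add r.scale)
  then have "vs1.span B \<subseteq> {x \<in> W. r x = p x}"
    using B r by (intro vs1.span_minimal) auto
  then have "r x = p x" if "x \<in> W" for x
    using that B by auto
  then show thesis
    using that lin by blast
qed

text \<open>A field is injective as a vector space over itself. The exactness statements about duals
  and the injectivity of \<open>inj_sum\<close> below all rest on this.\<close>

lemma functional_factor:
  fixes s :: "'k :: field \<Rightarrow> 'v :: ab_group_add \<Rightarrow> 'v" and t :: "'k \<Rightarrow> 'w :: ab_group_add \<Rightarrow> 'w"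
  assumes "vector_space s" "vector_space t" "module.subspace s V"
    and d: "linear_on s t V W d" and p: "linear_on s (*) V UNIV p"
    and ker: "\<And>x. x \<in> V \<Longrightarrow> d x = 0 \<Longrightarrow> p x = 0"
  obtains r where "linear_on t (*) UNIV UNIV r" "\<And>x. x \<in> V \<Longrightarrow> r (d x) = p x"
proof -
  interpret s: vector_space s by fact
  note V = s.subspace_0[OF assms(3)] s.subspace_add[OF assms(3)] s.subspace_scale[OF assms(3)]
    s.subspace_diff[OF assms(3)]
  \<comment> \<open>Any preimage will do: two of them differ by an element of the kernel of
    \<open>d\<close>, on which \<open>p\<close> vanishes.\<close>
  define r0 where "r0 y = p (SOME x. x \<in> V \<and> d x = y)" for y
  have r0: "r0 (d x) = p x" if "x \<in> V" for x
  proof -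
    define x' where "x' = (SOME x'. x' \<in> V \<and> d x' = d x)"
    have x': "x' \<in> V" "d x' = d x"
      unfolding x'_def using someI[of "\<lambda>x'. x' \<in> V \<and> d x' = d x" x] that by auto
    have "p (x' - x) = 0"
      using x' that V(4) by (intro ker) (auto simp: linear_on_diff[OF d _ _ assms(1,3)])
    then have "p x' = p x"
      using x' that by (simp add: linear_on_diff[OF p _ _ assms(1,3)])
    then show ?thesis
      by (simp add: r0_def x'_def)
  qed
  have "linear_on t (*) (d ` V) UNIV r0"
    unfolding linear_on_def
  proof (intro conjI ballI allI)
    show "r0 x \<in> UNIV" for x by simp
    fix x y assume "x \<in> d ` V" "y \<in> d ` V"
    then obtain x' y' where xy: "x = d x'" "x' \<in> V" "y = d y'" "y' \<in> V" by blast
    then show "r0 (x + y) = r0 x + r0 y"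
      using V(2)[OF xy(2,4)] r0 by (metis linear_onD(2)[OF d] linear_onD(2)[OF p])
  next
    fix c x assume "x \<in> d ` V"
    then obtain x' where x': "x = d x'" "x' \<in> V" by blast
    then show "r0 (t c x) = c * r0 x"
      using V(3)[OF x'(2)] r0 by (metis linear_onD(3)[OF d] linear_onD(3)[OF p])
  qed
  from functional_extend[OF assms(2) linear_on_subspace_image[OF d assms(1,2,3)] this]
  obtain r where "linear_on t (*) UNIV UNIV r" "\<And>x. x \<in> d ` V \<Longrightarrow> r x = r0 x" by blast
  then show thesis
    using that r0 by force
qed

text \<open>A vector outside \<open>W\<close> extends a basis of \<open>W\<close> to an independent
  set, on which the values of a functional can be prescribed.\<close>

lemma functional_separation:
  fixes s :: "'k :: field \<Rightarrow> 'v :: ab_group_add \<Rightarrow> 'v"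
  assumes "vector_space s" "module.subspace s W" "x \<notin> W"
  obtains r where "linear_on s (*) UNIV UNIV r" "\<And>y. y \<in> W \<Longrightarrow> r y = 0" "r x \<noteq> 0"
proof -
  interpret vector_space_pair s "(*) :: 'k \<Rightarrow> 'k \<Rightarrow> 'k"
    using assms(1) vector_space_mult by (simp add: vector_space_pair_def)
  obtain B where B: "vs1.independent B" "B \<subseteq> W" "W \<subseteq> vs1.span B"
    using vs1.maximal_independent_subset by metis
  have span: "vs1.span B = W"
    using B vs1.span_minimal[OF B(2) assms(2)] by auto
  then have ind: "vs1.independent (insert x B)"
    using B assms(3) by (simp add: vs1.independent_insertI)
  then obtain r where r: "Vector_Spaces.linear s (*) r"
      "\<forall>y\<in>insert x B. r y = (if y = x then 1 else 0)"
    using linear_independent_extend[OF ind, of "\<lambda>y. if y = x then 1 else 0"] by blast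
  interpret r: Vector_Spaces.linear s "(*) :: 'k \<Rightarrow> 'k \<Rightarrow> 'k" r by fact
  have lin: "linear_on s (*) UNIV UNIV r"
    by (simp add: linear_on_def r.add r.scale)
  have "x \<notin> B" using B assms(3) by auto
  then have B0: "\<forall>y\<in>B. r y = 0" using r by auto
  have "vs1.subspace {y. r y = 0}"
    by (auto simp: vs1.subspace_def r.add r.scale r.zero)
  then have "vs1.span B \<subseteq> {y. r y = 0}"
    using B0 by (intro vs1.span_minimal) auto
  then show thesis
    using that[OF lin] span r(2) by auto
qed

section \<open>Spaces of functionals and finite-dimensional duality\<close>

definition restrict_to :: "'v set \<Rightarrow> ('v \<Rightarrow> 'k :: zero) \<Rightarrow> 'v \<Rightarrow> 'k" where
  "restrict_to V p x = (if x \<in> V then p x else 0)"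

text \<open>The zero convention off \<open>V\<close> is that of \<open>dual\<close>, so components
  of dual modules are literally of this form and equality of functionals is equality of
  functions.\<close>

definition functionals :: "('k :: field \<Rightarrow> 'v :: ab_group_add \<Rightarrow> 'v) \<Rightarrow> 'v set \<Rightarrow> ('v \<Rightarrow> 'k) set" where
  "functionals s V = {p. linear_on s (*) V UNIV p \<and> (\<forall>x. x \<notin> V \<longrightarrow> p x = 0)}"

lemma restrict_to_in [simp]: "x \<in> V \<Longrightarrow> restrict_to V p x = p x"
  by (simp add: restrict_to_def)

lemma restrict_to_functionals:
  assumes "vector_space s" "module.subspace s V" "linear_on s (*) V UNIV p"
  shows "restrict_to V p \<in> functionals s V"
  using linear_on_cong[OF assms(3) _ assms(1,2), of "restrict_to V p"]
  by (simp add: functionals_def) (simp add: restrict_to_def)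

lemma functionals_ext:
  assumes "p \<in> functionals s V" "q \<in> functionals s V" "\<And>x. x \<in> V \<Longrightarrow> p x = q x"
  shows "p = q"
proof
  show "p x = q x" for x
    using assms by (cases "x \<in> V") (auto simp: functionals_def)
qed

lemma functionalsD:
  assumes "p \<in> functionals s V"
  shows "linear_on s (*) V UNIV p" "x \<notin> V \<Longrightarrow> p x = 0"
  using assms by (auto simp: functionals_def)

lemma subspace_functionals:
  assumes "vector_space s" "module.subspace s V"
  shows "module.subspace (\<lambda>c p x. c * p x) (functionals s V)"
proof -
  interpret s: vector_space s by fact
  interpret f: vector_space "\<lambda>c (p :: 'b \<Rightarrow> 'a) x. c * p x"
    by (rule vector_space_fun[OF vector_space_mult])
  show ?thesis
    by (auto simp: f.subspace_def functionals_def linear_on_def algebra_simps)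
qed

text \<open>The hypotheses make the \<open>c j\<close> a coordinate system on \<open>X\<close>:
  \<open>surj\<close> supplies the dual basis and \<open>inj\<close> shows that it spans. The two
  applications take as coordinates those of a free module, and the values of a morphism on
  generators.\<close>

lemma coordinates_dual_bij:
  fixes s :: "'k :: field \<Rightarrow> 'x :: ab_group_add \<Rightarrow> 'x" and c :: "nat \<Rightarrow> 'x \<Rightarrow> 'k"
  assumes "vector_space s" "module.subspace s X" "finite J"
    and c: "\<And>j. j \<in> J \<Longrightarrow> linear_on s (*) X UNIV (c j)"
    and inj: "\<And>x. x \<in> X \<Longrightarrow> \<forall>j\<in>J. c j x = 0 \<Longrightarrow> x = 0"
    and surj: "\<And>j. j \<in> J \<Longrightarrow> \<exists>x\<in>X. c j x = 1 \<and> (\<forall>i\<in>J. i \<noteq> j \<longrightarrow> c i x = 0)"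
  shows "bij_betw (\<lambda>y. restrict_to X (\<lambda>x. \<Sum>j\<in>J. y j * c j x)) {y. \<forall>j. j \<notin> J \<longrightarrow> y j = 0} (functionals s X)"
proof -
  interpret s: vector_space s by fact
  let ?f = "\<lambda>y. restrict_to X (\<lambda>x. \<Sum>j\<in>J. y j * c j x)"
  obtain e where e: "\<And>j. j \<in> J \<Longrightarrow> e j \<in> X" "\<And>j. j \<in> J \<Longrightarrow> c j (e j) = 1"
      "\<And>i j. j \<in> J \<Longrightarrow> i \<in> J \<Longrightarrow> i \<noteq> j \<Longrightarrow> c i (e j) = 0"
    using surj by metis
  have val: "(\<Sum>j\<in>J. y j * c j (e i)) = y i" if "i \<in> J" for y i
  proof -
    have "(\<Sum>j\<in>J. y j * c j (e i)) = (\<Sum>j\<in>J. if j = i then y j else 0)"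
      using e that by (intro sum.cong) auto
    then show ?thesis
      using that assms(3) by simp
  qed
  show ?thesis
    unfolding bij_betw_def
  proof
    show "inj_on ?f {y. \<forall>j. j \<notin> J \<longrightarrow> y j = 0}"
    proof (rule inj_onI, rule ext)
      fix y y' i
      assume y: "y \<in> {y. \<forall>j. j \<notin> J \<longrightarrow> y j = 0}" "y' \<in> {y. \<forall>j. j \<notin> J \<longrightarrow> y j = 0}"
        and eq: "?f y = ?f y'"
      show "y i = y' i"
      proof (cases "i \<in> J")
        case True
        then show ?thesis
          using fun_cong[OF eq, of "e i"] e(1) by (simp add: val)
      qed (use y in auto)
    qed
    show "?f ` {y. \<forall>j. j \<notin> J \<longrightarrow> y j = 0} = functionals s X"
    proof
      have "linear_on s (*) X UNIV (\<lambda>x. \<Sum>j\<in>J. y j * c j x)" for y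
        using c by (auto simp: linear_on_def sum.distrib algebra_simps sum_distrib_left
            intro!: sum.cong)
      then show "?f ` {y. \<forall>j. j \<notin> J \<longrightarrow> y j = 0} \<subseteq> functionals s X"
        using restrict_to_functionals[OF assms(1,2)] by blast
      show "functionals s X \<subseteq> ?f ` {y. \<forall>j. j \<notin> J \<longrightarrow> y j = 0}"
      proof
        fix p assume p: "p \<in> functionals s X"
        then have pl: "linear_on s (*) X UNIV p"
          by (simp add: functionals_def)
        define y where "y j = (if j \<in> J then p (e j) else 0)" for j
        have "p x = (\<Sum>j\<in>J. y j * c j x)" if x: "x \<in> X" for x
        proof -
          \<comment> \<open>The expansion of \<open>x\<close> in the dual basis has the same
            coordinates as \<open>x\<close>, so \<open>inj\<close> identifies the two.\<close>
          let ?x' = "\<Sum>j\<in>J. s (c j x) (e j)"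
          have x': "?x' \<in> X" "p ?x' = (\<Sum>j\<in>J. c j x * p (e j))"
            using linear_on_sum_scale[OF pl assms(1) vector_space_mult assms(2,3), of e] e(1) by auto
          have "c i (x - ?x') = 0" if "i \<in> J" for i
          proof -
            have "c i ?x' = (\<Sum>j\<in>J. c j x * c i (e j))"
              using linear_on_sum_scale[OF c[OF that] assms(1) vector_space_mult assms(2,3), of e] e(1)
              by auto
            also have "\<dots> = (\<Sum>j\<in>J. if j = i then c j x else 0)"
              using e that by (intro sum.cong) auto
            finally have "c i ?x' = c i x"
              using that assms(3) by simp
            then show ?thesis
              using linear_on_diff[OF c[OF that] x x'(1) assms(1,2)] by simp
          qed
          then have "x - ?x' = 0"
            using s.subspace_diff[OF assms(2) x x'(1)] by (intro inj) auto
          then have "p x = (\<Sum>j\<in>J. c j x * p (e j))"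
            using x'(2) by simp
          then show ?thesis
            by (simp add: y_def mult.commute)
        qed
        then have "p = ?f y"
          using p by (auto simp: restrict_to_def functionals_def fun_eq_iff)
        moreover have "y \<in> {y. \<forall>j. j \<notin> J \<longrightarrow> y j = 0}"
          by (simp add: y_def)
        ultimately show "p \<in> ?f ` {y. \<forall>j. j \<notin> J \<longrightarrow> y j = 0}"
          by (rule image_eqI)
      qed
    qed
  qed
qed

text \<open>The \<open>e b\<close> are the coordinate functionals of a basis \<open>B\<close>. The
  expansion gives both the finite dimension of the dual and biduality.\<close>

lemma functionals_expansion:
  fixes s :: "'k :: field \<Rightarrow> 'v :: ab_group_add \<Rightarrow> 'v"
  assumes "vector_space s" "finite B0" "module.span s B0 = V"
  obtains B e where "finite B" "B \<subseteq> V" "\<And>b. e b \<in> functionals s V"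
    "\<And>p. p \<in> functionals s V \<Longrightarrow> p = (\<Sum>b\<in>B. (\<lambda>x. p b * e b x))"
proof -
  interpret vector_space s by fact
  obtain B where B: "B \<subseteq> V" "independent B" "V \<subseteq> span B"
    using maximal_independent_subset by metis
  have fin: "finite B" and sub: "subspace V"
    using independent_span_bound[OF assms(2) B(2)] B(1) assms(3) by auto
  define e where "e b = restrict_to V (\<lambda>x. representation B x b)" for b
  have "e b \<in> functionals s V" for b
    unfolding e_def using B by (intro restrict_to_functionals assms(1) sub)
      (auto simp: linear_on_def representation_add representation_scale subset_iff)
  moreover have "p = (\<Sum>b\<in>B. (\<lambda>x. p b * e b x))" if p: "p \<in> functionals s V" for p
  proof
    fix x
    have sum: "(\<Sum>b\<in>S. (\<lambda>x. p b * e b x)) x = (\<Sum>b\<in>S. p b * e b x)" for S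
      by (induction S rule: infinite_finite_induct) auto
    show "p x = (\<Sum>b\<in>B. (\<lambda>x. p b * e b x)) x"
    proof (cases "x \<in> V")
      case True
      then have "p x = p (\<Sum>b\<in>B. s (representation B x b) b)"
        using sum_representation_eq[OF B(2) _ fin, of x] B(3) by auto
      also have "\<dots> = (\<Sum>b\<in>B. representation B x b * p b)"
        using linear_on_sum_scale[OF functionalsD(1)[OF p] assms(1) vector_space_mult sub fin, of id] B(1)
        by (simp add: subset_iff)
      also have "\<dots> = (\<Sum>b\<in>B. p b * e b x)"
        using True by (simp add: e_def mult.commute)
      finally show ?thesis
        by (simp add: sum)
    next
      case False
      then have "e b x = 0" for b
        by (simp add: e_def restrict_to_def)
      then show ?thesis
        using functionalsD(2)[OF p False] by (simp add: sum)
    qed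
  qed
  ultimately show thesis
    using that[OF fin B(1)] by blast
qed

text \<open>The representing vector is read off from the values of \<open>r\<close> on the dual
  basis; finite dimension makes this a finite sum.\<close>

lemma biduality:
  fixes s :: "'k :: field \<Rightarrow> 'v :: ab_group_add \<Rightarrow> 'v"
  assumes "vector_space s" "finite B0" "module.span s B0 = V"
    and r: "linear_on (\<lambda>c p x. c * p x) (*) (functionals s V) UNIV r"
  obtains v where "v \<in> V" "\<And>p. p \<in> functionals s V \<Longrightarrow> r p = p v"
proof -
  interpret vector_space s by fact
  have sub: "subspace V"
    using assms(3) by auto
  obtain B e where B: "finite B" "B \<subseteq> V" and e: "\<And>b. e b \<in> functionals s V"
    and exp: "\<And>p. p \<in> functionals s V \<Longrightarrow> p = (\<Sum>b\<in>B. (\<lambda>x. p b * e b x))"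
    using functionals_expansion[OF assms(1-3)] by metis
  define v where "v = (\<Sum>b\<in>B. s (r (e b)) b)"
  have v: "v \<in> V"
    unfolding v_def using B(2) by (intro subspace_sum[OF sub] subspace_scale[OF sub]) auto
  have vsf: "vector_space (\<lambda>c (p :: 'v \<Rightarrow> 'k) x. c * p x)"
    by (rule vector_space_fun[OF vector_space_mult])
  have "r p = p v" if p: "p \<in> functionals s V" for p
  proof -
    have pl: "linear_on s (*) V UNIV p" using p by (simp add: functionals_def)
    have "r p = r (\<Sum>b\<in>B. (\<lambda>x. p b * e b x))"
      using exp[OF p] by simp
    also have "\<dots> = (\<Sum>b\<in>B. p b * r (e b))"
      using linear_on_sum_scale[OF r vsf vector_space_mult subspace_functionals[OF assms(1) sub] B(1), of e p] e
      by simp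
    also have "\<dots> = p v"
      unfolding v_def
      using linear_on_sum_scale[OF pl assms(1) vector_space_mult sub B(1), of id "\<lambda>b. r (e b)"] B(2)
      by (simp add: subset_eq mult.commute)
    finally show ?thesis .
  qed
  with v show thesis using that by blast
qed

lemma functionals_finite_span:
  fixes s :: "'k :: field \<Rightarrow> 'v :: ab_group_add \<Rightarrow> 'v"
  assumes "vector_space s" "finite B0" "module.span s B0 = V"
  shows "\<exists>B. finite B \<and> module.span (\<lambda>c p x. c * p x) B = functionals s V"
proof -
  interpret vector_space s by fact
  interpret f: vector_space "\<lambda>c (p :: 'v \<Rightarrow> 'k) x. c * p x"
    by (rule vector_space_fun[OF vector_space_mult])
  have sub: "subspace V"
    using assms(3) by auto
  obtain B e where B: "finite B" "B \<subseteq> V" and e: "\<And>b. e b \<in> functionals s V"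
    and exp: "\<And>p. p \<in> functionals s V \<Longrightarrow> p = (\<Sum>b\<in>B. (\<lambda>x. p b * e b x))"
    using functionals_expansion[OF assms(1-3)] by metis
  have "(\<Sum>b\<in>B. (\<lambda>x. p b * e b x)) \<in> f.span (e ` B)" for p
    by (intro f.span_sum f.span_scale f.span_base) auto
  then have "p \<in> f.span (e ` B)" if "p \<in> functionals s V" for p
    by (subst exp[OF that])
  then have "functionals s V \<subseteq> f.span (e ` B)" by blast
  moreover have "f.span (e ` B) \<subseteq> functionals s V"
    using e by (intro f.span_minimal subspace_functionals[OF assms(1) sub]) auto
  ultimately show ?thesis
    using B(1) by blast
qed

lemma functional_nonzero:
  fixes s :: "'k :: field \<Rightarrow> 'v :: ab_group_add \<Rightarrow> 'v"
  assumes "vector_space s" "module.subspace s V" and x: "x \<in> V" "\<And>p. p \<in> functionals s V \<Longrightarrow> p x = 0"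
  shows "x = 0"
proof (rule ccontr)
  assume "x \<noteq> 0"
  interpret vector_space s by fact
  have "subspace {0}" by (rule subspace_single_0)
  then obtain r where r: "linear_on s (*) UNIV UNIV r" "r x \<noteq> 0"
    using functional_separation[OF assms(1), of "{0}" x] \<open>x \<noteq> 0\<close> by blast
  have "restrict_to V r \<in> functionals s V"
    by (intro restrict_to_functionals assms(1,2) linear_on_mono[OF r(1)]) auto
  from x(2)[OF this] show False
    using r(2) x(1) by simp
qed

text \<open>
  A pairing of \<open>V\<close> and \<open>W\<close> identifies \<open>V / B\<close> with \<open>W\<^sup>*\<close> if and only if it identifies \<open>W\<close> with the
  annihilator of \<open>B\<close>.
\<close>

lemma pairing_iso_iff:
  fixes s :: "'k :: field \<Rightarrow> 'v :: ab_group_add \<Rightarrow> 'v" and t :: "'k \<Rightarrow> 'w :: ab_group_add \<Rightarrow> 'w"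
  assumes s: "vector_space s" "finite V0" "module.span s V0 = V"
    and t: "vector_space t" "finite W0" "module.span t W0 = W"
    and h: "linear_on s (\<lambda>c p x. c * p x) V (functionals t W) h"
    and g: "linear_on t (\<lambda>c p x. c * p x) W (functionals s V) g"
    and gh: "\<And>x w. x \<in> V \<Longrightarrow> w \<in> W \<Longrightarrow> g w x = h x w"
    and B: "module.subspace s B" "B \<subseteq> V"
  shows "h ` V = functionals t W \<and> (\<forall>x\<in>V. h x = 0 \<longleftrightarrow> x \<in> B) \<longleftrightarrow>
    g ` W = {p \<in> functionals s V. \<forall>x\<in>B. p x = 0} \<and> (\<forall>w\<in>W. g w = 0 \<longrightarrow> w = 0)"
proof -
  interpret s: vector_space s by fact
  interpret t: vector_space t by fact
  have sub: "s.subspace V" "t.subspace W"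
    using s(3) t(3) by auto
  have vsf: "vector_space (\<lambda>c (p :: 'x \<Rightarrow> 'k) x. c * p x)"
    by (rule vector_space_fun[OF vector_space_mult])
  note hF = linear_onD(1)[OF h] and gF = linear_onD(1)[OF g]
  show ?thesis
  proof (intro iffI; elim conjE)
    assume hV: "h ` V = functionals t W" and hB: "\<forall>x\<in>V. h x = 0 \<longleftrightarrow> x \<in> B"
    have "g w x = 0" if "w \<in> W" "x \<in> B" for w x
    proof -
      have "x \<in> V" "h x = 0" using that B(2) hB by auto
      then show ?thesis using gh that by simp
    qed
    moreover have "p \<in> g ` W" if p: "p \<in> functionals s V" "\<forall>x\<in>B. p x = 0" for p
    proof -
      \<comment> \<open>As \<open>p\<close> kills the kernel of \<open>h\<close>, it factors through
        \<open>h\<close> as some \<open>r\<close>; by biduality \<open>r\<close> is evaluation at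
        some \<open>w\<close>, which is the required preimage under \<open>g\<close>.\<close>
      have "p x = 0" if "x \<in> V" "h x = 0" for x
        using that hB p(2) by blast
      from functional_factor[OF s(1) vsf sub(1) h functionalsD(1)[OF p(1)] this]
      obtain r where r: "linear_on (\<lambda>c p x. c * p x) (*) UNIV UNIV r" "\<And>x. x \<in> V \<Longrightarrow> r (h x) = p x"
        by blast
      obtain w where w: "w \<in> W" "\<And>q. q \<in> functionals t W \<Longrightarrow> r q = q w"
        using biduality[OF t linear_on_mono[OF r(1)]] by blast
      have "p = g w"
      proof (rule functionals_ext[OF p(1) gF[OF w(1)]])
        show "p x = g w x" if x: "x \<in> V" for x
          using r(2)[OF x] w(2)[OF hF[OF x]] gh[OF x w(1)] by simp
      qed
      then show ?thesis using w(1) by blast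
    qed
    moreover have "w = 0" if w: "w \<in> W" "g w = 0" for w
    proof (rule functional_nonzero[OF t(1) sub(2) w(1)])
      fix p assume "p \<in> functionals t W"
      then obtain x where "x \<in> V" "p = h x" using hV by blast
      then show "p w = 0" using gh[of x w] w by simp
    qed
    ultimately show "g ` W = {p \<in> functionals s V. \<forall>x\<in>B. p x = 0} \<and> (\<forall>w\<in>W. g w = 0 \<longrightarrow> w = 0)"
      using gF by blast
  next
    assume gW: "g ` W = {p \<in> functionals s V. \<forall>x\<in>B. p x = 0}" and g0: "\<forall>w\<in>W. g w = 0 \<longrightarrow> w = 0"
    have "p \<in> h ` V" if p: "p \<in> functionals t W" for p
    proof -
      \<comment> \<open>The same factorization with the two sides exchanged, where the kernel
        condition is now the injectivity of \<open>g\<close>.\<close>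
      have "p w = 0" if "w \<in> W" "g w = 0" for w
        using that g0 linear_on_zero[OF functionalsD(1)[OF p] t.subspace_0[OF sub(2)]] by auto
      from functional_factor[OF t(1) vsf sub(2) g functionalsD(1)[OF p] this]
      obtain r where r: "linear_on (\<lambda>c p x. c * p x) (*) UNIV UNIV r" "\<And>w. w \<in> W \<Longrightarrow> r (g w) = p w"
        by blast
      obtain x where x: "x \<in> V" "\<And>q. q \<in> functionals s V \<Longrightarrow> r q = q x"
        using biduality[OF s linear_on_mono[OF r(1)]] by blast
      have "p = h x"
      proof (rule functionals_ext[OF p hF[OF x(1)]])
        show "p w = h x w" if w: "w \<in> W" for w
          using r(2)[OF w] x(2)[OF gF[OF w]] gh[OF x(1) w] by simp
      qed
      then show ?thesis using x(1) by blast
    qed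
    then have "h ` V = functionals t W"
      using hF by blast
    moreover have "h x = 0 \<longleftrightarrow> x \<in> B" if x: "x \<in> V" for x
    proof
      assume xB: "x \<in> B"
      have "g w \<in> {p \<in> functionals s V. \<forall>x\<in>B. p x = 0}" if "w \<in> W" for w
        unfolding gW[symmetric] using that by (rule imageI)
      then have "h x w = 0 w" for w
        using xB gh[OF x, of w] functionalsD(2)[OF hF[OF x], of w] by (cases "w \<in> W") auto
      then show "h x = 0" by blast
    next
      assume hx: "h x = 0"
      show "x \<in> B"
      proof (rule ccontr)
        assume "x \<notin> B"
        \<comment> \<open>This functional annihilates \<open>B\<close>, so it has the form
          \<open>g w\<close>; but then its value at \<open>x\<close> is
          \<open>h x w = 0\<close>.\<close>
        then obtain p where p: "linear_on s (*) UNIV UNIV p" "\<And>y. y \<in> B \<Longrightarrow> p y = 0" "p x \<noteq> 0"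
          using functional_separation[OF s(1) B(1)] by blast
        have "restrict_to V p \<in> functionals s V"
          by (intro restrict_to_functionals s(1) sub(1) linear_on_mono[OF p(1)]) auto
        then have "restrict_to V p \<in> g ` W"
          unfolding gW using p(2) by (auto simp: restrict_to_def)
        then obtain w where w: "w \<in> W" "restrict_to V p = g w" by blast
        have "p x = restrict_to V p x"
          using x by simp
        also have "\<dots> = 0"
          unfolding w(2) using gh[OF x w(1)] hx by simp
        finally show False
          using p(3) by simp
      qed
    qed
    ultimately show "h ` V = functionals t W \<and> (\<forall>x\<in>V. h x = 0 \<longleftrightarrow> x \<in> B)" by blast
  qed
qed

section \<open>Complexes and quasi-isomorphisms\<close>

text \<open>The only contact with quotient sets. From here on homology is handled through
  representatives: injectivity is a condition on kernels, surjectivity holds up to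
  boundaries.\<close>

lemma quotient_map_bij_iff:
  fixes f :: "'v :: ab_group_add \<Rightarrow> 'w :: ab_group_add"
  assumes Z: "\<And>x y. x \<in> Z \<Longrightarrow> y \<in> Z \<Longrightarrow> x - y \<in> Z"
    and B: "B \<subseteq> Z" "0 \<in> B" "\<And>x y. x \<in> B \<Longrightarrow> y \<in> B \<Longrightarrow> x - y \<in> B"
    and Z': "\<And>x y. x \<in> Z' \<Longrightarrow> y \<in> Z' \<Longrightarrow> x - y \<in> Z'"
    and B': "B' \<subseteq> Z'" "0 \<in> B'" "\<And>x y. x \<in> B' \<Longrightarrow> y \<in> B' \<Longrightarrow> x - y \<in> B'"
    and f: "\<And>x. x \<in> Z \<Longrightarrow> f x \<in> Z'" "\<And>x. x \<in> B \<Longrightarrow> f x \<in> B'"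
      "\<And>x y. x \<in> Z \<Longrightarrow> y \<in> Z \<Longrightarrow> f (x - y) = f x - f y"
  defines "R \<equiv> {(x, y). x \<in> Z \<and> y \<in> Z \<and> x - y \<in> B}"
    and "R' \<equiv> {(x, y). x \<in> Z' \<and> y \<in> Z' \<and> x - y \<in> B'}"
  shows "bij_betw (\<lambda>X. R' `` (f ` X)) (Z // R) (Z' // R') \<longleftrightarrow>
    (\<forall>x\<in>Z. f x \<in> B' \<longrightarrow> x \<in> B) \<and> (\<forall>y\<in>Z'. \<exists>x\<in>Z. y - f x \<in> B')"
proof -
  have equivI: "equiv W {(x, y). x \<in> W \<and> y \<in> W \<and> x - y \<in> A}"
    if 0: "0 \<in> A" and diff: "\<And>x y. x \<in> A \<Longrightarrow> y \<in> A \<Longrightarrow> x - y \<in> A" for W A :: "'u :: ab_group_add set"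
  proof -
    let ?r = "{(x, y). x \<in> W \<and> y \<in> W \<and> x - y \<in> A}"
    have sym: "y - x \<in> A" if "x - y \<in> A" for x y
      using diff[OF 0 that] by simp
    have "trans ?r"
    proof (rule transI)
      fix x y z assume "(x, y) \<in> ?r" "(y, z) \<in> ?r"
      then show "(x, z) \<in> ?r"
        using diff[of "x - y" "z - y"] sym[of y z] by simp
    qed
    moreover have "sym ?r"
      using sym by (auto intro: symI)
    ultimately show ?thesis
      using 0 by (auto simp: equiv_def refl_on_def)
  qed
  have eR: "equiv Z R" and eR': "equiv Z' R'"
    unfolding R_def R'_def using B(2,3) B'(2,3) by (intro equivI; simp)+
  have eq: "R `` {x} = R `` {y} \<longleftrightarrow> x - y \<in> B" if "x \<in> Z" "y \<in> Z" for x y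
    using eq_equiv_class_iff[OF eR that] that by (simp add: R_def)
  have eq': "R' `` {x} = R' `` {y} \<longleftrightarrow> x - y \<in> B'" if "x \<in> Z'" "y \<in> Z'" for x y
    using eq_equiv_class_iff[OF eR' that] that by (simp add: R'_def)
  \<comment> \<open>The image of a class may be only part of a class, hence the saturation by
    \<open>R'\<close> in \<open>homology_map\<close>. The result does not depend on the
    representative because \<open>f\<close> sends \<open>B\<close> into \<open>B'\<close>.\<close>
  have cls: "R' `` (f ` (R `` {x})) = R' `` {f x}" if x: "x \<in> Z" for x
  proof -
    have "R' `` {f y} = R' `` {f x}" if "y \<in> R `` {x}" for y
    proof -
      have y: "y \<in> Z" "R `` {y} = R `` {x}"
        using that equiv_class_eq[OF eR, of x y] by (auto simp: R_def)
      then have "f (y - x) \<in> B'"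
        using f(2) eq x by blast
      then show ?thesis
        using eq' f(1,3) x y(1) by simp
    qed
    then have "(\<Union>y\<in>R `` {x}. R' `` {f y}) = (\<Union>y\<in>R `` {x}. R' `` {f x})"
      by (rule SUP_cong[OF refl])
    moreover have "x \<in> R `` {x}"
      using x B(2) by (simp add: R_def)
    ultimately show ?thesis
      by blast
  qed
  have quot: "Z // R = (\<lambda>x. R `` {x}) ` Z" "Z' // R' = (\<lambda>x. R' `` {x}) ` Z'"
    by (auto simp: quotient_def)
  have "inj_on (\<lambda>X. R' `` (f ` X)) (Z // R) \<longleftrightarrow> (\<forall>x\<in>Z. \<forall>y\<in>Z. f (x - y) \<in> B' \<longrightarrow> x - y \<in> B)"
    unfolding inj_on_def quot by (simp add: cls eq eq' f(1,3))
  also have "\<dots> \<longleftrightarrow> (\<forall>x\<in>Z. f x \<in> B' \<longrightarrow> x \<in> B)"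
    using B(1,2) Z by (metis diff_zero subsetD)
  finally have inj: "inj_on (\<lambda>X. R' `` (f ` X)) (Z // R) \<longleftrightarrow> (\<forall>x\<in>Z. f x \<in> B' \<longrightarrow> x \<in> B)" .
  have "(\<lambda>X. R' `` (f ` X)) ` (Z // R) = (\<lambda>x. R' `` {f x}) ` Z"
    unfolding quot image_image by (simp add: cls cong: image_cong_simp)
  moreover have "(\<lambda>x. R' `` {f x}) ` Z = Z' // R' \<longleftrightarrow> (\<forall>y\<in>Z'. \<exists>x\<in>Z. R' `` {y} = R' `` {f x})"
  proof -
    have "R' `` {f x} \<in> (\<lambda>x. R' `` {x}) ` Z'" if "x \<in> Z" for x
      using f(1) that by blast
    then show ?thesis
      unfolding quot set_eq_subset image_subset_iff by (simp add: image_iff set_eq_subset)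
  qed
  ultimately have "(\<lambda>X. R' `` (f ` X)) ` (Z // R) = Z' // R' \<longleftrightarrow> (\<forall>y\<in>Z'. \<exists>x\<in>Z. y - f x \<in> B')"
    using eq' f(1) by simp
  then show ?thesis
    unfolding bij_betw_def inj by blast
qed

lemma persistence_moduleD:
  assumes "persistence_module M"
  shows "vector_space (scl M)" "module.subspace (scl M) (cmp M z)"
    "\<exists>B. finite B \<and> module.span (scl M) B = cmp M z"
    "z \<le> w \<Longrightarrow> linear_on (scl M) (scl M) (cmp M z) (cmp M w) (str M z w)"
    "x \<in> cmp M z \<Longrightarrow> str M z z x = x"
    "z \<le> w \<Longrightarrow> w \<le> u \<Longrightarrow> x \<in> cmp M z \<Longrightarrow> str M w u (str M z w x) = str M z u x"
  using assms by (auto simp: persistence_module_def)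

lemma persistence_module_zero_mem:
  assumes "persistence_module M"
  shows "0 \<in> cmp M z"
proof -
  interpret vector_space "scl M" using assms by (rule persistence_moduleD)
  show ?thesis using persistence_moduleD(2)[OF assms] by (rule subspace_0)
qed

lemma morphismD:
  assumes "morphism M N f"
  shows "linear_on (scl M) (scl N) (cmp M z) (cmp N z) (f z)"
    "z \<le> w \<Longrightarrow> x \<in> cmp M z \<Longrightarrow> f w (str M z w x) = str N z w (f z x)"
    "x \<in> cmp M z \<Longrightarrow> f z x \<in> cmp N z"
  using assms by (auto simp: morphism_def linear_on_def)

lemma morphism_diff:
  assumes "persistence_module M" "morphism M N f" "x \<in> cmp M z" "y \<in> cmp M z"
  shows "f z (x - y) = f z x - f z y"
  using linear_on_diff[OF morphismD(1)[OF assms(2)] assms(3,4)] persistence_moduleD(1,2)[OF assms(1)]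
  by blast

lemma morphism_zero:
  assumes "persistence_module M" "morphism M N f"
  shows "f z 0 = 0"
  using linear_on_zero[OF morphismD(1)[OF assms(2)] persistence_module_zero_mem[OF assms(1)]] .

lemma morphism_comp:
  assumes "morphism M N f" "morphism N P g"
  shows "morphism M P (\<lambda>z x. g z (f z x))"
  using assms linear_on_comp[OF morphismD(1)[OF assms(1)] morphismD(1)[OF assms(2)]]
  by (auto simp: morphism_def linear_on_def)

lemma complexD:
  assumes "complex C"
  shows "persistence_module (obj C q)" "morphism (obj C q) (obj C (q - 1)) (bd C q)"
    "x \<in> cmp (obj C q) z \<Longrightarrow> bd C (q - 1) z (bd C q z x) = 0"
  using assms by (auto simp: complex_def)

lemma complex_bd_succ:
  assumes "complex C"
  shows "morphism (obj C (q + 1)) (obj C q) (bd C (q + 1))"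
    "x \<in> cmp (obj C (q + 1)) z \<Longrightarrow> bd C q z (bd C (q + 1) z x) = 0"
  using complexD(2)[OF assms, of "q + 1"] complexD(3)[OF assms, of x "q + 1"] by simp_all

lemma subspace_cycles:
  assumes "complex C"
  shows "module.subspace (scl (obj C q)) (cycles C q z)"
proof -
  note P = complexD(1)[OF assms] and m = complexD(2)[OF assms, of q]
  interpret vector_space "scl (obj C q)" using P by (rule persistence_moduleD)
  interpret v: vector_space "scl (obj C (q - 1))" using P by (rule persistence_moduleD)
  show ?thesis
    using persistence_moduleD(2)[OF P, of q z] morphism_zero[OF P m] morphismD(1)[OF m, of z]
    by (simp add: subspace_def cycles_def linear_on_def)
qed

lemma subspace_boundaries:
  assumes "complex C"
  shows "module.subspace (scl (obj C q)) (boundaries C q z)"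
  unfolding boundaries_def
  using linear_on_subspace_image[OF morphismD(1)[OF complex_bd_succ(1)[OF assms]]]
    persistence_moduleD(1,2)[OF complexD(1)[OF assms]] by blast

lemma boundaries_subset_cycles:
  assumes "complex C"
  shows "boundaries C q z \<subseteq> cycles C q z"
  using complex_bd_succ[OF assms] morphismD(3)[OF complex_bd_succ(1)[OF assms]]
  by (auto simp: boundaries_def cycles_def)

lemma chain_mapD:
  assumes "chain_map f C D"
  shows "morphism (obj C q) (obj D q) (f q)"
    "x \<in> cmp (obj C q) z \<Longrightarrow> f (q - 1) z (bd C q z x) = bd D q z (f q z x)"
  using assms by (auto simp: chain_map_def)

lemma chain_map_cycles:
  assumes "complex C" "chain_map f C D" "x \<in> cycles C q z"
  shows "f q z x \<in> cycles D q z"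
  using assms(3) chain_mapD(2)[OF assms(2), of x q z] morphismD(3)[OF chain_mapD(1)[OF assms(2)], of x q z]
    morphism_zero[OF complexD(1)[OF assms(1)] chain_mapD(1)[OF assms(2)], of "q - 1" z]
  by (simp add: cycles_def)

lemma chain_map_boundaries:
  assumes "chain_map f C D" "x \<in> boundaries C q z"
  shows "f q z x \<in> boundaries D q z"
  using assms(2) chain_mapD(2)[OF assms(1), of _ "q + 1" z] morphismD(3)[OF chain_mapD(1)[OF assms(1)]]
  by (auto simp: boundaries_def)

lemma quasi_isomorphism_iff:
  assumes "complex C" "complex D"
  shows "quasi_isomorphism f C D \<longleftrightarrow> chain_map f C D \<and>
    (\<forall>q z. (\<forall>x\<in>cycles C q z. f q z x \<in> boundaries D q z \<longrightarrow> x \<in> boundaries C q z) \<and>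
      (\<forall>y\<in>cycles D q z. \<exists>x\<in>cycles C q z. y - f q z x \<in> boundaries D q z))"
proof -
  have "bij_betw (homology_map D f q z) (homology C q z) (homology D q z) \<longleftrightarrow>
      (\<forall>x\<in>cycles C q z. f q z x \<in> boundaries D q z \<longrightarrow> x \<in> boundaries C q z) \<and>
      (\<forall>y\<in>cycles D q z. \<exists>x\<in>cycles C q z. y - f q z x \<in> boundaries D q z)"
    if f: "chain_map f C D" for q z
  proof -
    interpret c: vector_space "scl (obj C q)" using complexD(1)[OF assms(1)] by (rule persistence_moduleD)
    interpret d: vector_space "scl (obj D q)" using complexD(1)[OF assms(2)] by (rule persistence_moduleD)
    note subs = subspace_cycles[OF assms(1)] subspace_cycles[OF assms(2)]
      subspace_boundaries[OF assms(1)] subspace_boundaries[OF assms(2)]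
    show ?thesis
      unfolding homology_map_def homology_def homologous_def
      using c.subspace_diff[OF subs(1)] c.subspace_diff[OF subs(3)] c.subspace_0[OF subs(3)]
        d.subspace_diff[OF subs(2)] d.subspace_diff[OF subs(4)] d.subspace_0[OF subs(4)]
        boundaries_subset_cycles[OF assms(1)] boundaries_subset_cycles[OF assms(2)]
        chain_map_cycles[OF assms(1) f] chain_map_boundaries[OF f]
        morphism_diff[OF complexD(1)[OF assms(1)] chain_mapD(1)[OF f]]
      by (intro quotient_map_bij_iff) (auto simp: cycles_def)
  qed
  then show ?thesis
    unfolding quasi_isomorphism_def by blast
qed

section \<open>Quasi-isomorphisms to and from a single module\<close>

lemma persistence_module_zero:
  assumes "persistence_module M"
  shows "persistence_module (M\<lparr>cmp := \<lambda>z. {0}\<rparr>)"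
proof -
  interpret vector_space "scl M" using assms by (rule persistence_moduleD)
  have "str M z w 0 = 0" if "z \<le> w" for z w
    using linear_on_zero[OF persistence_moduleD(4)[OF assms that] persistence_module_zero_mem[OF assms]] .
  moreover have "\<exists>B. finite B \<and> span B = {0}"
    using span_empty by blast
  ultimately show ?thesis
    unfolding persistence_module_def linear_on_def by (simp add: subspace_def vector_space_axioms)
qed

lemma persistence_module_str_zero:
  assumes "persistence_module M" "z \<le> w"
  shows "str M z w 0 = 0"
  using linear_on_zero[OF persistence_moduleD(4)[OF assms] persistence_module_zero_mem[OF assms(1)]] .

lemma complex_stalk:
  assumes "persistence_module M"
  shows "complex (stalk M)"
proof -
  interpret vector_space "scl M" using assms by (rule persistence_moduleD)
  show ?thesis
    using assms persistence_module_zero[OF assms] persistence_module_zero_mem[OF assms]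
      persistence_module_str_zero[OF assms]
    by (auto simp: complex_def stalk_def morphism_def linear_on_def)
qed

lemma stalk_simps:
  assumes "persistence_module M"
  shows "cycles (stalk M) q z = (if q = 0 then cmp M z else {0})" "boundaries (stalk M) q z = {0}"
  using persistence_module_zero_mem[OF assms]
  by (auto simp: stalk_def cycles_def boundaries_def)

text \<open>The complex vanishes in degree -1, so all elements of degree 0 are cycles. What remains
  of the quasi-isomorphism is an augmentation onto \<open>N\<close> with the boundaries as kernel,
  and exactness in the other degrees.\<close>

lemma quasi_isomorphism_to_stalk_iff:
  fixes C :: "('k :: field, 'v :: ab_group_add, 'n :: finite) cplx" and N :: "('k, 'w :: ab_group_add, 'n) pmod"
  assumes C: "complex C" and N: "persistence_module N" and zero: "\<forall>q<0. is_zero (obj C q)"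
  shows "(\<exists>f. quasi_isomorphism f C (stalk N)) \<longleftrightarrow>
    (\<forall>q z. q \<noteq> 0 \<longrightarrow> cycles C q z \<subseteq> boundaries C q z) \<and>
    (\<exists>h. morphism (obj C 0) N h \<and> (\<forall>z. h z ` cmp (obj C 0) z = cmp N z \<and>
      (\<forall>x\<in>cmp (obj C 0) z. h z x = 0 \<longleftrightarrow> x \<in> boundaries C 0 z)))"
    (is "?L \<longleftrightarrow> ?R")
proof -
  have Z0: "cycles C 0 z = cmp (obj C 0) z" for z
  proof -
    have "cmp (obj C (0 - 1)) z = {0}"
      using zero by (simp add: is_zero_def)
    then show ?thesis
      using morphismD(3)[OF complexD(2)[OF C, of 0], of _ z] by (auto simp: cycles_def)
  qed
  note iff = quasi_isomorphism_iff[OF C complex_stalk[OF N]] and simps = stalk_simps[OF N]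
  show ?thesis
  proof
    assume ?L
    then obtain f where f: "quasi_isomorphism f C (stalk N)" by blast
    then have ch: "chain_map f C (stalk N)"
      and inj: "\<And>q z x. x \<in> cycles C q z \<Longrightarrow> f q z x = 0 \<Longrightarrow> x \<in> boundaries C q z"
      and surj: "\<And>q z y. y \<in> cycles (stalk N) q z \<Longrightarrow> \<exists>x\<in>cycles C q z. y = f q z x"
      unfolding iff simps by auto
    have cyc: "f q z x \<in> cycles (stalk N) q z" if "x \<in> cycles C q z" for q z x
      using chain_map_cycles[OF C ch that] .
    have bnd: "f q z x = 0" if "x \<in> boundaries C q z" for q z x
      using chain_map_boundaries[OF ch that] by (simp add: simps)
    have "morphism (obj C 0) N (f 0)"
      using chain_mapD(1)[OF ch, of 0] by (simp add: stalk_def)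
    moreover have "f 0 z ` cmp (obj C 0) z = cmp N z" for z
      using cyc[of _ 0 z] surj[of _ 0 z] unfolding Z0 simps by auto
    moreover have "cycles C q z \<subseteq> boundaries C q z" if "q \<noteq> 0" for q z
      using cyc[of _ q z] inj[of _ q z] that by (auto simp: simps)
    moreover have "f 0 z x = 0 \<longleftrightarrow> x \<in> boundaries C 0 z" if "x \<in> cmp (obj C 0) z" for x z
      using inj[of x 0 z] bnd[of x 0 z] that by (auto simp: Z0)
    ultimately show ?R
      by (intro conjI exI[of _ "f 0"]) simp_all
  next
    assume R: ?R
    obtain h where h0: "morphism (obj C 0) N h" "\<forall>z. h z ` cmp (obj C 0) z = cmp N z \<and>
        (\<forall>x\<in>cmp (obj C 0) z. h z x = 0 \<longleftrightarrow> x \<in> boundaries C 0 z)"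
      using R by (elim conjE exE) (rule that)
    have h: "morphism (obj C 0) N h" "\<And>z. h z ` cmp (obj C 0) z = cmp N z"
      "\<And>x z. x \<in> cmp (obj C 0) z \<Longrightarrow> h z x = 0 \<longleftrightarrow> x \<in> boundaries C 0 z"
      using h0 by auto
    define f where "f q = (if q = 0 then h else (\<lambda>z x. 0))" for q :: int
    interpret N: vector_space "scl N" using N by (rule persistence_moduleD)
    have "morphism (obj C q) (obj (stalk N) q) (f q)" for q
      using h(1) persistence_module_str_zero[OF N] persistence_module_zero_mem[OF N]
      by (auto simp: f_def stalk_def morphism_def linear_on_def)
    \<comment> \<open>Only \<open>q = 1\<close> matters, where \<open>h\<close> has to kill the
      boundaries; for other \<open>q\<close> the map \<open>f (q - 1)\<close> is zero.\<close>
    moreover have "f (q - 1) z (bd C q z x) = 0" if "x \<in> cmp (obj C q) z" for q z x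
    proof (cases "q = 1")
      case True
      then have "bd C q z x \<in> boundaries C 0 z"
        using that by (auto simp: boundaries_def)
      then show ?thesis
        using True h(3)[of "bd C q z x" z] boundaries_subset_cycles[OF C, of 0 z] by (auto simp: f_def Z0)
    qed (simp add: f_def)
    ultimately have "chain_map f C (stalk N)"
      by (simp add: chain_map_def stalk_def)
    moreover have "\<exists>x\<in>cycles C q z. y = f q z x" if "y \<in> cycles (stalk N) q z" for q z y
    proof -
      interpret c: vector_space "scl (obj C q)" using complexD(1)[OF C] by (rule persistence_moduleD)
      have "0 \<in> cycles C q z"
        using subspace_cycles[OF C] by (rule c.subspace_0)
      then show ?thesis
        using that h(2)[of z] Z0[of z] by (cases "q = 0") (auto simp: simps f_def)
    qed
    moreover have "x \<in> boundaries C q z" if "x \<in> cycles C q z" "f q z x = 0" for q z x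
      using that h(3)[of x z] conjunct1[OF R, rule_format, of q z] Z0[of z] by (cases "q = 0") (auto simp: f_def)
    ultimately show ?L
      unfolding iff simps by (intro exI[of _ f]) auto
  qed
qed

text \<open>Dually, the complex vanishes in degree 1, so only zero is a boundary in degree 0 and the
  homology there is the space of cycles, with which the coaugmentation identifies
  \<open>M\<close>.\<close>

lemma quasi_isomorphism_from_stalk_iff:
  fixes C :: "('k :: field, 'v :: ab_group_add, 'n :: finite) cplx" and M :: "('k, 'w :: ab_group_add, 'n) pmod"
  assumes C: "complex C" and M: "persistence_module M" and zero: "\<forall>q>0. is_zero (obj C q)"
  shows "(\<exists>f. quasi_isomorphism f (stalk M) C) \<longleftrightarrow>
    (\<forall>q z. q \<noteq> 0 \<longrightarrow> cycles C q z \<subseteq> boundaries C q z) \<and>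
    (\<exists>h. morphism M (obj C 0) h \<and> (\<forall>z. h z ` cmp M z = cycles C 0 z \<and>
      (\<forall>x\<in>cmp M z. h z x = 0 \<longrightarrow> x = 0)))"
    (is "?L \<longleftrightarrow> ?R")
proof -
  have B0: "boundaries C 0 z = {0}" for z
  proof -
    have "cmp (obj C (0 + 1)) z = {0}"
      using zero by (simp add: is_zero_def)
    then show ?thesis
      using morphism_zero[OF complexD(1)[OF C] complex_bd_succ(1)[OF C, of 0]] by (simp add: boundaries_def)
  qed
  note iff = quasi_isomorphism_iff[OF complex_stalk[OF M] C] and simps = stalk_simps[OF M]
  show ?thesis
  proof
    assume ?L
    then obtain f where f: "quasi_isomorphism f (stalk M) C" by blast
    then have ch: "chain_map f (stalk M) C"
      and inj: "\<And>q z x. x \<in> cycles (stalk M) q z \<Longrightarrow> f q z x \<in> boundaries C q z \<Longrightarrow> x = 0"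
      and surj: "\<And>q z y. y \<in> cycles C q z \<Longrightarrow> \<exists>x\<in>cycles (stalk M) q z. y - f q z x \<in> boundaries C q z"
      unfolding iff simps by auto
    have cyc: "f q z x \<in> cycles C q z" if "x \<in> cycles (stalk M) q z" for q z x
      using chain_map_cycles[OF complex_stalk[OF M] ch that] .
    have m: "morphism M (obj C 0) (f 0)"
      using chain_mapD(1)[OF ch, of 0] by (simp add: stalk_def)
    have f0: "f q z 0 = 0" for q z
      using morphism_zero[OF complexD(1)[OF complex_stalk[OF M]] chain_mapD(1)[OF ch]] .
    have "f 0 z ` cmp M z = cycles C 0 z" for z
      using cyc[of _ 0 z] surj[of _ 0 z] unfolding B0 simps by auto
    moreover have "cycles C q z \<subseteq> boundaries C q z" if "q \<noteq> 0" for q z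
      using surj[of _ q z] f0 that by (auto simp: simps)
    moreover have "x = 0" if "x \<in> cmp M z" "f 0 z x = 0" for x z
      using inj[of x 0 z] that by (simp add: B0 simps)
    ultimately show ?R
      using m by (intro conjI exI[of _ "f 0"]) simp_all
  next
    assume R: ?R
    obtain h where h0: "morphism M (obj C 0) h" "\<forall>z. h z ` cmp M z = cycles C 0 z \<and>
        (\<forall>x\<in>cmp M z. h z x = 0 \<longrightarrow> x = 0)"
      using R by (elim conjE exE) (rule that)
    have h: "morphism M (obj C 0) h" "\<And>z. h z ` cmp M z = cycles C 0 z"
      "\<And>x z. x \<in> cmp M z \<Longrightarrow> h z x = 0 \<Longrightarrow> x = 0"
      using h0 by auto
    define f where "f q = (if q = 0 then h else (\<lambda>z x. 0))" for q :: int
    note str0 = persistence_module_str_zero[OF complexD(1)[OF C]]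
      persistence_module_zero_mem[OF complexD(1)[OF C]]
      and bd0 = morphism_zero[OF complexD(1)[OF C] complexD(2)[OF C]]
    have "morphism (obj (stalk M) q) (obj C q) (f q)" for q
    proof -
      interpret c: vector_space "scl (obj C q)" using complexD(1)[OF C] by (rule persistence_moduleD)
      show ?thesis
        using h(1) str0 by (auto simp: f_def stalk_def morphism_def linear_on_def)
    qed
    moreover have "f (q - 1) z 0 = bd C q z (f q z x)" if "x \<in> cmp (obj (stalk M) q) z" for q z x
      using that h(2)[of z] bd0 morphism_zero[OF M h(1)] by (auto simp: stalk_def f_def cycles_def)
    ultimately have "chain_map f (stalk M) C"
      by (simp add: chain_map_def stalk_def)
    moreover have "\<exists>x\<in>cycles (stalk M) q z. y - f q z x \<in> boundaries C q z" if "y \<in> cycles C q z" for q z y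
      using that h(2)[of z] conjunct1[OF R, rule_format, of q z] by (cases "q = 0") (auto simp: simps f_def B0)
    moreover have "x = 0" if "x \<in> cycles (stalk M) q z" "f q z x \<in> boundaries C q z" for q z x
      using that h(3)[of x z] by (cases "q = 0") (auto simp: f_def simps B0)
    ultimately show ?L
      unfolding iff simps by (intro exI[of _ f]) auto
  qed
qed

lemma quasi_isomorphism_comp_iso:
  assumes "complex C" "complex D" "complex E" "quasi_isomorphism f C D" "complex_iso h D E"
  shows "quasi_isomorphism (\<lambda>q z x. h q z (f q z x)) C E"
proof -
  have h: "chain_map h D E" "\<And>q z. bij_betw (h q z) (cmp (obj D q) z) (cmp (obj E q) z)"
    using assms(5) by (auto simp: complex_iso_def isomorphism_def)
  have f: "chain_map f C D"
    and inj: "\<And>q z x. x \<in> cycles C q z \<Longrightarrow> f q z x \<in> boundaries D q z \<Longrightarrow> x \<in> boundaries C q z"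
    and surj: "\<And>q z y. y \<in> cycles D q z \<Longrightarrow> \<exists>x\<in>cycles C q z. y - f q z x \<in> boundaries D q z"
    using assms(4) unfolding quasi_isomorphism_iff[OF assms(1,2)] by auto
  note hcom = chain_mapD(2)[OF h(1)]
  have hinj: "x = y" if "x \<in> cmp (obj D q) z" "y \<in> cmp (obj D q) z" "h q z x = h q z y" for q z x y
    using that h(2) by (meson bij_betw_imp_inj_on inj_onD)
  have hsurj: "\<exists>x\<in>cmp (obj D q) z. y = h q z x" if "y \<in> cmp (obj E q) z" for q z y
    using that h(2)[of q z] by (auto simp: bij_betw_def)
  have hB: "x \<in> boundaries D q z" if x: "x \<in> cmp (obj D q) z" "h q z x \<in> boundaries E q z" for q z x
  proof -
    obtain e where e: "e \<in> cmp (obj E (q + 1)) z" "h q z x = bd E (q + 1) z e"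
      using x(2) by (auto simp: boundaries_def)
    then obtain d where d: "d \<in> cmp (obj D (q + 1)) z" "e = h (q + 1) z d"
      using hsurj by blast
    then have "h q z (bd D (q + 1) z d) = h q z x"
      using hcom[of d "q + 1" z] e by simp
    then have "bd D (q + 1) z d = x"
      using hinj x(1) morphismD(3)[OF complex_bd_succ(1)[OF assms(2)] d(1)] by blast
    then show ?thesis
      using d by (auto simp: boundaries_def)
  qed
  have "chain_map (\<lambda>q z x. h q z (f q z x)) C E"
    using f h(1) morphism_comp[OF chain_mapD(1)[OF f] chain_mapD(1)[OF h(1)]]
      morphismD(3)[OF chain_mapD(1)[OF f]]
    by (auto simp: chain_map_def)
  moreover have "x \<in> boundaries C q z"
    if "x \<in> cycles C q z" "h q z (f q z x) \<in> boundaries E q z" for x q z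
    using inj[OF that(1)] hB[OF _ that(2)] that(1) morphismD(3)[OF chain_mapD(1)[OF f]]
    by (auto simp: cycles_def)
  moreover have "\<exists>x\<in>cycles C q z. y - h q z (f q z x) \<in> boundaries E q z" if y: "y \<in> cycles E q z" for q z y
  proof -
    obtain d where d: "d \<in> cmp (obj D q) z" "y = h q z d"
      using hsurj y unfolding cycles_def by blast
    have "h (q - 1) z (bd D q z d) = h (q - 1) z 0"
      using hcom[OF d(1)] y d(2) morphism_zero[OF complexD(1)[OF assms(2)] chain_mapD(1)[OF h(1)]]
      by (simp add: cycles_def)
    then have "bd D q z d = 0"
      using hinj morphismD(3)[OF complexD(2)[OF assms(2)] d(1)]
        persistence_module_zero_mem[OF complexD(1)[OF assms(2)]] by blast
    then obtain x where x: "x \<in> cycles C q z" "d - f q z x \<in> boundaries D q z"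
      using surj d(1) by (force simp: cycles_def)
    have "f q z x \<in> cmp (obj D q) z"
      using x(1) morphismD(3)[OF chain_mapD(1)[OF f]] by (auto simp: cycles_def)
    then have "h q z (d - f q z x) = y - h q z (f q z x)"
      using morphism_diff[OF complexD(1)[OF assms(2)] chain_mapD(1)[OF h(1)] d(1)] d(2) by blast
    then show ?thesis
      using x chain_map_boundaries[OF h(1) x(2)] by auto
  qed
  ultimately show ?thesis
    unfolding quasi_isomorphism_iff[OF assms(1,3)] by blast
qed

text \<open>The properties of \<open>M\<close> are listed one by one so that the lemma also covers
  the module \<open>K\<close> of cycles in \<open>represents_injective_resolution_iff\<close>, for
  which \<open>persistence_module\<close> is not established.\<close>

lemma isomorphism_inverse:
  assumes vs: "vector_space (scl M)" and sub: "\<And>z. module.subspace (scl M) (cmp M z)"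
    and str: "\<And>z w x. z \<le> w \<Longrightarrow> x \<in> cmp M z \<Longrightarrow> str M z w x \<in> cmp M w" and f: "isomorphism M N f"
  shows "isomorphism N M (\<lambda>z. inv_into (cmp M z) (f z))"
proof -
  have m: "morphism M N f" and bij: "\<And>z. bij_betw (f z) (cmp M z) (cmp N z)"
    using f by (auto simp: isomorphism_def)
  let ?g = "\<lambda>z. inv_into (cmp M z) (f z)"
  have "?g w (str N z w y) = str M z w (?g z y)" if zw: "z \<le> w" and y: "y \<in> cmp N z" for z w y
  proof -
    obtain x where x: "x \<in> cmp M z" "y = f z x"
      using y bij_betw_imp_surj_on[OF bij] by blast
    then show ?thesis
      using bij_betw_inv_into_left[OF bij] str[OF zw] morphismD(2)[OF m zw, symmetric] by simp
  qed
  then show ?thesis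
    using linear_on_inv_into[OF vs sub morphismD(1)[OF m] bij] bij_betw_inv_into[OF bij]
    by (simp add: isomorphism_def morphism_def)
qed

lemma complex_iso_inverse:
  assumes C: "complex C" and "complex_iso h C D"
  shows "complex_iso (\<lambda>q z. inv_into (cmp (obj C q) z) (h q z)) D C"
proof -
  let ?g = "\<lambda>q z. inv_into (cmp (obj C q) z) (h q z)"
  have h: "chain_map h C D" "\<And>q. isomorphism (obj C q) (obj D q) (h q)"
    using assms(2) by (auto simp: complex_iso_def)
  note P = persistence_moduleD[OF complexD(1)[OF C]]
  have bij: "bij_betw (h q z) (cmp (obj C q) z) (cmp (obj D q) z)" for q z
    using h(2) by (simp add: isomorphism_def)
  have iso: "isomorphism (obj D q) (obj C q) (?g q)" for q
    using linear_onD(1)[OF P(4)] by (intro isomorphism_inverse P h) auto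
  have "?g (q - 1) z (bd D q z y) = bd C q z (?g q z y)" if "y \<in> cmp (obj D q) z" for q z y
  proof -
    obtain x where x: "x \<in> cmp (obj C q) z" "y = h q z x"
      using \<open>y \<in> cmp (obj D q) z\<close> bij_betw_imp_surj_on[OF bij] by blast
    then show ?thesis
      using bij_betw_inv_into_left[OF bij] morphismD(3)[OF complexD(2)[OF C]]
        chain_mapD(2)[OF h(1) x(1), symmetric] by simp
  qed
  with iso show ?thesis
    by (simp add: complex_iso_def chain_map_def isomorphism_def)
qed

lemma quasi_isomorphism_iso_iff:
  assumes "complex C" "complex D" "complex E" "complex_iso h D E"
  shows "(\<exists>f. quasi_isomorphism f C D) \<longleftrightarrow> (\<exists>f. quasi_isomorphism f C E)"
  using quasi_isomorphism_comp_iso[OF assms(1,2,3) _ assms(4)]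
    quasi_isomorphism_comp_iso[OF assms(1,3,2) _ complex_iso_inverse[OF assms(2,4)]] by blast

section \<open>Dual modules and dual complexes\<close>

lemma vec_uminus_le_iff [simp]: "- w \<le> - z \<longleftrightarrow> z \<le> (w :: int ^ 'n)"
  by (simp add: less_eq_vec_def)

lemma dual_simps:
  "scl (dual M) = (\<lambda>c p x. c * p x)"
  "cmp (dual M) z = functionals (scl M) (cmp M (- z))"
  "str (dual M) z w p = restrict_to (cmp M (- w)) (\<lambda>x. p (str M (- w) (- z) x))"
  by (auto simp: dual_def functionals_def restrict_to_def)

lemma dual_map_eq: "dual_map M f z p = restrict_to (cmp M (- z)) (\<lambda>x. p (f (- z) x))"
  by (auto simp: dual_map_def restrict_to_def)

lemma functionals_comp:
  assumes "vector_space s" "module.subspace s V" "linear_on s t V W f" "p \<in> functionals t W"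
  shows "restrict_to V (\<lambda>x. p (f x)) \<in> functionals s V"
  using restrict_to_functionals[OF assms(1,2) linear_on_comp[OF assms(3) functionalsD(1)[OF assms(4)]]] .

lemma linear_on_precomp:
  assumes "vector_space s" "module.subspace s V" "linear_on s t V W f"
  shows "linear_on (\<lambda>c p x. c * p x) (\<lambda>c p x. c * p x) (functionals t W) (functionals s V)
    (\<lambda>p. restrict_to V (\<lambda>x. p (f x)))"
  using functionals_comp[OF assms] by (auto simp: linear_on_def restrict_to_def fun_eq_iff)

lemma persistence_module_dual:
  assumes M: "persistence_module M"
  shows "persistence_module (dual M)"
proof -
  note D = persistence_moduleD[OF M]
  have "\<exists>B. finite B \<and> module.span (scl (dual M)) B = cmp (dual M) z" for z
  proof -
    obtain B where B: "finite B" "module.span (scl M) B = cmp M (- z)"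
      using D(3) by blast
    show ?thesis
      using functionals_finite_span[OF D(1) B] by (simp add: dual_simps)
  qed
  moreover have "str (dual M) z z p = p" if "p \<in> cmp (dual M) z" for z p
    using that D(5) by (auto simp: dual_simps restrict_to_def fun_eq_iff dest: functionalsD(2))
  moreover have "str (dual M) w u (str (dual M) z w p) = str (dual M) z u p"
    if "z \<le> w" "w \<le> u" for z w u p
    using that D(6)[of "- u" "- w" "- z"] linear_onD(1)[OF D(4)[of "- u" "- w"]]
    by (auto simp: dual_simps restrict_to_def fun_eq_iff)
  moreover have "linear_on (scl (dual M)) (scl (dual M)) (cmp (dual M) z) (cmp (dual M) w) (str (dual M) z w)"
    if "z \<le> w" for z w
    using linear_on_precomp[OF D(1,2) D(4)[of "- w" "- z"]] that
    by (simp add: dual_simps(1,2) dual_simps(3)[abs_def])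
  ultimately show ?thesis
    unfolding persistence_module_def
    using vector_space_fun[OF vector_space_mult] subspace_functionals[OF D(1,2)]
    by (simp add: dual_simps(1,2))
qed

lemma morphism_dual_map:
  assumes M: "persistence_module M" and f: "morphism M N f"
  shows "morphism (dual N) (dual M) (dual_map M f)"
proof -
  note D = persistence_moduleD[OF M]
  have "linear_on (scl (dual N)) (scl (dual M)) (cmp (dual N) z) (cmp (dual M) z) (dual_map M f z)" for z
    using linear_on_precomp[OF D(1,2) morphismD(1)[OF f], of "- z"]
    by (simp add: dual_simps dual_map_eq[abs_def])
  moreover have "dual_map M f w (str (dual N) z w p) = str (dual M) z w (dual_map M f z p)"
    if "z \<le> w" for z w p
    using that morphismD(2,3)[OF f] linear_onD(1)[OF D(4)[of "- w" "- z"]]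
    by (auto simp: dual_simps dual_map_eq restrict_to_def fun_eq_iff)
  ultimately show ?thesis
    by (simp add: morphism_def)
qed

lemma dual_complex_simps:
  "obj (dual_complex C) q = dual (obj C (- q))"
  "bd (dual_complex C) q = dual_map (obj C (1 - q)) (bd C (1 - q))"
  by (simp_all add: dual_complex_def)

text \<open>This is applied where neither side is known to be a complex. For the converse, every
  functional kills the second differential of \<open>x\<close>, and functionals separate
  points.\<close>

lemma complex_dual_iff:
  assumes P: "\<And>q. persistence_module (obj C q)"
    and m: "\<And>q. morphism (obj C q) (obj C (q - 1)) (bd C q)"
  shows "complex (dual_complex C) \<longleftrightarrow> complex C"
proof -
  have m': "morphism (obj C (1 - q)) (obj C (- q)) (bd C (1 - q))" for q
    using m[of "1 - q"] by simp
  have m'': "morphism (obj C (2 - q)) (obj C (1 - q)) (bd C (2 - q))" for q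
    using m[of "2 - q"] by simp
  have dd: "bd (dual_complex C) (q - 1) z (bd (dual_complex C) q z p) =
      restrict_to (cmp (obj C (2 - q)) (- z)) (\<lambda>x. p (bd C (1 - q) (- z) (bd C (2 - q) (- z) x)))" for q z p
    using morphismD(3)[OF m''[of q]]
    by (auto simp: dual_complex_simps dual_map_eq restrict_to_def fun_eq_iff)
  have p0: "p 0 = 0" if "p \<in> functionals (scl (obj C q)) (cmp (obj C q) z)" for p q z
    using linear_on_zero[OF functionalsD(1)[OF that] persistence_module_zero_mem[OF P]] .
  have 1: "persistence_module (obj (dual_complex C) q)" for q
    by (simp add: dual_complex_simps persistence_module_dual P)
  have 2: "morphism (obj (dual_complex C) q) (obj (dual_complex C) (q - 1)) (bd (dual_complex C) q)" for q
    using morphism_dual_map[OF P m'[of q]] by (simp add: dual_complex_simps)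
  show ?thesis
  proof
    assume "complex C"
    then have "bd C (1 - q) z (bd C (2 - q) z x) = 0" if "x \<in> cmp (obj C (2 - q)) z" for q z x
      using complexD(3)[of C x "2 - q" z] that by simp
    then have "bd (dual_complex C) (q - 1) z (bd (dual_complex C) q z p) = 0"
      if "p \<in> cmp (obj (dual_complex C) q) z" for q z p
      unfolding dd using that p0[of p "- q" "- z"]
      by (auto simp: dual_complex_simps dual_simps restrict_to_def fun_eq_iff)
    with 1 2 show "complex (dual_complex C)"
      by (simp add: complex_def)
  next
    assume D: "complex (dual_complex C)"
    have "bd C (q - 1) z (bd C q z x) = 0" if x: "x \<in> cmp (obj C q) z" for q z x
    proof (rule functional_nonzero[OF persistence_moduleD(1,2)[OF P[of "q - 2"]]])
      have "bd C q z x \<in> cmp (obj C (q - 1)) z"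
        using morphismD(3)[OF m x] .
      from morphismD(3)[OF m this] show "bd C (q - 1) z (bd C q z x) \<in> cmp (obj C (q - 2)) z"
        by simp
      fix p assume p: "p \<in> functionals (scl (obj C (q - 2))) (cmp (obj C (q - 2)) z)"
      then have "bd (dual_complex C) (2 - q - 1) (- z) (bd (dual_complex C) (2 - q) (- z) p) = 0"
        by (intro complexD(3)[OF D]) (simp add: dual_complex_simps dual_simps)
      from fun_cong[OF this, of x] show "p (bd C (q - 1) z (bd C q z x)) = 0"
        unfolding dd using x by simp
    qed
    with P m show "complex C"
      by (simp add: complex_def)
  qed
qed

lemma cycles_dual:
  assumes C: "complex C"
  shows "cycles (dual_complex C) q z =
    {p \<in> functionals (scl (obj C (- q))) (cmp (obj C (- q)) (- z)). \<forall>x\<in>boundaries C (- q) (- z). p x = 0}"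
proof -
  have "1 - q = - q + 1" by simp
  then show ?thesis
    by (auto simp: cycles_def boundaries_def dual_complex_simps dual_simps dual_map_eq
        restrict_to_def fun_eq_iff)
qed

lemma boundaries_dual:
  "boundaries (dual_complex C) q z =
    (\<lambda>r. restrict_to (cmp (obj C (- q)) (- z)) (\<lambda>x. r (bd C (- q) (- z) x))) `
      functionals (scl (obj C (- q - 1))) (cmp (obj C (- q - 1)) (- z))"
  by (auto simp: boundaries_def dual_complex_simps dual_simps dual_map_eq)

text \<open>A cocycle vanishes on boundaries; if these are all the cycles, it factors through the
  differential and is a coboundary. Conversely, a cycle that does not bound is separated from the
  boundaries by a functional, which is then a cocycle but no coboundary, since coboundaries vanish
  on cycles.\<close>

lemma exact_dual_iff:
  assumes C: "complex C"
  shows "cycles (dual_complex C) q z \<subseteq> boundaries (dual_complex C) q z \<longleftrightarrow>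
    cycles C (- q) (- z) \<subseteq> boundaries C (- q) (- z)"
proof
  note P = complexD(1)[OF C] and D = persistence_moduleD[OF complexD(1)[OF C]]
  assume exact: "cycles C (- q) (- z) \<subseteq> boundaries C (- q) (- z)"
  show "cycles (dual_complex C) q z \<subseteq> boundaries (dual_complex C) q z"
  proof
    fix p assume "p \<in> cycles (dual_complex C) q z"
    then have p: "p \<in> functionals (scl (obj C (- q))) (cmp (obj C (- q)) (- z))"
        and 0: "\<And>x. x \<in> boundaries C (- q) (- z) \<Longrightarrow> p x = 0"
      by (auto simp: cycles_dual[OF C])
    have "p x = 0" if "x \<in> cmp (obj C (- q)) (- z)" "bd C (- q) (- z) x = 0" for x
      using that exact 0 by (auto simp: cycles_def)
    from functional_factor[OF D(1) D(1) D(2) morphismD(1)[OF complexD(2)[OF C]] functionalsD(1)[OF p] this]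
    obtain r where r: "linear_on (scl (obj C (- q - 1))) (*) UNIV UNIV r"
        "\<And>x. x \<in> cmp (obj C (- q)) (- z) \<Longrightarrow> r (bd C (- q) (- z) x) = p x"
      by blast
    define r' where "r' = restrict_to (cmp (obj C (- q - 1)) (- z)) r"
    have r': "r' \<in> functionals (scl (obj C (- q - 1))) (cmp (obj C (- q - 1)) (- z))"
      unfolding r'_def by (intro restrict_to_functionals D linear_on_mono[OF r(1)]) auto
    have "p = restrict_to (cmp (obj C (- q)) (- z)) (\<lambda>x. r' (bd C (- q) (- z) x))"
      using r(2) functionalsD(2)[OF p] morphismD(3)[OF complexD(2)[OF C, of "- q"], of _ "- z"]
      by (auto simp: r'_def restrict_to_def fun_eq_iff)
    then show "p \<in> boundaries (dual_complex C) q z"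
      using r' unfolding boundaries_dual by blast
  qed
next
  note P = complexD(1)[OF C] and D = persistence_moduleD[OF complexD(1)[OF C]]
  assume exact: "cycles (dual_complex C) q z \<subseteq> boundaries (dual_complex C) q z"
  show "cycles C (- q) (- z) \<subseteq> boundaries C (- q) (- z)"
  proof (rule subsetI, rule ccontr)
    fix x assume x: "x \<in> cycles C (- q) (- z)" "x \<notin> boundaries C (- q) (- z)"
    obtain p where p: "linear_on (scl (obj C (- q))) (*) UNIV UNIV p"
        "\<And>y. y \<in> boundaries C (- q) (- z) \<Longrightarrow> p y = 0" "p x \<noteq> 0"
      using functional_separation[OF D(1) subspace_boundaries[OF C] x(2)] by blast
    define p' where "p' = restrict_to (cmp (obj C (- q)) (- z)) p"
    have "p' \<in> functionals (scl (obj C (- q))) (cmp (obj C (- q)) (- z))"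
      unfolding p'_def by (intro restrict_to_functionals D linear_on_mono[OF p(1)]) auto
    moreover have "p' y = 0" if "y \<in> boundaries C (- q) (- z)" for y
      using p(2)[OF that] by (simp add: p'_def restrict_to_def)
    ultimately have "p' \<in> boundaries (dual_complex C) q z"
      using exact by (auto simp: cycles_dual[OF C])
    then obtain r where "r \<in> functionals (scl (obj C (- q - 1))) (cmp (obj C (- q - 1)) (- z))"
        "p' = restrict_to (cmp (obj C (- q)) (- z)) (\<lambda>x. r (bd C (- q) (- z) x))"
      unfolding boundaries_dual by blast
    then have "p' x = 0"
      using x(1) linear_on_zero[OF functionalsD(1) persistence_module_zero_mem[OF P]]
      by (auto simp: cycles_def)
    then show False
      using p(3) x(1) by (simp add: p'_def cycles_def)
  qed
qed

text \<open>Maps from \<open>M\<close> to \<open>dual N\<close> and from \<open>N\<close> to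
  \<open>dual M\<close> are the two readings of one bilinear pairing; passing from one to the other
  negates the grade.\<close>

definition transpose_map ::
  "('k :: field, 'v :: ab_group_add, 'n :: finite) pmod \<Rightarrow> (int ^ 'n \<Rightarrow> 'v \<Rightarrow> 'w \<Rightarrow> 'k) \<Rightarrow> int ^ 'n \<Rightarrow> 'w \<Rightarrow> 'v \<Rightarrow> 'k"
where
  "transpose_map M h z y = restrict_to (cmp M (- z)) (\<lambda>x. h (- z) x y)"

lemma morphism_transpose_map:
  fixes M :: "('k :: field, 'v :: ab_group_add, 'n :: finite) pmod" and N :: "('k, 'w :: ab_group_add, 'n) pmod"
  assumes M: "persistence_module M" and h: "morphism M (dual N) h"
  shows "morphism N (dual M) (transpose_map M h)"
  unfolding morphism_def
proof (intro conjI allI impI ballI)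
  note D = persistence_moduleD[OF M]
  have hN: "h z x \<in> functionals (scl N) (cmp N (- z))" if "x \<in> cmp M z" for x z
    using morphismD(3)[OF h that] by (simp add: dual_simps)
  have "linear_on (scl M) (*) (cmp M (- z)) UNIV (\<lambda>x. h (- z) x y)" for z y
    using morphismD(1)[OF h, of "- z"] by (auto simp: linear_on_def dual_simps)
  then have "transpose_map M h z y \<in> functionals (scl M) (cmp M (- z))" for z y
    unfolding transpose_map_def by (intro restrict_to_functionals D)
  then show "linear_on (scl N) (scl (dual M)) (cmp N z) (cmp (dual M) z) (transpose_map M h z)" for z
    using functionalsD(1)[OF hN, of _ "- z"]
    by (auto simp: linear_on_def transpose_map_def dual_simps(1,2) restrict_to_def fun_eq_iff)
  fix z w :: "int ^ 'n" and y assume zw: "z \<le> w" and y: "y \<in> cmp N z"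
  have "transpose_map M h w (str N z w y) x = str (dual M) z w (transpose_map M h z y) x" for x
    using zw y morphismD(2)[OF h, of "- w" "- z" x] linear_onD(1)[OF D(4)[of "- w" "- z"]]
    by (auto simp: transpose_map_def dual_simps(3) restrict_to_def)
  then show "transpose_map M h w (str N z w y) = str (dual M) z w (transpose_map M h z y)" by blast
qed

text \<open>An augmentation of \<open>C\<close> to \<open>dual M\<close> and a coaugmentation of
  \<open>dual_complex C\<close> by \<open>M\<close> are transposes of each other, and
  \<open>pairing_iso_iff\<close> matches the conditions on them grade by grade.\<close>

lemma quasi_isomorphism_dual_iff:
  fixes C :: "('k :: field, 'v :: ab_group_add, 'n :: finite) cplx" and M :: "('k, 'w :: ab_group_add, 'n) pmod"
  assumes C: "complex C" and M: "persistence_module M" and zero: "\<forall>q<0. is_zero (obj C q)"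
  shows "(\<exists>f. quasi_isomorphism f C (stalk (dual M))) \<longleftrightarrow>
    (\<exists>f. quasi_isomorphism f (stalk M) (dual_complex C))"
proof -
  note P = complexD(1)[OF C] and D = persistence_moduleD[OF complexD(1)[OF C]]
    and DM = persistence_moduleD[OF M]
  have CD: "complex (dual_complex C)"
    using complex_dual_iff[OF complexD(1,2)[OF C]] C by blast
  have zeroD: "\<forall>q>0. is_zero (obj (dual_complex C) q)"
  proof (intro allI impI)
    fix q :: int assume "q > 0"
    then have "is_zero (obj C (- q))" using zero by simp
    then have 0: "cmp (obj C (- q)) z = {0}" for z by (simp add: is_zero_def)
    interpret vector_space "scl (obj C (- q))" by (rule D)
    have "p x = 0" if "p \<in> functionals (scl (obj C (- q))) {0}" for p x
      using linear_on_zero[OF functionalsD(1)[OF that]] functionalsD(2)[OF that, of x] by (cases "x = 0") auto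
    then have "p = 0" if "p \<in> functionals (scl (obj C (- q))) {0}" for p
      using that by (intro ext) simp
    moreover have "0 \<in> functionals (scl (obj C (- q))) {0}"
      by (simp add: functionals_def linear_on_def)
    ultimately have "functionals (scl (obj C (- q))) {0} = {0}"
      by blast
    then show "is_zero (obj (dual_complex C) q)"
      by (simp add: is_zero_def dual_complex_simps dual_simps(2) 0)
  qed
  have exact: "(\<forall>q z. q \<noteq> 0 \<longrightarrow> cycles (dual_complex C) q z \<subseteq> boundaries (dual_complex C) q z) \<longleftrightarrow>
      (\<forall>q z. q \<noteq> 0 \<longrightarrow> cycles C q z \<subseteq> boundaries C q z)" (is "(\<forall>q z. ?D q z) \<longleftrightarrow> (\<forall>q z. ?C q z)")
  proof -
    \<comment> \<open>Dualizing negates degree and grade, and the excluded degree 0 is fixed by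
      this.\<close>
    have eq: "?D q z \<longleftrightarrow> ?C (- q) (- z)" for q z
      unfolding exact_dual_iff[OF C] by simp
    show ?thesis
    proof (intro iffI allI)
      fix q z
      show "?C q z" if "\<forall>q z. ?D q z"
        using eq[of "- q" "- z"] spec[OF spec[OF that, of "- q"], of "- z"]
        unfolding minus_minus by blast
      show "?D q z" if "\<forall>q z. ?C q z"
        using eq[of q z] spec[OF spec[OF that, of "- q"], of "- z"] by blast
    qed
  qed
  have Z0: "cycles (dual_complex C) 0 z =
      {p \<in> functionals (scl (obj C 0)) (cmp (obj C 0) (- z)). \<forall>x\<in>boundaries C 0 (- z). p x = 0}" for z
    using cycles_dual[OF C, of 0 z] by simp
  have B0: "boundaries C 0 z \<subseteq> cmp (obj C 0) z" for z
    using boundaries_subset_cycles[OF C, of 0 z] by (auto simp: cycles_def)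
  have obj0: "obj (dual_complex C) 0 = dual (obj C 0)"
    by (simp add: dual_complex_simps)
  have pointwise: "h (- z) ` cmp (obj C 0) (- z) = cmp (dual M) (- z) \<and>
      (\<forall>x\<in>cmp (obj C 0) (- z). h (- z) x = 0 \<longleftrightarrow> x \<in> boundaries C 0 (- z)) \<longleftrightarrow>
    g z ` cmp M z = cycles (dual_complex C) 0 z \<and> (\<forall>m\<in>cmp M z. g z m = 0 \<longrightarrow> m = 0)"
    if h: "morphism (obj C 0) (dual M) h" and g: "morphism M (dual (obj C 0)) g"
      and gh: "\<And>x m. x \<in> cmp (obj C 0) (- z) \<Longrightarrow> m \<in> cmp M z \<Longrightarrow> g z m x = h (- z) x m" for h g z
  proof -
    obtain V0 where V0: "finite V0" "module.span (scl (obj C 0)) V0 = cmp (obj C 0) (- z)"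
      using D(3) by blast
    obtain W0 where W0: "finite W0" "module.span (scl M) W0 = cmp M z"
      using DM(3) by blast
    have hl: "linear_on (scl (obj C 0)) (\<lambda>c p x. c * p x) (cmp (obj C 0) (- z)) (functionals (scl M) (cmp M z)) (h (- z))"
      using morphismD(1)[OF h, of "- z"] by (simp add: dual_simps)
    have gl: "linear_on (scl M) (\<lambda>c p x. c * p x) (cmp M z) (functionals (scl (obj C 0)) (cmp (obj C 0) (- z))) (g z)"
      using morphismD(1)[OF g, of z] by (simp add: dual_simps)
    show ?thesis
      unfolding Z0 dual_simps(2) minus_minus
      by (rule pairing_iso_iff[OF D(1) V0 DM(1) W0 hl gl gh subspace_boundaries[OF C] B0])
  qed
  have LR: "(\<exists>h. morphism (obj C 0) (dual M) h \<and> (\<forall>z. h z ` cmp (obj C 0) z = cmp (dual M) z \<and>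
      (\<forall>x\<in>cmp (obj C 0) z. h z x = 0 \<longleftrightarrow> x \<in> boundaries C 0 z))) \<longleftrightarrow>
    (\<exists>g. morphism M (dual (obj C 0)) g \<and> (\<forall>z. g z ` cmp M z = cycles (dual_complex C) 0 z \<and>
      (\<forall>m\<in>cmp M z. g z m = 0 \<longrightarrow> m = 0)))" (is "(\<exists>h. ?m h \<and> (\<forall>z. ?L h z)) \<longleftrightarrow> (\<exists>g. ?m' g \<and> (\<forall>z. ?R g z))")
  proof
    assume "\<exists>h. ?m h \<and> (\<forall>z. ?L h z)"
    then obtain h where h: "?m h" "\<forall>z. ?L h z" by (elim conjE exE) (rule that)
    let ?g = "transpose_map (obj C 0) h"
    have g: "?m' ?g"
      by (rule morphism_transpose_map[OF P h(1)])
    have "?R ?g z" for z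
      by (rule iffD1[OF pointwise[OF h(1) g] spec[OF h(2)]]) (simp add: transpose_map_def)
    with g show "\<exists>g. ?m' g \<and> (\<forall>z. ?R g z)" by (intro exI[of _ ?g]) simp
  next
    assume "\<exists>g. ?m' g \<and> (\<forall>z. ?R g z)"
    then obtain g where g: "?m' g" "\<forall>z. ?R g z" by (elim conjE exE) (rule that)
    let ?h = "transpose_map M g"
    have h: "?m ?h"
      by (rule morphism_transpose_map[OF M g(1)])
    have "?L ?h (- z)" for z
      by (rule iffD2[OF pointwise[OF h g(1)] spec[OF g(2)]]) (simp add: transpose_map_def)
    from this[of "- z" for z] have "?L ?h z" for z
      unfolding minus_minus .
    with h show "\<exists>h. ?m h \<and> (\<forall>z. ?L h z)" by (intro exI[of _ ?h]) simp
  qed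
  show ?thesis
    unfolding quasi_isomorphism_to_stalk_iff[OF C persistence_module_dual[OF M] zero]
      quasi_isomorphism_from_stalk_iff[OF CD M zeroD] exact obj0
    by (rule conj_cong[OF refl LR])
qed

section \<open>Subquotients of graded complexes on boxes\<close>

text \<open>\<open>R\<close> is kept apart from the complement of \<open>T\<close> because a
  coordinate in neither set is unconstrained, as in the middle complex of each step.\<close>

definition box :: "'n set \<Rightarrow> 'n set \<Rightarrow> int ^ 'n \<Rightarrow> int ^ 'n :: finite \<Rightarrow> bool" where
  "box T R z g \<longleftrightarrow> (\<forall>i\<in>T. z $ i < g $ i) \<and> (\<forall>i\<in>R. g $ i \<le> z $ i)"

text \<open>
  The condition under which discarding the generators outside \<open>P'\<close> commutes with the differentials
  of the subquotients spanned by the generators with grades in \<open>P\<close> and in \<open>P'\<close>.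
\<close>

definition compat :: "(int ^ 'n :: finite \<Rightarrow> bool) \<Rightarrow> (int ^ 'n \<Rightarrow> bool) \<Rightarrow> bool" where
  "compat P P' \<longleftrightarrow> (\<forall>g' g. g' \<le> g \<longrightarrow> P g \<longrightarrow> P' g' \<longrightarrow> (P' g \<longleftrightarrow> P g'))"

text \<open>Convexity makes the generators in \<open>P\<close> span a subquotient of the whole
  complex, so that the truncated differential still squares to zero.\<close>

definition convex_pred :: "(int ^ 'n :: finite \<Rightarrow> bool) \<Rightarrow> bool" where
  "convex_pred P \<longleftrightarrow> (\<forall>a b c. a \<le> b \<longrightarrow> b \<le> c \<longrightarrow> P a \<longrightarrow> P c \<longrightarrow> P b)"

lemma convex_box: "convex_pred (box T R z)"
  unfolding convex_pred_def box_def less_eq_vec_def by (meson order_trans less_le_trans)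

text \<open>The first of three instances of \<open>compat\<close>: the structure map from
  \<open>z\<close> to \<open>w\<close>. The next two are the inclusion of the subcomplex where
  \<open>i\<close> is bounded above, and the projection to the quotient complex where
  \<open>i\<close> is bounded below.\<close>

lemma compat_box: "z \<le> w \<Longrightarrow> compat (box T R z) (box T R w)"
  unfolding compat_def box_def less_eq_vec_def by (meson order_trans less_le_trans le_less_trans)

lemma compat_box_lower: "compat (box T (insert i R) z) (box T R z)"
  unfolding compat_def box_def less_eq_vec_def by (auto intro: order_trans)

lemma compat_box_upper: "compat (box T R z) (box (insert i T) R z)"
  unfolding compat_def box_def less_eq_vec_def by (auto intro: order_trans less_le_trans)

text \<open>Only grades and entries are kept; whether they present free or injective modules is
  decided later by the choice of box. By \<open>bounded\<close> there are finitely many generators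
  in all degrees together.\<close>

locale graded_complex =
  fixes G :: "int \<Rightarrow> (int ^ 'n :: finite) list" and a :: "int \<Rightarrow> nat \<Rightarrow> nat \<Rightarrow> 'k :: field"
  assumes graded: "i < length (G (q - 1)) \<Longrightarrow> j < length (G q) \<Longrightarrow> a q i j \<noteq> 0 \<Longrightarrow> G (q - 1) ! i \<le> G q ! j"
    and square_zero: "i < length (G (q - 2)) \<Longrightarrow> k < length (G q) \<Longrightarrow>
      (\<Sum>j<length (G (q - 1)). a (q - 1) i j * a q j k) = 0"
    and bounded: "finite {q. G q \<noteq> []}"
begin

definition D :: "int \<Rightarrow> (nat \<Rightarrow> 'k) \<Rightarrow> nat \<Rightarrow> 'k" where
  "D q x i = (if i < length (G (q - 1)) then \<Sum>j<length (G q). a q i j * x j else 0)"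

definition V :: "(int ^ 'n \<Rightarrow> bool) \<Rightarrow> int \<Rightarrow> (nat \<Rightarrow> 'k) set" where
  "V P q = {x. \<forall>j. x j \<noteq> 0 \<longrightarrow> j < length (G q) \<and> P (G q ! j)}"

text \<open>One truncation plays three roles: inclusion of a subcomplex, projection to a quotient
  complex, and structure map between grades.\<close>

definition res :: "(int ^ 'n \<Rightarrow> bool) \<Rightarrow> int \<Rightarrow> (nat \<Rightarrow> 'k) \<Rightarrow> nat \<Rightarrow> 'k" where
  "res P q x j = (if j < length (G q) \<and> P (G q ! j) then x j else 0)"

definition d :: "(int ^ 'n \<Rightarrow> bool) \<Rightarrow> int \<Rightarrow> (nat \<Rightarrow> 'k) \<Rightarrow> nat \<Rightarrow> 'k" where
  "d P q x = res P (q - 1) (D q x)"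

definition Z :: "(int ^ 'n \<Rightarrow> bool) \<Rightarrow> int \<Rightarrow> (nat \<Rightarrow> 'k) set" where
  "Z P q = {x \<in> V P q. d P q x = 0}"

definition Bd :: "(int ^ 'n \<Rightarrow> bool) \<Rightarrow> int \<Rightarrow> (nat \<Rightarrow> 'k) set" where
  "Bd P q = d P (q + 1) ` V P (q + 1)"

lemma D_linear:
  "D q (x + y) = D q x + D q y" "D q (x - y) = D q x - D q y" "D q (\<lambda>j. c * x j) = (\<lambda>j. c * D q x j)"
  by (auto simp: D_def fun_eq_iff algebra_simps sum.distrib sum_subtractf sum_distrib_left)

lemma res_linear:
  "res P q (x + y) = res P q x + res P q y" "res P q (x - y) = res P q x - res P q y"
  "res P q (\<lambda>j. c * x j) = (\<lambda>j. c * res P q x j)" "res P q 0 = 0"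
  by (auto simp: res_def fun_eq_iff)

lemma d_linear:
  "d P q (x + y) = d P q x + d P q y" "d P q (x - y) = d P q x - d P q y"
  "d P q (\<lambda>j. c * x j) = (\<lambda>j. c * d P q x j)"
  by (simp_all add: d_def D_linear res_linear)

lemma d_zero [simp]: "d P q 0 = 0"
  using d_linear(2)[of P q 0 0] by simp

lemma V_closed:
  "x \<in> V P q \<Longrightarrow> y \<in> V P q \<Longrightarrow> x + y \<in> V P q" "x \<in> V P q \<Longrightarrow> y \<in> V P q \<Longrightarrow> x - y \<in> V P q"
  "x \<in> V P q \<Longrightarrow> (\<lambda>j. c * x j) \<in> V P q" "0 \<in> V P q"
  by (force simp: V_def)+

lemma Z_closed:
  "x \<in> Z P q \<Longrightarrow> y \<in> Z P q \<Longrightarrow> x + y \<in> Z P q" "x \<in> Z P q \<Longrightarrow> y \<in> Z P q \<Longrightarrow> x - y \<in> Z P q"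
  "x \<in> Z P q \<Longrightarrow> (\<lambda>j. c * x j) \<in> Z P q" "0 \<in> Z P q"
  using V_closed by (auto simp: Z_def d_linear fun_eq_iff)

lemma Bd_closed:
  "x \<in> Bd P q \<Longrightarrow> y \<in> Bd P q \<Longrightarrow> x + y \<in> Bd P q" "x \<in> Bd P q \<Longrightarrow> y \<in> Bd P q \<Longrightarrow> x - y \<in> Bd P q"
  "x \<in> Bd P q \<Longrightarrow> (\<lambda>j. c * x j) \<in> Bd P q" "0 \<in> Bd P q"
proof -
  show "x \<in> Bd P q \<Longrightarrow> y \<in> Bd P q \<Longrightarrow> x + y \<in> Bd P q"
    using V_closed(1) unfolding Bd_def by (force simp flip: d_linear)
  show "x \<in> Bd P q \<Longrightarrow> y \<in> Bd P q \<Longrightarrow> x - y \<in> Bd P q"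
    using V_closed(2) unfolding Bd_def by (force simp flip: d_linear)
  show "x \<in> Bd P q \<Longrightarrow> (\<lambda>j. c * x j) \<in> Bd P q"
    using V_closed(3) unfolding Bd_def by (force simp flip: d_linear)
  show "0 \<in> Bd P q"
    using V_closed(4) unfolding Bd_def by (intro image_eqI[of _ _ 0]) auto
qed

lemma subspace_Z: "module.subspace (\<lambda>c x j. c * x j) (Z P q)"
proof -
  interpret vector_space "\<lambda>c (x :: nat \<Rightarrow> 'k) j. c * x j"
    by (rule vector_space_fun[OF vector_space_mult])
  show ?thesis
    using Z_closed by (auto simp: subspace_def)
qed

lemma res_in_V [simp]: "res P q x \<in> V P q"
  by (auto simp: res_def V_def)

lemma d_in_V [simp]: "d P q x \<in> V P (q - 1)"
  by (simp add: d_def)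

lemma d_succ_in_V [simp]: "d P (q + 1) x \<in> V P q"
  using d_in_V[of P "q + 1" x] by simp

lemma res_id: "x \<in> V P q \<Longrightarrow> (\<And>g. P g \<Longrightarrow> P' g) \<Longrightarrow> res P' q x = x"
  by (force simp: V_def res_def fun_eq_iff)

lemma V_mono: "(\<And>g. P g \<Longrightarrow> P' g) \<Longrightarrow> V P q \<subseteq> V P' q"
  by (auto simp: V_def)

text \<open>Compare both sides in a row with grade in \<open>P'\<close>. Where entry and coefficient
  are nonzero, the row grade is below the column grade, and \<open>compat\<close> says that
  \<open>P'\<close> keeps the column exactly when \<open>P\<close> keeps the row.\<close>

lemma d_res:
  assumes "compat P P'" "x \<in> V P q"
  shows "d P' q (res P' q x) = res P' (q - 1) (d P q x)"
proof
  fix i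
  show "d P' q (res P' q x) i = res P' (q - 1) (d P q x) i"
  proof (cases "i < length (G (q - 1)) \<and> P' (G (q - 1) ! i)")
    case True
    have "(\<Sum>j<length (G q). a q i j * res P' q x j) =
        (\<Sum>j<length (G q). if P (G (q - 1) ! i) then a q i j * x j else 0)"
    proof (rule sum.cong[OF refl])
      fix j assume "j \<in> {..<length (G q)}"
      then have j: "j < length (G q)" by simp
      show "a q i j * res P' q x j = (if P (G (q - 1) ! i) then a q i j * x j else 0)"
      proof (cases "a q i j = 0 \<or> x j = 0")
        case False
        then have "G (q - 1) ! i \<le> G q ! j" "P (G q ! j)"
          using graded[of i q j] True j assms(2) by (auto simp: V_def)
        then have "P' (G q ! j) \<longleftrightarrow> P (G (q - 1) ! i)"
          using assms(1) True by (auto simp: compat_def)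
        then show ?thesis
          using j by (simp add: res_def)
      qed (auto simp: res_def)
    qed
    then show ?thesis
      using True by (simp add: d_def D_def) (simp add: res_def D_def)
  qed (simp add: d_def, auto simp: res_def)
qed

lemma D_D: "D (q - 1) (D q x) = 0"
proof
  fix i
  have "(\<Sum>j<length (G (q - 1)). a (q - 1) i j * (\<Sum>k<length (G q). a q j k * x k)) = 0"
    if i: "i < length (G (q - 2))"
  proof -
    have "(\<Sum>j<length (G (q - 1)). a (q - 1) i j * (\<Sum>k<length (G q). a q j k * x k)) =
        (\<Sum>j<length (G (q - 1)). \<Sum>k<length (G q). a (q - 1) i j * a q j k * x k)"
      by (simp add: sum_distrib_left mult.assoc)
    also have "\<dots> = (\<Sum>k<length (G q). \<Sum>j<length (G (q - 1)). a (q - 1) i j * a q j k * x k)"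
      by (rule sum.swap)
    also have "\<dots> = (\<Sum>k<length (G q). (\<Sum>j<length (G (q - 1)). a (q - 1) i j * a q j k) * x k)"
      by (simp add: sum_distrib_right)
    also have "\<dots> = 0"
      using i by (intro sum.neutral) (simp add: square_zero)
    finally show ?thesis .
  qed
  then show "D (q - 1) (D q x) i = 0 i"
    by (simp add: D_def)
qed

lemma d_d:
  assumes "convex_pred P" "x \<in> V P q"
  shows "d P (q - 1) (d P q x) = 0"
proof
  fix i
  show "d P (q - 1) (d P q x) i = 0 i"
  proof (cases "i < length (G (q - 2)) \<and> P (G (q - 2) ! i)")
    case True
    have "a (q - 1) i j * d P q x j = a (q - 1) i j * D q x j" if j: "j < length (G (q - 1))" for j
    proof (cases "a (q - 1) i j = 0 \<or> P (G (q - 1) ! j)")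
      case True
      with j show ?thesis by (auto simp: d_def res_def)
    next
      case False
      \<comment> \<open>A nonzero term would place the grade of \<open>j\<close>, which is outside
        \<open>P\<close>, between the grades of \<open>i\<close> and \<open>k\<close>, which are in
        \<open>P\<close>.\<close>
      have "a q j k * x k = 0" if k: "k < length (G q)" for k
      proof (rule ccontr)
        assume *: "a q j k * x k \<noteq> 0"
        then have "P (G q ! k)"
          using assms(2) by (auto simp: V_def)
        moreover have "G (q - 1) ! j \<le> G q ! k"
          using graded[of j q k] j k * by auto
        moreover have "G (q - 2) ! i \<le> G (q - 1) ! j"
          using graded[of i "q - 1" j] j True False by (simp add: algebra_simps)
        ultimately show False
          using assms(1) True False unfolding convex_pred_def by blast
      qed
      then have "(\<Sum>k<length (G q). a q j k * x k) = 0"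
        by (intro sum.neutral) simp
      then have "D q x j = 0"
        by (simp add: D_def)
      then show ?thesis
        by (simp add: d_def res_def)
    qed
    then have "(\<Sum>j<length (G (q - 1)). a (q - 1) i j * d P q x j) =
        (\<Sum>j<length (G (q - 1)). a (q - 1) i j * D q x j)"
      by (intro sum.cong) auto
    then have "D (q - 1) (d P q x) i = D (q - 1) (D q x) i"
      by (simp add: D_def[of "q - 1"])
    then show ?thesis
      by (simp add: D_D d_def[of P "q - 1"] res_def)
  next
    case False
    then show ?thesis
      by (simp add: d_def[of P "q - 1"]) (auto simp: res_def)
  qed
qed

lemma res_Z:
  assumes "compat P P'" "x \<in> Z P q"
  shows "res P' q x \<in> Z P' q"
  using assms d_res[OF assms(1)] by (simp add: Z_def res_linear)

lemma res_Bd: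
  assumes "compat P P'" "x \<in> Bd P q"
  shows "res P' q x \<in> Bd P' q"
proof -
  obtain y where y: "y \<in> V P (q + 1)" "x = d P (q + 1) y"
    using assms(2) by (auto simp: Bd_def)
  then have "res P' q x = d P' (q + 1) (res P' (q + 1) y)"
    using d_res[OF assms(1) y(1)] by simp
  then show ?thesis
    by (auto simp: Bd_def)
qed

text \<open>Boxes at different \<open>z\<close> can select the same generators. This is what allows
  \<open>z\<close> to be moved past all generators in one direction in
  \<open>middle_exact\<close>.\<close>

lemma pred_cong:
  assumes "\<And>q g. g \<in> set (G q) \<Longrightarrow> P g \<longleftrightarrow> P' g"
  shows "Z P = Z P'" "Bd P = Bd P'"
proof -
  have eq: "P (G q ! j) \<longleftrightarrow> P' (G q ! j)" if "j < length (G q)" for q j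
    using assms nth_mem[OF that] .
  then have res: "res P = res P'"
    by (auto simp: res_def fun_eq_iff)
  then have d: "d P = d P'"
    by (auto simp: d_def fun_eq_iff)
  have V: "V P = V P'"
    using eq by (auto simp: V_def fun_eq_iff)
  show "Z P = Z P'" "Bd P = Bd P'"
    using d V by (auto simp: Z_def Bd_def fun_eq_iff)
qed

subsection \<open>Splitting a box along one coordinate\<close>

context
  fixes T R :: "'n set" and i :: 'n and z :: "int ^ 'n"
  assumes acyclic: "\<And>q. Z (box T R z) q \<subseteq> Bd (box T R z) q"
begin

text \<open>The generators in \<open>Q\<close> are divided by whether
  \<open>g $ i \<le> z $ i\<close>. Since differentials do not raise grades, those that satisfy it
  span a subcomplex \<open>A\<close>, with quotient \<open>C\<close>.\<close>

private abbreviation "A \<equiv> box T (insert i R) z"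
private abbreviation "C \<equiv> box (insert i T) R z"
private abbreviation "Q \<equiv> box T R z"

private lemma sub: "A g \<Longrightarrow> Q g" "C g \<Longrightarrow> Q g" "Q g \<Longrightarrow> A g \<longleftrightarrow> \<not> C g"
  by (auto simp: box_def)

private lemma V_sub: "V A q \<subseteq> V Q q" "V C q \<subseteq> V Q q"
  using sub V_mono by blast+

private lemma split: "y \<in> V Q q \<Longrightarrow> y = res A q y + res C q y"
  using sub(3) by (force simp: V_def res_def fun_eq_iff)

private lemma V_A_iff: "y \<in> V Q q \<Longrightarrow> y \<in> V A q \<longleftrightarrow> res C q y = 0"
proof -
  assume y: "y \<in> V Q q"
  show ?thesis
  proof
    assume "y \<in> V A q"
    then show "res C q y = 0"
      using sub by (force simp: V_def res_def fun_eq_iff)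
  next
    assume "res C q y = 0"
    then have "y = res A q y" using split[OF y] by simp
    then show "y \<in> V A q" using res_in_V by metis
  qed
qed

lemma box_d_lower: "x \<in> V A q \<Longrightarrow> d Q q x = d A q x"
  using d_res[OF compat_box_lower[of T i R z], of x q] res_id[of x A q Q]
    res_id[of "d A q x" A "q - 1" Q] sub(1) by simp

lemma box_d_upper: "y \<in> V Q q \<Longrightarrow> d C q (res C q y) = res C (q - 1) (d Q q y)"
  using d_res[OF compat_box_upper] .

text \<open>Elements of \<open>C\<close> are also elements of \<open>Q\<close>, so \<open>y\<close>
  is its own lift, and \<open>d Q\<close> is the connecting homomorphism on representatives.\<close>

lemma connecting_cycle:
  assumes "y \<in> Z C (q + 1)"
  shows "d Q (q + 1) y \<in> Z A q"
proof -
  have y: "y \<in> V C (q + 1)" "d C (q + 1) y = 0" "y \<in> V Q (q + 1)"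
    using assms V_sub by (auto simp: Z_def)
  have "res C q (d Q (q + 1) y) = 0"
    using box_d_upper[OF y(3)] res_id[OF y(1), of C] y(2) by simp
  moreover have "d Q (q + 1) y \<in> V Q q"
    using d_in_V[of Q "q + 1" y] by simp
  ultimately have A: "d Q (q + 1) y \<in> V A q"
    using V_A_iff by blast
  moreover have "d A q (d Q (q + 1) y) = 0"
    using box_d_lower[OF A] d_d[OF convex_box y(3)] by simp
  ultimately show ?thesis by (simp add: Z_def)
qed

text \<open>One direction makes the connecting homomorphism well defined on homology; the other
  makes it injective and is where acyclicity of \<open>Q\<close> enters.\<close>

lemma connecting_boundary_iff:
  assumes y: "y \<in> Z C (q + 1)"
  shows "d Q (q + 1) y \<in> Bd A q \<longleftrightarrow> y \<in> Bd C (q + 1)"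
proof
  have yV: "y \<in> V C (q + 1)" "y \<in> V Q (q + 1)"
    using y V_sub by (auto simp: Z_def)
  {
    assume "d Q (q + 1) y \<in> Bd A q"
    then obtain b where b: "b \<in> V A (q + 1)" "d Q (q + 1) y = d A (q + 1) b"
      by (auto simp: Bd_def)
    \<comment> \<open>\<open>y\<close> and \<open>b\<close> have the same differential in
      \<open>Q\<close>, so their difference is a cycle and bounds there; projecting to
      \<open>C\<close> removes \<open>b\<close> and leaves \<open>y\<close>.\<close>
    then have "d Q (q + 1) (y - b) = 0"
      using box_d_lower[OF b(1)] by (simp add: d_linear)
    moreover have "y - b \<in> V Q (q + 1)"
      using yV b V_sub V_closed(2) by blast
    ultimately have "y - b \<in> Bd Q (q + 1)"
      using acyclic by (auto simp: Z_def)
    then obtain w where w: "w \<in> V Q (q + 1 + 1)" "y - b = d Q (q + 1 + 1) w"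
      by (auto simp: Bd_def)
    have "res C (q + 1) (y - b) = y"
      using res_id[OF yV(1), of C] V_A_iff[of b "q + 1"] b(1) V_sub(1) by (auto simp: res_linear)
    then have "res C (q + 1) (d Q (q + 1 + 1) w) = y"
      unfolding w(2) .
    then have "y = d C (q + 1 + 1) (res C (q + 1 + 1) w)"
      using box_d_upper[OF w(1)] by (simp only: add_diff_cancel_right')
    then show "y \<in> Bd C (q + 1)"
      unfolding Bd_def by (metis image_eqI res_in_V)
  }
  {
    assume "y \<in> Bd C (q + 1)"
    then obtain w where w: "w \<in> V C (q + 1 + 1)" "y = d C (q + 1 + 1) w"
      by (auto simp: Bd_def)
    then have wQ: "w \<in> V Q (q + 1 + 1)" using V_sub by blast
    \<comment> \<open>The differential of \<open>w\<close> in \<open>Q\<close> is \<open>y\<close>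
      plus its part \<open>b\<close> in \<open>A\<close>. As \<open>d Q\<close> squares to zero,
      \<open>d Q y\<close> is minus the boundary of \<open>b\<close>.\<close>
    define b where "b = res A (q + 1) (d Q (q + 1 + 1) w)"
    have "y = res C (q + 1) (d Q (q + 1 + 1) w)"
      using box_d_upper[OF wQ] res_id[OF w(1), of C] w(2) by (simp only: add_diff_cancel_right')
    then have "d Q (q + 1 + 1) w = b + y"
      using split[OF d_succ_in_V] by (metis b_def)
    moreover have "d Q (q + 1) (d Q (q + 1 + 1) w) = 0"
      using d_d[OF convex_box wQ] by (simp only: add_diff_cancel_right')
    ultimately have "d Q (q + 1) y = 0 - d Q (q + 1) b"
      by (simp add: d_linear eq_neg_iff_add_eq_0 add.commute)
    also have "d Q (q + 1) b = d A (q + 1) b"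
      by (rule box_d_lower) (simp add: b_def)
    finally have "d Q (q + 1) y = 0 - d A (q + 1) b" .
    moreover have "d A (q + 1) b \<in> Bd A q"
      by (auto simp: Bd_def b_def)
    ultimately show "d Q (q + 1) y \<in> Bd A q"
      using Bd_closed(2)[OF Bd_closed(4)] by metis
  }
qed

text \<open>A cycle of \<open>A\<close> is a cycle of \<open>Q\<close> and bounds some
  \<open>w\<close> there. The part of \<open>w\<close> in \<open>C\<close> represents the class
  sought, and its part in \<open>A\<close> accounts for the error.\<close>

lemma connecting_surj:
  assumes x: "x \<in> Z A q"
  obtains y where "y \<in> Z C (q + 1)" "x - d Q (q + 1) y \<in> Bd A q"
proof -
  have xV: "x \<in> V A q" "x \<in> V Q q" "d A q x = 0"
    using x V_sub by (auto simp: Z_def)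
  then have "x \<in> Z Q q"
    using box_d_lower[OF xV(1)] by (simp add: Z_def)
  then obtain w where w: "w \<in> V Q (q + 1)" "x = d Q (q + 1) w"
    using acyclic by (auto simp: Bd_def)
  define y where "y = res C (q + 1) w"
  have "d C (q + 1) y = 0"
    using box_d_upper[OF w(1)] V_A_iff[OF xV(2)] xV(1) w(2) by (simp add: y_def)
  then have "y \<in> Z C (q + 1)"
    by (simp add: Z_def y_def)
  moreover have "x - d Q (q + 1) y = d Q (q + 1) (res A (q + 1) w)"
  proof -
    have "x = d Q (q + 1) (res A (q + 1) w + y)"
      using split[OF w(1)] w(2) by (simp add: y_def)
    then show ?thesis by (simp add: d_linear)
  qed
  then have "x - d Q (q + 1) y \<in> Bd A q"
    using box_d_lower[of "res A (q + 1) w" "q + 1"] by (auto simp: Bd_def)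
  ultimately show thesis by (rule that)
qed

lemma connecting_exact_iff: "Z A q \<subseteq> Bd A q \<longleftrightarrow> Z C (q + 1) \<subseteq> Bd C (q + 1)"
proof
  assume "Z A q \<subseteq> Bd A q"
  then show "Z C (q + 1) \<subseteq> Bd C (q + 1)"
    using connecting_cycle connecting_boundary_iff by blast
next
  assume C: "Z C (q + 1) \<subseteq> Bd C (q + 1)"
  show "Z A q \<subseteq> Bd A q"
  proof
    fix x assume "x \<in> Z A q"
    then obtain y where y: "y \<in> Z C (q + 1)" "x - d Q (q + 1) y \<in> Bd A q"
      by (rule connecting_surj)
    then have "d Q (q + 1) y \<in> Bd A q"
      using C connecting_boundary_iff by blast
    from Bd_closed(1)[OF y(2) this] show "x \<in> Bd A q" by simp
  qed
qed

end

text \<open>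
  The restriction to \<open>w\<close> of the lift \<open>y\<close> differs from the lift of the restriction, so naturality holds
  only up to boundaries.
\<close>

lemma connecting_natural:
  assumes "z \<le> w" "\<And>q. Z (box T R z) q \<subseteq> Bd (box T R z) q" "y \<in> Z (box (insert i T) R z) (q + 1)"
  shows "res (box T (insert i R) w) q (d (box T R z) (q + 1) y) -
      d (box T R w) (q + 1) (res (box (insert i T) R w) (q + 1) y) \<in> Bd (box T (insert i R) w) q"
proof -
  have yV: "y \<in> V (box T R z) (q + 1)"
    using assms(3) by (auto simp: Z_def V_def box_def)
  have *: "d (box T R z) (q + 1) y \<in> V (box T (insert i R) z) q"
    using connecting_cycle[OF assms(2,3)] by (simp add: Z_def)
  \<comment> \<open>Every generator of \<open>x\<close> satisfies
    \<open>g $ i \<le> z $ i \<le> w $ i\<close>, so the extra condition at \<open>w\<close> removes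
    nothing.\<close>
  have eq1: "res (box T R w) q x = res (box T (insert i R) w) q x"
    if "x \<in> V (box T (insert i R) z) q" for x
  proof
    fix j
    show "res (box T R w) q x j = res (box T (insert i R) w) q x j"
      using that assms(1) order_trans[of _ "z $ i" "w $ i"]
      by (cases "x j = 0") (auto simp: res_def V_def box_def less_eq_vec_def)
  qed
  \<comment> \<open>The generators with \<open>z $ i < g $ i \<le> w $ i\<close> change sides: they
    belong to the quotient at \<open>z\<close> and to the subcomplex at \<open>w\<close>. The
    boundary of their part of \<open>y\<close> is the error term.\<close>
  have eq2: "res (box T R w) (q + 1) y =
      res (box T (insert i R) w) (q + 1) y + res (box (insert i T) R w) (q + 1) y"
    by (auto simp: res_def box_def fun_eq_iff)
  have "res (box T (insert i R) w) q (d (box T R z) (q + 1) y) =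
      d (box T R w) (q + 1) (res (box T R w) (q + 1) y)"
    using d_res[OF compat_box[OF assms(1)] yV] eq1[OF *] by simp
  also have "\<dots> = d (box T R w) (q + 1) (res (box T (insert i R) w) (q + 1) y) +
      d (box T R w) (q + 1) (res (box (insert i T) R w) (q + 1) y)"
    unfolding eq2 d_linear ..
  also have "d (box T R w) (q + 1) (res (box T (insert i R) w) (q + 1) y) =
      d (box T (insert i R) w) (q + 1) (res (box T (insert i R) w) (q + 1) y)"
    using d_res[OF compat_box_lower[of T i R w], of "res (box T (insert i R) w) (q + 1) y" "q + 1"]
      res_id[of "res (box T (insert i R) w) (q + 1) y" "box T (insert i R) w" "q + 1" "box T R w"]
      res_id[of "d (box T (insert i R) w) (q + 1) (res (box T (insert i R) w) (q + 1) y)"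
        "box T (insert i R) w" q "box T R w"]
      d_in_V[of "box T (insert i R) w" "q + 1"]
    by (simp add: box_def)
  finally have "res (box T (insert i R) w) q (d (box T R z) (q + 1) y) -
      d (box T R w) (q + 1) (res (box (insert i T) R w) (q + 1) y) =
      d (box T (insert i R) w) (q + 1) (res (box T (insert i R) w) (q + 1) y)"
    by (simp only: add_diff_cancel_right')
  then show ?thesis
    unfolding Bd_def by (metis image_eqI res_in_V)
qed

text \<open>\<open>\<psi>\<close> induces isomorphisms from the homology in degree \<open>k\<close> to \<open>M\<close>.\<close>

definition comparison ::
  "('k, 'v :: ab_group_add, 'n) pmod \<Rightarrow> 'n set \<Rightarrow> int \<Rightarrow> (int ^ 'n \<Rightarrow> (nat \<Rightarrow> 'k) \<Rightarrow> 'v) \<Rightarrow> bool"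
where
  "comparison M T k \<psi> \<longleftrightarrow>
    (\<forall>z. linear_on (\<lambda>c x j. c * x j) (scl M) (Z (box T (- T) z) k) (cmp M z) (\<psi> z)) \<and>
    (\<forall>z. \<psi> z ` Z (box T (- T) z) k = cmp M z) \<and>
    (\<forall>z. \<forall>x\<in>Z (box T (- T) z) k. \<psi> z x = 0 \<longleftrightarrow> x \<in> Bd (box T (- T) z) k) \<and>
    (\<forall>z w. z \<le> w \<longrightarrow> (\<forall>x\<in>Z (box T (- T) z) k. \<psi> w (res (box T (- T) w) k x) = str M z w (\<psi> z x)))"

text \<open>With \<open>- T\<close> as second set every coordinate is constrained; a free coordinate
  occurs only in the intermediate complexes.\<close>

definition resolves :: "('k, 'v :: ab_group_add, 'n) pmod \<Rightarrow> 'n set \<Rightarrow> int \<Rightarrow> bool" where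
  "resolves M T k \<longleftrightarrow>
    (\<forall>q z. q \<noteq> k \<longrightarrow> Z (box T (- T) z) q \<subseteq> Bd (box T (- T) z) q) \<and> (\<exists>\<psi>. comparison M T k \<psi>)"

lemma comparisonD:
  assumes "comparison M T k \<psi>"
  shows "linear_on (\<lambda>c x j. c * x j) (scl M) (Z (box T (- T) z) k) (cmp M z) (\<psi> z)"
    "\<psi> z ` Z (box T (- T) z) k = cmp M z"
    "x \<in> Z (box T (- T) z) k \<Longrightarrow> \<psi> z x = 0 \<longleftrightarrow> x \<in> Bd (box T (- T) z) k"
    "z \<le> w \<Longrightarrow> x \<in> Z (box T (- T) z) k \<Longrightarrow> \<psi> w (res (box T (- T) w) k x) = str M z w (\<psi> z x)"
  using assms unfolding comparison_def by simp_all

lemma resolvesD: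
  assumes "resolves M T k"
  shows "q \<noteq> k \<Longrightarrow> Z (box T (- T) z) q \<subseteq> Bd (box T (- T) z) q" "\<exists>\<psi>. comparison M T k \<psi>"
  using assms unfolding resolves_def by simp_all

lemma grades_bounded:
  assumes "finite S"
  obtains K :: int where "\<And>q g. g \<in> set (G q) \<Longrightarrow> \<bar>g $ i\<bar> < K" "\<And>z. z \<in> S \<Longrightarrow> \<bar>z $ i\<bar> < K"
proof -
  let ?A = "S \<union> (\<Union>q\<in>{q. G q \<noteq> []}. set (G q))"
  have "finite ((\<lambda>g. \<bar>g $ i\<bar>) ` ?A)"
    using assms bounded by auto
  then obtain K where K: "\<And>g. g \<in> ?A \<Longrightarrow> \<bar>g $ i\<bar> \<le> K"
    by (meson bdd_above_finite bdd_above.E imageI)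
  have "g \<in> ?A" if "g \<in> set (G q)" for g q
    using that by force
  then have "\<bar>g $ i\<bar> < K + 1" if "g \<in> set (G q)" for g q
    using K[of g] that by force
  moreover have "\<bar>z $ i\<bar> < K + 1" if "z \<in> S" for z
    using K[of z] that by force
  ultimately show thesis by (rule that)
qed

lemma resolves_exact:
  assumes "resolves M T k" "cmp M z = {0}"
  shows "Z (box T (- T) z) q \<subseteq> Bd (box T (- T) z) q"
proof (cases "q = k")
  case True
  obtain \<psi> where "comparison M T k \<psi>"
    using resolvesD(2)[OF assms(1)] by blast
  note \<psi> = comparisonD(2,3)[OF this]
  have "\<psi> z x = 0" if "x \<in> Z (box T (- T) z) k" for x
    using \<psi>(1)[of z] assms(2) that by auto
  then show ?thesis
    using True \<psi>(2) by blast
next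
  case False
  then show ?thesis
    by (rule resolvesD(1)[OF assms(1)])
qed

text \<open>
  The coordinate \<open>i\<close> can be dropped from the conditions on the generators by moving \<open>z\<close> far up
  or far down in direction \<open>i\<close>, out of the support of \<open>M\<close>.
\<close>

lemma middle_exact:
  fixes M :: "('k, 'v :: ab_group_add, 'n) pmod"
  assumes fin: "finite {z. cmp M z \<noteq> {0}}" and i: "i \<notin> T"
    and res: "resolves M T k \<or> resolves M (insert i T) k"
  shows "Z (box T (- insert i T) z) q \<subseteq> Bd (box T (- insert i T) z) q"
proof -
  obtain K :: int where K: "\<And>q g. g \<in> set (G q) \<Longrightarrow> \<bar>g $ i\<bar> < K" "\<And>z. cmp M z \<noteq> {0} \<Longrightarrow> \<bar>z $ i\<bar> < K"
    using grades_bounded[OF fin, of i] by auto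
  define up where "up N = (\<chi> l. if l = i then N else z $ l)" for N
  have up: "up N $ l = (if l = i then N else z $ l)" for N l
    by (simp add: up_def)
  \<comment> \<open>At this height the grade has left the support of \<open>M\<close>, so the
    complex is exact there in all degrees.\<close>
  have zero: "cmp M (up N) = {0}" if "\<bar>N\<bar> \<ge> K" for N
    using K(2)[of "up N"] that by (auto simp: up)
  show ?thesis
    using res
  proof
    assume r: "resolves M T k"
    \<comment> \<open>At height \<open>K\<close> the condition \<open>g $ i \<le> K\<close> holds
      for all generators and drops out.\<close>
    have "box T (- T) (up K) g \<longleftrightarrow> box T (- insert i T) z g" if "g \<in> set (G q)" for q g
      using K(1)[OF that] i by (auto simp: box_def up)
    from pred_cong[OF this] show ?thesis
      using resolves_exact[OF r zero[of K]] by auto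
  next
    assume r: "resolves M (insert i T) k"
    \<comment> \<open>Here it is the strict condition \<open>- K < g $ i\<close> that always holds,
      which is why the bound \<open>K\<close> is strict.\<close>
    have "box (insert i T) (- insert i T) (up (- K)) g \<longleftrightarrow> box T (- insert i T) z g" if "g \<in> set (G q)" for q g
      using K(1)[OF that] i by (auto simp: box_def up)
    from pred_cong[OF this] show ?thesis
      using resolves_exact[OF r zero[of "- K"]] by auto
  qed
qed

text \<open>Whichever side is assumed, \<open>middle_exact\<close> makes the middle complex acyclic.
  From \<open>T\<close> to \<open>insert i T\<close>, the comparison is precomposed with the
  connecting map, which exists on cycles. The converse has to invert that map, which is possible
  only on homology, so preimages up to boundaries are chosen.\<close>

lemma resolves_insert:
  fixes M :: "('k, 'v :: ab_group_add, 'n) pmod"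
  assumes M: "persistence_module M" and fin: "finite {z. cmp M z \<noteq> {0}}" and i: "i \<notin> T"
  shows "resolves M T k \<longleftrightarrow> resolves M (insert i T) (k + 1)"
proof -
  define R where "R = - insert i T"
  have R: "- T = insert i R" "- insert i T = R"
    using i by (auto simp: R_def)
  define A where "A z = box T (insert i R) z" for z
  define C where "C z = box (insert i T) R z" for z
  define Q where "Q z = box T R z" for z
  note defs = A_def C_def Q_def
  have dlin: "linear_on (\<lambda>c x j. c * x j) (\<lambda>c x j. c * x j) (Z (C z) (k + 1)) (Z (A z) k) (d (Q z) (k + 1))"
    if "\<And>z q. Z (Q z) q \<subseteq> Bd (Q z) q" for z
    using connecting_cycle[where i = i, OF that[unfolded Q_def]] unfolding linear_on_def defs
    by (auto simp: d_linear)
  have ZA_vs: "vector_space (\<lambda>c (x :: nat \<Rightarrow> 'k) j. c * x j)"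
    by (rule vector_space_fun[OF vector_space_mult])
  show ?thesis
  proof
    assume r: "resolves M T k"
    have acyc: "Z (Q z) q \<subseteq> Bd (Q z) q" for z q
      using middle_exact[OF fin i] r unfolding R(2) Q_def by blast
    note conn = connecting_cycle[where i = i, OF acyc[unfolded Q_def], folded defs]
      connecting_boundary_iff[where i = i, OF acyc[unfolded Q_def], folded defs]
      connecting_surj[where i = i, OF acyc[unfolded Q_def], folded defs]
      connecting_exact_iff[where i = i, OF acyc[unfolded Q_def], folded defs]
      connecting_natural[where i = i, OF _ acyc[unfolded Q_def], folded defs]
    obtain \<psi> where comp: "comparison M T k \<psi>"
      using resolvesD(2)[OF r] by blast
    note lin = comparisonD(1)[OF comp, unfolded R, folded A_def]
      and surj = comparisonD(2)[OF comp, unfolded R, folded A_def]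
      and ker = comparisonD(3)[OF comp, unfolded R, folded A_def]
      and nat = comparisonD(4)[OF comp, unfolded R, folded A_def]
    define \<psi>' where "\<psi>' z y = \<psi> z (d (Q z) (k + 1) y)" for z y
    \<comment> \<open>Homologous cycles have the same image. This absorbs both the error in
      \<open>connecting_surj\<close> and the failure of strict naturality.\<close>
    have bd0: "\<psi> z x = \<psi> z y" if "x - y \<in> Bd (A z) k" "x \<in> Z (A z) k" "y \<in> Z (A z) k" for x y z
      using ker[of "x - y" z] that linear_on_diff[OF lin that(2,3) ZA_vs subspace_Z] Z_closed(2) by auto
    have "linear_on (\<lambda>c x j. c * x j) (scl M) (Z (C z) (k + 1)) (cmp M z) (\<psi>' z)" for z
      unfolding \<psi>'_def using linear_on_comp[OF dlin[OF acyc] lin] .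
    moreover have "\<psi>' z ` Z (C z) (k + 1) = cmp M z" for z
    proof
      show "\<psi>' z ` Z (C z) (k + 1) \<subseteq> cmp M z"
        using conn(1)[of _ z k] surj[of z] by (auto simp: \<psi>'_def)
      show "cmp M z \<subseteq> \<psi>' z ` Z (C z) (k + 1)"
      proof
        fix m assume "m \<in> cmp M z"
        then obtain x where x: "x \<in> Z (A z) k" "m = \<psi> z x"
          using surj[of z] by auto
        obtain y where y: "y \<in> Z (C z) (k + 1)" "x - d (Q z) (k + 1) y \<in> Bd (A z) k"
          using conn(3)[OF x(1)] by blast
        then have "m = \<psi>' z y"
          using bd0[OF y(2) x(1) conn(1)[OF y(1)]] x(2) by (simp add: \<psi>'_def)
        then show "m \<in> \<psi>' z ` Z (C z) (k + 1)"
          using y(1) by blast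
      qed
    qed
    moreover have "\<psi>' z y = 0 \<longleftrightarrow> y \<in> Bd (C z) (k + 1)" if "y \<in> Z (C z) (k + 1)" for z y
      using ker[OF conn(1)[OF that]] conn(2)[OF that] by (simp add: \<psi>'_def)
    moreover have "\<psi>' w (res (C w) (k + 1) y) = str M z w (\<psi>' z y)"
      if zw: "z \<le> w" and y: "y \<in> Z (C z) (k + 1)" for z w y
    proof -
      have "res (C w) (k + 1) y \<in> Z (C w) (k + 1)"
        using res_Z[OF compat_box[OF zw] y[unfolded C_def]] unfolding C_def .
      then have "\<psi> w (res (A w) k (d (Q z) (k + 1) y)) = \<psi>' w (res (C w) (k + 1) y)"
        unfolding \<psi>'_def
        using res_Z[OF compat_box[OF zw] conn(1)[OF y, unfolded A_def]]
        by (intro bd0 conn(1,5) zw y) (auto simp: A_def)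
      then show ?thesis
        using nat[OF zw conn(1)[OF y]] by (simp add: \<psi>'_def)
    qed
    moreover have "Z (C z) q \<subseteq> Bd (C z) q" if "q \<noteq> k + 1" for q z
    proof -
      have "Z (A z) (q - 1) \<subseteq> Bd (A z) (q - 1)"
        using resolvesD(1)[OF r, of "q - 1" z] that by (simp add: R A_def)
      then show ?thesis
        using conn(4)[of z "q - 1"] by simp
    qed
    ultimately show "resolves M (insert i T) (k + 1)"
      unfolding resolves_def comparison_def R C_def[symmetric] by (intro conjI exI[of _ \<psi>']) simp_all
  next
    assume r: "resolves M (insert i T) (k + 1)"
    have acyc: "Z (Q z) q \<subseteq> Bd (Q z) q" for z q
      using middle_exact[OF fin i] r unfolding R(2) Q_def by blast
    note conn = connecting_cycle[where i = i, OF acyc[unfolded Q_def], folded defs]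
      connecting_boundary_iff[where i = i, OF acyc[unfolded Q_def], folded defs]
      connecting_surj[where i = i, OF acyc[unfolded Q_def], folded defs]
      connecting_exact_iff[where i = i, OF acyc[unfolded Q_def], folded defs]
      connecting_natural[where i = i, OF _ acyc[unfolded Q_def], folded defs]
    obtain \<psi>' where comp: "comparison M (insert i T) (k + 1) \<psi>'"
      using resolvesD(2)[OF r] by blast
    note lin = comparisonD(1)[OF comp, unfolded R, folded C_def]
      and surj = comparisonD(2)[OF comp, unfolded R, folded C_def]
      and ker = comparisonD(3)[OF comp, unfolded R, folded C_def]
      and nat = comparisonD(4)[OF comp, unfolded R, folded C_def]
    \<comment> \<open>\<open>lift z x y\<close> says that the connecting homomorphism sends the
      class of \<open>y\<close> to that of \<open>x\<close>. The relation respects sums, multiples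
      and structure maps, which makes \<open>\<psi>\<close> linear and natural although its
      representatives are arbitrary.\<close>
    define lift where "lift z x y \<longleftrightarrow> y \<in> Z (C z) (k + 1) \<and> x - d (Q z) (k + 1) y \<in> Bd (A z) k" for z x y
    define \<psi> where "\<psi> z x = \<psi>' z (SOME y. lift z x y)" for z x
    have lift_ex: "\<exists>y. lift z x y" if "x \<in> Z (A z) k" for x z
      using conn(3)[OF that] unfolding lift_def by blast
    \<comment> \<open>Two lifts differ by a boundary, because the connecting homomorphism is
      injective on homology.\<close>
    have lift_unique: "\<psi>' z y = \<psi>' z y'" if "lift z x y" "lift z x y'" for x y y' z
    proof -
      have y: "y \<in> Z (C z) (k + 1)" "y' \<in> Z (C z) (k + 1)"
        using that by (auto simp: lift_def)
      have "(x - d (Q z) (k + 1) y') - (x - d (Q z) (k + 1) y) \<in> Bd (A z) k"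
        using Bd_closed(2) that unfolding lift_def by blast
      then have "d (Q z) (k + 1) (y - y') \<in> Bd (A z) k"
        by (simp add: d_linear algebra_simps)
      then have "y - y' \<in> Bd (C z) (k + 1)"
        using conn(2) Z_closed(2)[OF y] by blast
      then have "\<psi>' z (y - y') = 0"
        using ker Z_closed(2)[OF y] by blast
      then show ?thesis
        using linear_on_diff[OF lin y ZA_vs subspace_Z] by simp
    qed
    have \<psi>: "\<psi> z x = \<psi>' z y" if "lift z x y" for x y z
      unfolding \<psi>_def using lift_unique[OF someI[of "lift z x", OF that] that] .
    have "linear_on (\<lambda>c x j. c * x j) (scl M) (Z (A z) k) (cmp M z) (\<psi> z)" for z
      unfolding linear_on_def
    proof (intro conjI ballI allI)
      fix x assume x: "x \<in> Z (A z) k"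
      obtain y where y: "lift z x y" using lift_ex[OF x] by blast
      then show "\<psi> z x \<in> cmp M z"
        using \<psi>[OF y] linear_onD(1)[OF lin] by (simp add: lift_def)
      {
        fix x' assume x': "x' \<in> Z (A z) k"
        obtain y' where y': "lift z x' y'" using lift_ex[OF x'] by blast
        have "(x - d (Q z) (k + 1) y) + (x' - d (Q z) (k + 1) y') \<in> Bd (A z) k"
          using Bd_closed(1) y y' unfolding lift_def by blast
        then have "lift z (x + x') (y + y')"
          using y y' by (auto simp: lift_def d_linear algebra_simps intro: Z_closed)
        then show "\<psi> z (x + x') = \<psi> z x + \<psi> z x'"
          using \<psi> y y' linear_onD(2)[OF lin, of y z y'] by (simp add: lift_def)
      }
      fix c
      have "(\<lambda>j. c * (x - d (Q z) (k + 1) y) j) \<in> Bd (A z) k"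
        using Bd_closed(3) y unfolding lift_def by blast
      moreover have "(\<lambda>j. c * (x - d (Q z) (k + 1) y) j) = (\<lambda>j. c * x j) - d (Q z) (k + 1) (\<lambda>j. c * y j)"
        unfolding d_linear by (simp add: fun_eq_iff algebra_simps)
      ultimately have "lift z (\<lambda>j. c * x j) (\<lambda>j. c * y j)"
        using y by (simp add: lift_def Z_closed)
      then show "\<psi> z (\<lambda>j. c * x j) = scl M c (\<psi> z x)"
        using \<psi> y linear_onD(3)[OF lin, of y z c] by (simp add: lift_def)
    qed
    moreover have "\<psi> z ` Z (A z) k = cmp M z" for z
    proof
      show "\<psi> z ` Z (A z) k \<subseteq> cmp M z"
        using lift_ex \<psi> linear_onD(1)[OF lin] by (fastforce simp: lift_def)
      show "cmp M z \<subseteq> \<psi> z ` Z (A z) k"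
      proof
        fix m assume "m \<in> cmp M z"
        then obtain y where y: "y \<in> Z (C z) (k + 1)" "m = \<psi>' z y"
          using surj[of z] by auto
        have "lift z (d (Q z) (k + 1) y) y"
          using y(1) by (simp add: lift_def Bd_closed)
        then have "m = \<psi> z (d (Q z) (k + 1) y)"
          using \<psi> y(2) by simp
        then show "m \<in> \<psi> z ` Z (A z) k"
          using conn(1)[OF y(1)] by blast
      qed
    qed
    moreover have "\<psi> z x = 0 \<longleftrightarrow> x \<in> Bd (A z) k" if x: "x \<in> Z (A z) k" for z x
    proof -
      obtain y where y: "lift z x y" using lift_ex[OF x] by blast
      have yZ: "y \<in> Z (C z) (k + 1)" using y by (simp add: lift_def)
      have "x \<in> Bd (A z) k \<longleftrightarrow> d (Q z) (k + 1) y \<in> Bd (A z) k"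
        using Bd_closed(2)[of x "A z" k "x - d (Q z) (k + 1) y"]
          Bd_closed(1)[of "x - d (Q z) (k + 1) y" "A z" k "d (Q z) (k + 1) y"] y
        by (auto simp: lift_def)
      then show ?thesis
        using conn(2)[OF yZ] ker[OF yZ] \<psi>[OF y] by simp
    qed
    moreover have "\<psi> w (res (A w) k x) = str M z w (\<psi> z x)"
      if zw: "z \<le> w" and x: "x \<in> Z (A z) k" for z w x
    proof -
      obtain y where y: "lift z x y" using lift_ex[OF x] by blast
      have yZ: "y \<in> Z (C z) (k + 1)" using y by (simp add: lift_def)
      have "res (C w) (k + 1) y \<in> Z (C w) (k + 1)"
        using res_Z[OF compat_box[OF zw] yZ[unfolded C_def]] unfolding C_def .
      \<comment> \<open>Truncating the boundary \<open>x - d Q y\<close> to \<open>w\<close> and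
        adding the naturality error turns a lift at \<open>z\<close> into a lift at
        \<open>w\<close>.\<close>
      moreover have "res (A w) k (x - d (Q z) (k + 1) y) \<in> Bd (A w) k"
        using res_Bd[OF compat_box[OF zw]] y unfolding lift_def A_def by blast
      from Bd_closed(1)[OF this conn(5)[OF zw yZ]]
      have "res (A w) k x - d (Q w) (k + 1) (res (C w) (k + 1) y) \<in> Bd (A w) k"
        by (simp add: res_linear)
      ultimately have "lift w (res (A w) k x) (res (C w) (k + 1) y)"
        by (simp add: lift_def)
      then show ?thesis
        using \<psi> y nat[OF zw yZ] by simp
    qed
    moreover have "Z (A z) q \<subseteq> Bd (A z) q" if "q \<noteq> k" for q z
    proof -
      have "Z (C z) (q + 1) \<subseteq> Bd (C z) (q + 1)"
        using resolvesD(1)[OF r, of "q + 1" z] that by (simp add: R C_def)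
      then show ?thesis
        using conn(4) by blast
    qed
    ultimately show "resolves M T k"
      unfolding resolves_def comparison_def R A_def[symmetric] by (intro conjI exI[of _ \<psi>]) simp_all
  qed
qed

theorem resolves_empty_iff_UNIV:
  fixes M :: "('k, 'v :: ab_group_add, 'n) pmod"
  assumes M: "persistence_module M" and fin: "finite {z. cmp M z \<noteq> {0}}"
  shows "resolves M {} 0 \<longleftrightarrow> resolves M UNIV (int CARD('n))"
proof -
  have "resolves M {} 0 \<longleftrightarrow> resolves M T (int (card T))" for T
  proof (induction T rule: finite_induct[OF finite])
    case 1
    then show ?case by simp
  next
    case (2 i T)
    then show ?case
      using resolves_insert[OF M fin 2(2), of "int (card T)"] by (simp add: add.commute)
  qed
  then show ?thesis .
qed

end

section \<open>Sums of free and of injective modules\<close>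

lemma free_sum_simps:
  "scl (free_sum gs :: ('k :: field, nat \<Rightarrow> 'k, 'n :: finite) pmod) = (\<lambda>c x j. c * x j)"
  "cmp (free_sum gs :: ('k, nat \<Rightarrow> 'k, 'n) pmod) z = {x. \<forall>j. x j \<noteq> 0 \<longrightarrow> j < length gs \<and> gs ! j \<le> z}"
  "x \<in> cmp (free_sum gs :: ('k, nat \<Rightarrow> 'k, 'n) pmod) z \<Longrightarrow> str (free_sum gs) w u x = x"
proof -
  have "finite {j. x j \<noteq> 0}" if "\<forall>j. \<not> j < length gs \<longrightarrow> x j = 0" for x :: "nat \<Rightarrow> 'k"
  proof (rule finite_subset)
    show "{j. x j \<noteq> 0} \<subseteq> {..<length gs}"
      using that unfolding lessThan_def by blast
  qed simp
  then show "cmp (free_sum gs :: ('k, nat \<Rightarrow> 'k, 'n) pmod) z = {x. \<forall>j. x j \<noteq> 0 \<longrightarrow> j < length gs \<and> gs ! j \<le> z}"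
    by (auto simp: free_sum_def direct_sum_def F_def split: if_splits)
  then show "x \<in> cmp (free_sum gs :: ('k, nat \<Rightarrow> 'k, 'n) pmod) z \<Longrightarrow> str (free_sum gs) w u x = x"
    by (auto simp: free_sum_def direct_sum_def F_def fun_eq_iff)
qed (simp add: free_sum_def direct_sum_def F_def)

lemma inj_sum_simps:
  "scl (inj_sum gs :: ('k :: field, nat \<Rightarrow> 'k, 'n :: finite) pmod) = (\<lambda>c x j. c * x j)"
  "cmp (inj_sum gs :: ('k, nat \<Rightarrow> 'k, 'n) pmod) z = {x. \<forall>j. x j \<noteq> 0 \<longrightarrow> j < length gs \<and> z \<le> gs ! j}"
  "str (inj_sum gs :: ('k, nat \<Rightarrow> 'k, 'n) pmod) z w x j = (if j < length gs \<and> w \<le> gs ! j then x j else 0)"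
proof -
  have "finite {j. x j \<noteq> 0}" if "\<forall>j. \<not> j < length gs \<longrightarrow> x j = 0" for x :: "nat \<Rightarrow> 'k"
  proof (rule finite_subset)
    show "{j. x j \<noteq> 0} \<subseteq> {..<length gs}"
      using that unfolding lessThan_def by blast
  qed simp
  then show "cmp (inj_sum gs :: ('k, nat \<Rightarrow> 'k, 'n) pmod) z = {x. \<forall>j. x j \<noteq> 0 \<longrightarrow> j < length gs \<and> z \<le> gs ! j}"
    by (auto simp: inj_sum_def direct_sum_def I_def split: if_splits)
qed (simp_all add: inj_sum_def direct_sum_def I_def)

lemma coordinate_subspace:
  fixes S :: "nat set"
  assumes "finite S"
  shows "module.subspace (\<lambda>c (x :: nat \<Rightarrow> 'k :: field) j. c * x j) {x. \<forall>j. x j \<noteq> 0 \<longrightarrow> j \<in> S}"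
    and "\<exists>B. finite B \<and> module.span (\<lambda>c (x :: nat \<Rightarrow> 'k) j. c * x j) B = {x. \<forall>j. x j \<noteq> 0 \<longrightarrow> j \<in> S}"
proof -
  interpret vector_space "\<lambda>c (x :: nat \<Rightarrow> 'k) j. c * x j"
    by (rule vector_space_fun[OF vector_space_mult])
  show sub: "subspace {x. \<forall>j. x j \<noteq> 0 \<longrightarrow> j \<in> S}"
    by (force simp: subspace_def)
  define e where "e i = (\<lambda>j. if j = i then 1 else 0 :: 'k)" for i :: nat
  have "x \<in> span (e ` S)" if x: "\<forall>j. x j \<noteq> 0 \<longrightarrow> j \<in> S" for x
  proof -
    have "x = (\<Sum>i\<in>S. (\<lambda>j. x i * e i j))"
    proof
      fix j
      have "(\<Sum>i\<in>S. (\<lambda>j. x i * e i j)) j = (\<Sum>i\<in>S. x i * e i j)"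
        by (induction S rule: infinite_finite_induct) auto
      also have "\<dots> = (\<Sum>i\<in>S. if i = j then x i else 0)"
        by (intro sum.cong) (auto simp: e_def split: if_splits)
      finally show "x j = (\<Sum>i\<in>S. (\<lambda>j. x i * e i j)) j"
        using x assms by auto
    qed
    also have "\<dots> \<in> span (e ` S)"
      by (intro span_sum span_scale span_base) auto
    finally show ?thesis .
  qed
  moreover have "span (e ` S) \<subseteq> {x. \<forall>j. x j \<noteq> 0 \<longrightarrow> j \<in> S}"
    using sub by (intro span_minimal) (auto simp: e_def split: if_splits)
  ultimately have "span (e ` S) = {x. \<forall>j. x j \<noteq> 0 \<longrightarrow> j \<in> S}"
    by blast
  then show "\<exists>B. finite B \<and> span B = {x. \<forall>j. x j \<noteq> 0 \<longrightarrow> j \<in> S}"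
    using assms by blast
qed

lemma persistence_module_free_sum:
  "persistence_module (free_sum gs :: ('k :: field, nat \<Rightarrow> 'k, 'n :: finite) pmod)"
proof -
  note fs = free_sum_simps(1)[of gs, where 'k = 'k]
    free_sum_simps(2)[of gs, where 'k = 'k]
  have S: "cmp (free_sum gs :: ('k, nat \<Rightarrow> 'k, 'n) pmod) z = {x. \<forall>j. x j \<noteq> 0 \<longrightarrow> j \<in> {j. j < length gs \<and> gs ! j \<le> z}}" for z
    by (simp add: fs)
  have fin: "finite {j. j < length gs \<and> gs ! j \<le> z}" for z
    by (rule finite_subset[of _ "{..<length gs}"]) auto
  have mono: "cmp (free_sum gs :: ('k, nat \<Rightarrow> 'k, 'n) pmod) z \<subseteq> cmp (free_sum gs) w" if "z \<le> w" for z w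
    using that by (auto simp: fs intro: order_trans)
  have closed: "x + y \<in> cmp (free_sum gs :: ('k, nat \<Rightarrow> 'k, 'n) pmod) z"
      "(\<lambda>j. c * x j) \<in> cmp (free_sum gs :: ('k, nat \<Rightarrow> 'k, 'n) pmod) z"
    if "x \<in> cmp (free_sum gs :: ('k, nat \<Rightarrow> 'k, 'n) pmod) z" "y \<in> cmp (free_sum gs :: ('k, nat \<Rightarrow> 'k, 'n) pmod) z"
    for x y c z
    using that unfolding fs by force+
  have "linear_on (scl (free_sum gs)) (scl (free_sum gs)) (cmp (free_sum gs) z) (cmp (free_sum gs) w)
      (str (free_sum gs :: ('k, nat \<Rightarrow> 'k, 'n) pmod) z w)" if "z \<le> w" for z w
    using mono[OF that] unfolding linear_on_def fs(1)
    by (auto simp: free_sum_simps(3) free_sum_simps(3)[OF closed(1)] free_sum_simps(3)[OF closed(2)])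
  moreover have "str (free_sum gs) w u (str (free_sum gs) z w x) = str (free_sum gs :: ('k, nat \<Rightarrow> 'k, 'n) pmod) z u x"
    if "x \<in> cmp (free_sum gs) z" for z w u x
    using that by (simp add: free_sum_simps(3))
  ultimately show ?thesis
    unfolding persistence_module_def fs(1)
    using coordinate_subspace[OF fin, where 'k = 'k, folded S]
    by (simp add: free_sum_simps(3) vector_space_fun[OF vector_space_mult])
qed

lemma persistence_module_inj_sum:
  "persistence_module (inj_sum gs :: ('k :: field, nat \<Rightarrow> 'k, 'n :: finite) pmod)"
proof -
  note isums = inj_sum_simps(1)[of gs, where 'k = 'k]
    inj_sum_simps(2)[of gs, where 'k = 'k]
    inj_sum_simps(3)[of gs, where 'k = 'k]
  have S: "cmp (inj_sum gs :: ('k, nat \<Rightarrow> 'k, 'n) pmod) z = {x. \<forall>j. x j \<noteq> 0 \<longrightarrow> j \<in> {j. j < length gs \<and> z \<le> gs ! j}}" for z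
    by (simp add: isums)
  have fin: "finite {j. j < length gs \<and> z \<le> gs ! j}" for z
    by (rule finite_subset[of _ "{..<length gs}"]) auto
  have "str (inj_sum gs :: ('k, nat \<Rightarrow> 'k, 'n) pmod) z z x = x" if "x \<in> cmp (inj_sum gs) z" for z x
    using that by (auto simp: isums fun_eq_iff)
  moreover have "str (inj_sum gs) w u (str (inj_sum gs) z w x) = str (inj_sum gs :: ('k, nat \<Rightarrow> 'k, 'n) pmod) z u x"
    if "z \<le> w" "w \<le> u" for z w u x
    using that by (auto simp: isums fun_eq_iff intro: order_trans)
  moreover have "linear_on (scl (inj_sum gs)) (scl (inj_sum gs)) (cmp (inj_sum gs) z) (cmp (inj_sum gs) w)
      (str (inj_sum gs :: ('k, nat \<Rightarrow> 'k, 'n) pmod) z w)" for z w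
    by (auto simp: isums linear_on_def fun_eq_iff split: if_splits)
  ultimately show ?thesis
    unfolding persistence_module_def isums(1)
    using coordinate_subspace[OF fin, where 'k = 'k, folded S]
    by (simp add: vector_space_fun[OF vector_space_mult])
qed

lemma free_module_free_sum: "free_module (free_sum gs)"
  unfolding free_module_def
proof (intro exI)
  have "morphism (free_sum gs) (free_sum gs) (\<lambda>z x. x)"
    by (simp add: morphism_def linear_on_def)
  then show "isomorphism (free_sum gs) (direct_sum {..<length gs} (\<lambda>j. F (gs ! j))) (\<lambda>z x. x)"
    by (simp add: isomorphism_def free_sum_def bij_betw_def)
qed

text \<open>A morphism into \<open>I g\<close> is the same as a functional on the component at
  \<open>g\<close>. So for each summand one functional is extended along the injection at grade
  \<open>gs ! j\<close>, and the structure maps of \<open>B\<close> carry it to the lower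
  grades.\<close>

lemma injective_module_inj_sum:
  "injective_module (inj_sum gs :: ('k :: field, nat \<Rightarrow> 'k, 'n :: finite) pmod)"
  unfolding injective_module_def
proof (intro conjI allI impI persistence_module_inj_sum)
  fix A B :: "('k, nat \<Rightarrow> 'k, 'n) pmod" and i g
  assume A: "persistence_module A" and B: "persistence_module B" and i: "morphism A B i"
    and inj: "\<forall>z. inj_on (i z) (cmp A z)" and g: "morphism A (inj_sum gs) g"
  note DA = persistence_moduleD[OF A] and DB = persistence_moduleD[OF B]
  note isums = inj_sum_simps(1)[of gs, where 'k = 'k]
    inj_sum_simps(2)[of gs, where 'k = 'k]
    inj_sum_simps(3)[of gs, where 'k = 'k]
  have "\<exists>r. linear_on (scl B) (*) UNIV UNIV r \<and> (\<forall>x\<in>cmp A (gs ! j). r (i (gs ! j) x) = g (gs ! j) x j)" for j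
  proof -
    let ?z = "gs ! j"
    have "linear_on (scl A) (*) (cmp A ?z) UNIV (\<lambda>x. g ?z x j)"
      using morphismD(1)[OF g, of ?z] by (auto simp: linear_on_def isums)
    moreover have "g ?z x j = 0" if "x \<in> cmp A ?z" "i ?z x = 0" for x
    proof -
      have "i ?z x = i ?z 0"
        using that(2) morphism_zero[OF A i] by simp
      then have "x = 0"
        using inj that(1) persistence_module_zero_mem[OF A] by (meson inj_onD)
      then show ?thesis
        using morphism_zero[OF A g] by simp
    qed
    ultimately show ?thesis
      using functional_factor[OF DA(1) DB(1) DA(2) morphismD(1)[OF i]] by metis
  qed
  then obtain r where rl: "\<And>j. linear_on (scl B) (*) UNIV UNIV (r j)"
    and r: "\<And>j x. x \<in> cmp A (gs ! j) \<Longrightarrow> r j (i (gs ! j) x) = g (gs ! j) x j"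
    by metis
  define h where "h w b j = (if j < length gs \<and> w \<le> gs ! j then r j (str B w (gs ! j) b) else 0)" for w b j
  have "morphism B (inj_sum gs) h"
    unfolding morphism_def
  proof (intro conjI allI impI ballI)
    fix z
    have "linear_on (scl B) (*) (cmp B z) UNIV (\<lambda>b. r j (str B z (gs ! j) b))" if "z \<le> gs ! j" for j
      using linear_on_comp[OF DB(4)[OF that] linear_on_mono[OF rl]] by simp
    then show "linear_on (scl B) (scl (inj_sum gs)) (cmp B z) (cmp (inj_sum gs) z) (h z)"
      by (auto simp: linear_on_def h_def isums fun_eq_iff)
    fix w x assume zw: "z \<le> w" and x: "x \<in> cmp B z"
    have "h w (str B z w x) j = str (inj_sum gs) z w (h z x) j" for j
      using DB(6)[OF zw _ x] zw by (auto simp: h_def isums intro: order_trans)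
    then show "h w (str B z w x) = str (inj_sum gs) z w (h z x)"
      by blast
  qed
  moreover have "h w (i w x) = g w x" if x: "x \<in> cmp A w" for w x
  proof
    fix j
    have gx: "g w x \<in> cmp (inj_sum gs) w"
      using morphismD(3)[OF g x] .
    show "h w (i w x) j = g w x j"
    proof (cases "j < length gs \<and> w \<le> gs ! j")
      case True
      then have "h w (i w x) j = r j (i (gs ! j) (str A w (gs ! j) x))"
        using morphismD(2)[OF i _ x] by (simp add: h_def)
      also have "\<dots> = g (gs ! j) (str A w (gs ! j) x) j"
        using r linear_onD(1)[OF DA(4) x] True by blast
      also have "\<dots> = g w x j"
        using morphismD(2)[OF g _ x] True by (simp add: isums)
      finally show ?thesis .
    next
      case False
      then show ?thesis
        using gx by (auto simp: h_def isums)
    qed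
  qed
  ultimately show "\<exists>h. morphism B (inj_sum gs) h \<and> (\<forall>z. \<forall>x\<in>cmp A z. h z (i z x) = g z x)"
    by blast
qed

section \<open>Morphisms given by graded matrices\<close>

lemma morphism_const_zero:
  assumes "persistence_module N"
  shows "morphism M N (\<lambda>z x. 0)"
proof -
  interpret vector_space "scl N" using assms by (rule persistence_moduleD)
  show ?thesis
    using persistence_module_zero_mem[OF assms] persistence_module_str_zero[OF assms]
    by (auto simp: morphism_def linear_on_def)
qed

lemma morphism_free_map:
  assumes "graded_matrix A"
  shows "morphism (free_sum (cg A)) (free_sum (rg A)) (free_map A)"
proof -
  have mem: "free_map A z x \<in> cmp (free_sum (rg A)) z" if x: "x \<in> cmp (free_sum (cg A)) z" for z x
    unfolding free_sum_simps
  proof safe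
    fix i assume nz: "free_map A z x i \<noteq> 0"
    then show i: "i < length (rg A)" by (auto simp: free_map_def split: if_splits)
    then obtain j where j: "j < length (cg A)" "ent A i j * x j \<noteq> 0"
      using nz sum.neutral[of "{..<length (cg A)}" "\<lambda>j. ent A i j * x j"] by (auto simp: free_map_def)
    then have "rg A ! i \<le> cg A ! j" "cg A ! j \<le> z"
      using assms i x by (auto simp: graded_matrix_def free_sum_simps)
    then show "rg A ! i \<le> z" by (rule order_trans)
  qed
  have "linear_on (scl (free_sum (cg A))) (scl (free_sum (rg A))) (cmp (free_sum (cg A)) z)
      (cmp (free_sum (rg A)) z) (free_map A z)" for z
    unfolding linear_on_def free_sum_simps(1)
    using mem by (auto simp: free_map_def fun_eq_iff distrib_left sum.distrib sum_distrib_left mult.left_commute)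
  moreover have "free_map A w (str (free_sum (cg A)) z w x) = str (free_sum (rg A)) z w (free_map A z x)"
    if "x \<in> cmp (free_sum (cg A)) z" for z w x
    using that mem[OF that] by (simp add: free_sum_simps(3)) (simp add: free_map_def fun_eq_iff)
  ultimately show ?thesis
    by (simp add: morphism_def)
qed

lemma morphism_inj_map:
  assumes "graded_matrix A"
  shows "morphism (inj_sum (cg A)) (inj_sum (rg A)) (inj_map A)"
proof -
  have "inj_map A w (str (inj_sum (cg A)) z w x) = str (inj_sum (rg A)) z w (inj_map A z x)"
    if zw: "z \<le> w" for z w x
  proof
    fix i
    \<comment> \<open>Where \<open>str\<close> clears the coordinate \<open>j\<close>, the entry is
      zero: otherwise \<open>w \<le> rg A ! i \<le> cg A ! j\<close>.\<close>
    have "(\<Sum>j<length (cg A). ent A i j * str (inj_sum (cg A)) z w x j) = (\<Sum>j<length (cg A). ent A i j * x j)"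
      if "i < length (rg A)" "w \<le> rg A ! i"
    proof (rule sum.cong[OF refl])
      fix j assume "j \<in> {..<length (cg A)}"
      then show "ent A i j * str (inj_sum (cg A)) z w x j = ent A i j * x j"
        using that assms order_trans[of w "rg A ! i" "cg A ! j"]
        by (auto simp: inj_sum_simps graded_matrix_def)
    qed
    then show "inj_map A w (str (inj_sum (cg A)) z w x) i = str (inj_sum (rg A)) z w (inj_map A z x) i"
      using zw by (auto simp: inj_map_def inj_sum_simps(3) intro: order_trans)
  qed
  then show ?thesis
    by (auto simp: morphism_def linear_on_def inj_sum_simps(1,2) inj_map_def fun_eq_iff
        distrib_left sum.distrib sum_distrib_left mult.left_commute)
qed

section \<open>Complexes of graded matrices\<close>

text \<open>Extended by zero to all integer degrees, to fit the indexing of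
  \<open>graded_complex\<close>.\<close>

definition entries :: "nat \<Rightarrow> (nat \<Rightarrow> ('k :: field, 'n :: finite) gmat) \<Rightarrow> int \<Rightarrow> nat \<Rightarrow> nat \<Rightarrow> 'k" where
  "entries N U q i j = (if 1 \<le> q \<and> q \<le> int N then ent (U (nat q)) i j else 0)"

text \<open>Grades enter only through the sizes of the matrices. The condition is therefore
  unchanged by shifts, and it characterizes complexes on the free and on the injective side
  alike.\<close>

definition square_zero :: "nat \<Rightarrow> (nat \<Rightarrow> ('k :: field, 'n :: finite) gmat) \<Rightarrow> bool" where
  "square_zero N U \<longleftrightarrow> (\<forall>q i k. i < length (grades N U (q - 2)) \<longrightarrow> k < length (grades N U q) \<longrightarrow>
    (\<Sum>j<length (grades N U (q - 1)). entries N U (q - 1) i j * entries N U q j k) = 0)"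

lemma grades_matrix:
  assumes "matching N U" "1 \<le> q" "q \<le> int N"
  shows "cg (U (nat q)) = grades N U q" "rg (U (nat q)) = grades N U (q - 1)"
proof -
  show "cg (U (nat q)) = grades N U q"
    using assms by (simp add: grades_def)
  show "rg (U (nat q)) = grades N U (q - 1)"
  proof (cases "q = 1")
    case False
    then have "nat q = nat (q - 1) + 1" "1 \<le> nat (q - 1)" "nat (q - 1) < N"
      using assms by auto
    then have "rg (U (nat q)) = cg (U (nat (q - 1)))"
      using assms(1) unfolding matching_def by metis
    then show ?thesis
      using False assms by (simp add: grades_def)
  qed (simp add: grades_def)
qed

lemma nat_in_range: "1 \<le> q \<Longrightarrow> q \<le> int N \<Longrightarrow> nat q \<in> {1..N}"
  by (simp add: Suc_le_eq nat_le_iff)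

lemma grades_outside: "q < 0 \<or> q > int N \<Longrightarrow> grades N U q = []"
  by (auto simp: grades_def)

lemma entries_graded:
  assumes "\<forall>q\<in>{1..N}. graded_matrix (U q)" "matching N U"
    and "i < length (grades N U (q - 1))" "j < length (grades N U q)" "entries N U q i j \<noteq> 0"
  shows "grades N U (q - 1) ! i \<le> grades N U q ! j"
proof -
  have q: "1 \<le> q" "q \<le> int N" "ent (U (nat q)) i j \<noteq> 0"
    using assms(5) by (auto simp: entries_def split: if_splits)
  then have "graded_matrix (U (nat q))"
    using assms(1) nat_in_range by blast
  then show ?thesis
    using q assms(3,4) grades_matrix[OF assms(2) q(1,2)] by (auto simp: graded_matrix_def)
qed

lemma graded_complex_matrices:
  assumes "\<forall>q\<in>{1..N}. graded_matrix (U q)" "matching N U" "square_zero N U"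
  shows "graded_complex (grades N U) (entries N U)"
proof
  show "finite {q. grades N U q \<noteq> []}"
    by (rule finite_subset[of _ "{0..int N}"]) (use grades_outside[of _ N U] in force)+
qed (use assms entries_graded[OF assms(1,2)] in \<open>auto simp: square_zero_def\<close>)

lemma free_complex_simps:
  assumes "matching N U"
  shows "obj (free_complex N U) q = free_sum (grades N U q)"
    "bd (free_complex N U) q z x i =
      (if i < length (grades N U (q - 1)) then \<Sum>j<length (grades N U q). entries N U q i j * x j else 0)"
proof -
  show "obj (free_complex N U) q = free_sum (grades N U q)"
    by (simp add: free_complex_def)
  show "bd (free_complex N U) q z x i =
      (if i < length (grades N U (q - 1)) then \<Sum>j<length (grades N U q). entries N U q i j * x j else 0)"
  proof (cases "1 \<le> q \<and> q \<le> int N")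
    case True
    then show ?thesis
      using grades_matrix[OF assms, of q] by (simp add: free_complex_def free_map_def entries_def)
  next
    case False
    then have "bd (free_complex N U) q = (\<lambda>z x. 0)" "entries N U q = (\<lambda>i j. 0)"
      by (auto simp: free_complex_def entries_def fun_eq_iff)
    then show ?thesis by simp
  qed
qed

lemma inj_complex_simps:
  assumes "matching N U"
  shows "obj (inj_complex N U) q = inj_sum (grades N U (int N + q))"
    "bd (inj_complex N U) q z x i =
      (if i < length (grades N U (int N + q - 1)) \<and> z \<le> grades N U (int N + q - 1) ! i
       then \<Sum>j<length (grades N U (int N + q)). entries N U (int N + q) i j * x j else 0)"
proof -
  show "obj (inj_complex N U) q = inj_sum (grades N U (int N + q))"
    by (simp add: inj_complex_def)
  show "bd (inj_complex N U) q z x i =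
      (if i < length (grades N U (int N + q - 1)) \<and> z \<le> grades N U (int N + q - 1) ! i
       then \<Sum>j<length (grades N U (int N + q)). entries N U (int N + q) i j * x j else 0)"
  proof (cases "1 \<le> int N + q \<and> q \<le> 0")
    case True
    then show ?thesis
      using grades_matrix[OF assms, of "int N + q"]
      by (simp add: inj_complex_def inj_map_def entries_def)
  next
    case False
    then have "bd (inj_complex N U) q = (\<lambda>z x. 0)" "entries N U (int N + q) = (\<lambda>i j. 0)"
      by (auto simp: inj_complex_def entries_def fun_eq_iff)
    then show ?thesis by simp
  qed
qed

lemma morphism_bd_free_complex:
  assumes "\<forall>q\<in>{1..N}. graded_matrix (U q)" "matching N U"
  shows "morphism (obj (free_complex N U) q) (obj (free_complex N U) (q - 1)) (bd (free_complex N U) q)"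
proof (cases "1 \<le> q \<and> q \<le> int N")
  case True
  then have "graded_matrix (U (nat q))"
    using assms(1) nat_in_range by blast
  from morphism_free_map[OF this] show ?thesis
    using True grades_matrix[OF assms(2), of q] by (simp add: free_complex_def)
next
  case False
  then have "bd (free_complex N U) q = (\<lambda>z x. 0)"
    by (auto simp: free_complex_def)
  then show ?thesis
    using morphism_const_zero[OF persistence_module_free_sum] by (simp add: free_complex_def)
qed

lemma morphism_bd_inj_complex:
  assumes "\<forall>q\<in>{1..N}. graded_matrix (U q)" "matching N U"
  shows "morphism (obj (inj_complex N U) q) (obj (inj_complex N U) (q - 1)) (bd (inj_complex N U) q)"
proof (cases "1 \<le> int N + q \<and> q \<le> 0")
  case True
  then have "graded_matrix (U (nat (int N + q)))"
    using assms(1) nat_in_range[of "int N + q" N] by simp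
  from morphism_inj_map[OF this] show ?thesis
    using True grades_matrix[OF assms(2), of "int N + q"] by (simp add: inj_complex_def add_diff_eq)
next
  case False
  then have "bd (inj_complex N U) q = (\<lambda>z x. 0)"
    by (auto simp: inj_complex_def)
  then show ?thesis
    using morphism_const_zero[OF persistence_module_inj_sum] by (simp add: inj_complex_def)
qed

lemma complex_free_iff:
  fixes U :: "nat \<Rightarrow> ('k :: field, 'n :: finite) gmat"
  assumes gr: "\<forall>q\<in>{1..N}. graded_matrix (U q)" and match: "matching N U"
  shows "complex (free_complex N U) \<longleftrightarrow> square_zero N U"
proof
  assume C: "complex (free_complex N U)"
  show "square_zero N U"
    unfolding square_zero_def
  proof (intro allI impI)
    fix q i k
    assume i: "i < length (grades N U (q - 2))" and k: "k < length (grades N U q)"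
    \<comment> \<open>The generator \<open>k\<close> at its own grade: coordinate \<open>i\<close>
      of its second boundary is an entry of the matrix product.\<close>
    let ?e = "\<lambda>j. if j = k then 1 else 0 :: 'k" and ?z = "grades N U q ! k"
    have "?e \<in> cmp (obj (free_complex N U) q) ?z"
      using k by (simp add: free_complex_simps[OF match] free_sum_simps)
    from fun_cong[OF complexD(3)[OF C this], of i]
    have "(\<Sum>j<length (grades N U (q - 1)). entries N U (q - 1) i j * bd (free_complex N U) q ?z ?e j) = 0"
      using i free_complex_simps(2)[OF match, of "q - 1"] by simp
    moreover have "bd (free_complex N U) q ?z ?e j = entries N U q j k" if "j < length (grades N U (q - 1))" for j
      using that k by (simp add: free_complex_simps[OF match] if_distrib[of "\<lambda>x. _ * x"] cong: if_cong)
    ultimately show "(\<Sum>j<length (grades N U (q - 1)). entries N U (q - 1) i j * entries N U q j k) = 0"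
      by simp
  qed
next
  assume sz: "square_zero N U"
  interpret graded_complex "grades N U" "entries N U"
    by (rule graded_complex_matrices[OF gr match sz])
  have "bd (free_complex N U) q z x = D q x" for q z x
    by (simp add: fun_eq_iff free_complex_simps[OF match] D_def)
  then have "bd (free_complex N U) (q - 1) z (bd (free_complex N U) q z x) = 0" for q z x
    by (simp add: D_D)
  then show "complex (free_complex N U)"
    using morphism_bd_free_complex[OF gr match]
    by (simp add: complex_def free_complex_simps(1)[OF match] persistence_module_free_sum)
qed

lemma complex_inj_iff:
  fixes U :: "nat \<Rightarrow> ('k :: field, 'n :: finite) gmat"
  assumes gr: "\<forall>q\<in>{1..N}. graded_matrix (U q)" and match: "matching N U"
  shows "complex (inj_complex N U) \<longleftrightarrow> square_zero N U"
proof
  assume C: "complex (inj_complex N U)"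
  note ent_graded = entries_graded[OF gr match]
  show "square_zero N U"
    unfolding square_zero_def
  proof (intro allI impI)
    fix q i k
    assume i: "i < length (grades N U (q - 2))" and k: "k < length (grades N U q)"
    \<comment> \<open>The test is made at the grade of row \<open>i\<close>, the largest at which
      this row is visible. If generator \<open>k\<close> is absent there, every summand vanishes,
      since two nonzero entries would give a chain of grades from row \<open>i\<close> to column
      \<open>k\<close>.\<close>
    let ?e = "\<lambda>j. if j = k then 1 else 0 :: 'k" and ?z = "grades N U (q - 2) ! i" and ?q = "q - int N"
    show "(\<Sum>j<length (grades N U (q - 1)). entries N U (q - 1) i j * entries N U q j k) = 0"
    proof (cases "?z \<le> grades N U q ! k")
      case True
      have "?e \<in> cmp (obj (inj_complex N U) ?q) ?z"
        using k True by (simp add: inj_complex_simps[OF match] inj_sum_simps)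
      from fun_cong[OF complexD(3)[OF C this], of i]
      have "(\<Sum>j<length (grades N U (q - 1)). entries N U (q - 1) i j * bd (inj_complex N U) ?q ?z ?e j) = 0"
        using i inj_complex_simps(2)[OF match, of "?q - 1"] by simp
      moreover have "entries N U (q - 1) i j * bd (inj_complex N U) ?q ?z ?e j =
          entries N U (q - 1) i j * entries N U q j k" if "j < length (grades N U (q - 1))" for j
      proof (cases "entries N U (q - 1) i j = 0")
        case False
        then have "?z \<le> grades N U (q - 1) ! j"
          using ent_graded[of i "q - 1" j] i that by simp
        then show ?thesis
          using that k by (simp add: inj_complex_simps[OF match] if_distrib[of "\<lambda>x. _ * x"] cong: if_cong)
      qed simp
      ultimately show ?thesis
        by simp
    next
      case False
      have "entries N U (q - 1) i j * entries N U q j k = 0" if "j < length (grades N U (q - 1))" for j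
      proof (rule ccontr)
        assume "entries N U (q - 1) i j * entries N U q j k \<noteq> 0"
        then have "?z \<le> grades N U (q - 1) ! j" "grades N U (q - 1) ! j \<le> grades N U q ! k"
          using ent_graded[of i "q - 1" j] ent_graded[of j q k] i k that by auto
        with False show False by (auto dest: order_trans)
      qed
      then show ?thesis
        by (intro sum.neutral) simp
    qed
  qed
next
  assume sz: "square_zero N U"
  interpret graded_complex "grades N U" "entries N U"
    by (rule graded_complex_matrices[OF gr match sz])
  \<comment> \<open>At \<open>z\<close> the injective complex is spanned by the generators above
    \<open>z\<close>, a convex set, so \<open>d_d\<close> applies.\<close>
  have bd: "bd (inj_complex N U) q z x = d (\<lambda>g. z \<le> g) (int N + q) x" for q z x
    by (auto simp: fun_eq_iff inj_complex_simps[OF match] d_def res_def D_def)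
  have conv: "convex_pred (\<lambda>g. z \<le> g)" for z :: "int ^ 'n"
    unfolding convex_pred_def by (auto intro: order_trans)
  have "bd (inj_complex N U) (q - 1) z (bd (inj_complex N U) q z x) = 0"
    if "x \<in> cmp (obj (inj_complex N U) q) z" for q z x
    using d_d[OF conv, of x z "int N + q"] that
    by (simp add: bd V_def inj_complex_simps[OF match] inj_sum_simps add_diff_eq)
  then show "complex (inj_complex N U)"
    using morphism_bd_inj_complex[OF gr match]
    by (simp add: complex_def inj_complex_simps(1)[OF match] persistence_module_inj_sum)
qed

text \<open>Each nonzero component contributes at least 1, and infinitely many such terms sum to
  infinity.\<close>

lemma total_dim_finite_support:
  fixes M :: "('k :: field, 'v :: ab_group_add, 'n :: finite) pmod"
  assumes M: "persistence_module M" and dim: "total_dim M < \<infinity>"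
  shows "finite {z. cmp M z \<noteq> {0}}"
proof (rule ccontr)
  assume inf: "infinite {z. cmp M z \<noteq> {0}}"
  note D = persistence_moduleD[OF M]
  interpret vector_space "scl M" by (rule D)
  let ?f = "\<lambda>z. enat (dim (cmp M z))"
  have "1 \<le> ?f z" if "cmp M z \<noteq> {0}" for z
  proof (rule ccontr)
    assume "\<not> 1 \<le> ?f z"
    then have 0: "dim (cmp M z) = 0"
      by (simp add: one_enat_def)
    obtain B0 where B0: "finite B0" "span B0 = cmp M z"
      using D(3) by blast
    obtain B where B: "B \<subseteq> cmp M z" "independent B" "cmp M z \<subseteq> span B" "card B = dim (cmp M z)"
      using basis_exists by blast
    \<comment> \<open>Shown before using \<open>card B = 0\<close>, because \<open>card\<close> is 0
      for infinite sets as well.\<close>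
    have "finite B"
      using independent_span_bound[OF B0(1) B(2)] B(1) B0(2) by auto
    then have "cmp M z \<subseteq> {0}"
      using B(3,4) 0 by (simp add: span_empty)
    then show False
      using that persistence_module_zero_mem[OF M] by blast
  qed
  then have "infsum ?f {z. cmp M z \<noteq> {0}} = \<infinity>"
    using inf by (intro infsum_superconst_infinite_enat[of _ 1]) auto
  moreover have "infsum ?f {z. cmp M z \<noteq> {0}} \<le> infsum ?f UNIV"
    by (rule infsum_mono_neutral) auto
  ultimately show False
    using dim by (simp add: total_dim_def)
qed

section \<open>Shifts of graded matrices\<close>

lemma gm_shift_simps [simp]:
  "rg (gm_shift z A) = map (\<lambda>a. a - z) (rg A)" "cg (gm_shift z A) = map (\<lambda>a. a - z) (cg A)"
  "ent (gm_shift z A) = ent A"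
  by (simp_all add: gm_shift_def)

lemma graded_matrix_shift:
  fixes A :: "('k :: field, 'n :: finite) gmat"
  shows "graded_matrix A \<Longrightarrow> graded_matrix (gm_shift z A)"
  by (auto simp: graded_matrix_def less_eq_vec_def)

lemma inj_map_diff: "inj (\<lambda>a :: int ^ 'n. a - z)"
  by (simp add: inj_on_def)

lemma matching_shift:
  fixes U :: "nat \<Rightarrow> ('k, 'n :: finite) gmat"
  shows "matching N (\<lambda>q. gm_shift z (U q)) \<longleftrightarrow> matching N U"
  by (simp add: matching_def inj_map_eq_map[OF inj_map_diff])

lemma grades_shift:
  "grades N (\<lambda>q. gm_shift z (U q)) q = map (\<lambda>a. a - z) (grades N U q)"
  by (simp add: grades_def)

lemma entries_shift: "entries N (\<lambda>q. gm_shift z (U q)) = entries N U"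
  by (intro ext) (simp add: entries_def)

lemma square_zero_shift: "square_zero N (\<lambda>q. gm_shift z (U q)) \<longleftrightarrow> square_zero N U"
  by (simp add: square_zero_def grades_shift entries_shift)

text \<open>For \<open>T = {}\<close> the box is the down-set of \<open>z\<close>, so truncation
  discards nothing and \<open>d\<close> is the free differential. In degree 0 all elements are
  cycles, and a comparison is an augmentation.\<close>

lemma represents_free_resolution_iff:
  fixes U :: "nat \<Rightarrow> ('k :: field, 'n :: finite) gmat" and M :: "('k, 'v :: ab_group_add, 'n) pmod"
  assumes gr: "\<forall>q\<in>{1..N}. graded_matrix (U q)" and match: "matching N U" and M: "persistence_module M"
    and sz: "square_zero N U"
  shows "represents_free_resolution N U M \<longleftrightarrow>
    graded_complex.resolves (grades N U) (entries N U) M {} 0"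
proof -
  interpret graded_complex "grades N U" "entries N U"
    by (rule graded_complex_matrices[OF gr match sz])
  let ?C = "free_complex N U"
  have C: "complex ?C"
    using complex_free_iff[OF gr match] sz by blast
  have box: "box {} UNIV z g \<longleftrightarrow> g \<le> z" for z g :: "int ^ 'n"
    by (simp add: box_def less_eq_vec_def)
  have V: "cmp (obj ?C q) z = V (box {} (- {}) z) q" for q z
    by (simp add: free_complex_simps[OF match] free_sum_simps V_def box)
  have bd: "bd ?C q z x = d (box {} (- {}) z) q x" if "x \<in> V (box {} (- {}) z) q" for q z x
  proof -
    have "bd ?C q z x = D q x"
      by (simp add: fun_eq_iff free_complex_simps[OF match] D_def)
    moreover have "bd ?C q z x \<in> V (box {} (- {}) z) (q - 1)"
      using morphismD(3)[OF complexD(2)[OF C]] that unfolding V .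
    ultimately show ?thesis
      by (simp add: d_def res_id)
  qed
  have cyc: "cycles ?C q z = Z (box {} (- {}) z) q" for q z
    by (auto simp: cycles_def Z_def V bd)
  have bnd: "boundaries ?C q z = Bd (box {} (- {}) z) q" for q z
    by (auto simp: boundaries_def Bd_def V bd)
  have zero: "\<forall>q<0. is_zero (obj ?C q)"
    by (auto simp: is_zero_def free_complex_simps[OF match] grades_outside free_sum_simps)
  have Z0: "Z (box {} (- {}) z) 0 = cmp (obj ?C 0) z" for z
    by (auto simp: Z_def V d_def res_def grades_outside fun_eq_iff)
  have str: "res (box {} (- {}) w) 0 x = str (obj ?C 0) z w x"
    if "z \<le> w" "x \<in> cmp (obj ?C 0) z" for z w x
  proof -
    have "str (obj ?C 0) z w x = x"
      using that(2) by (simp add: free_complex_simps[OF match] free_sum_simps(3))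
    moreover have "box {} (- {}) z g \<Longrightarrow> box {} (- {}) w g" for g
      using that(1) by (auto simp: box intro: order_trans)
    then have "res (box {} (- {}) w) 0 x = x"
      using res_id that(2) unfolding V by blast
    ultimately show ?thesis by simp
  qed
  have scl: "scl (obj ?C 0) = (\<lambda>c x j. c * x j)"
    by (simp add: free_complex_simps[OF match] free_sum_simps)
  have comp: "comparison M {} 0 h \<longleftrightarrow> morphism (obj ?C 0) M h \<and> (\<forall>z. h z ` cmp (obj ?C 0) z = cmp M z \<and>
      (\<forall>x\<in>cmp (obj ?C 0) z. h z x = 0 \<longleftrightarrow> x \<in> boundaries ?C 0 z))" for h
  proof -
    have "(\<forall>z w. z \<le> w \<longrightarrow> (\<forall>x\<in>cmp (obj ?C 0) z. h w (res (box {} (- {}) w) 0 x) = str M z w (h z x))) \<longleftrightarrow>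
        (\<forall>z w. z \<le> w \<longrightarrow> (\<forall>x\<in>cmp (obj ?C 0) z. h w (str (obj ?C 0) z w x) = str M z w (h z x)))"
      using str by simp
    then show ?thesis
      unfolding comparison_def morphism_def Z0 bnd scl all_conj_distrib by argo
  qed
  have "represents_free_resolution N U M \<longleftrightarrow> (\<exists>f. quasi_isomorphism f ?C (stalk M))"
    using gr match C zero
    by (simp add: represents_free_resolution_def free_resolution_def free_complex_simps(1)[OF match]
        free_module_free_sum)
  also have "\<dots> \<longleftrightarrow> resolves M {} 0"
    unfolding quasi_isomorphism_to_stalk_iff[OF C M zero] resolves_def comp cyc bnd ..
  finally show ?thesis .
qed

text \<open>For \<open>T = UNIV\<close> all inequalities are strict, which after the shift is the
  condition for an injective summand to be nonzero at \<open>z\<close>. Cohomological degree 0 is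
  degree \<open>N\<close> of the matrices, where only zero is a boundary, so a comparison is
  bijective on cycles. It runs from the cycles to \<open>M\<close> and the coaugmentation runs back,
  hence the passage to inverses.\<close>

lemma represents_injective_resolution_iff:
  fixes U :: "nat \<Rightarrow> ('k :: field, 'n :: finite) gmat" and M :: "('k, 'v :: ab_group_add, 'n) pmod"
  assumes gr: "\<forall>q\<in>{1..N}. graded_matrix (U q)" and match: "matching N U" and M: "persistence_module M"
    and sz: "square_zero N U"
  defines "W \<equiv> (\<lambda>q. gm_shift (\<chi> i. 1) (U q))"
  shows "represents_injective_resolution N W M \<longleftrightarrow>
    graded_complex.resolves (grades N U) (entries N U) M UNIV (int N)"
proof -
  interpret graded_complex "grades N U" "entries N U"
    by (rule graded_complex_matrices[OF gr match sz])
  let ?C = "inj_complex N W"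
  have grW: "\<forall>q\<in>{1..N}. graded_matrix (W q)" and matchW: "matching N W" and szW: "square_zero N W"
    using gr match sz by (auto simp: W_def graded_matrix_shift matching_shift square_zero_shift)
  have C: "complex ?C"
    using complex_inj_iff[OF grW matchW] szW by blast
  have box: "z \<le> g - (\<chi> i. 1) \<longleftrightarrow> box UNIV (- UNIV) z g" for z g :: "int ^ 'n"
    by (auto simp: box_def less_eq_vec_def)
  note simps = inj_complex_simps[OF matchW, unfolded W_def grades_shift entries_shift, folded W_def]
  have V: "cmp (obj ?C q) z = V (box UNIV (- UNIV) z) (int N + q)" for q z
    by (auto simp: simps inj_sum_simps V_def box)
  have bd: "bd ?C q z x = d (box UNIV (- UNIV) z) (int N + q) x" for q z x
    by (auto simp: fun_eq_iff simps d_def res_def D_def box)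
  have cyc: "cycles ?C q z = Z (box UNIV (- UNIV) z) (int N + q)" for q z
    by (auto simp: cycles_def Z_def V bd)
  have bnd: "boundaries ?C q z = Bd (box UNIV (- UNIV) z) (int N + q)" for q z
    by (auto simp: boundaries_def Bd_def V bd add.assoc)
  have zero: "\<forall>q>0. is_zero (obj ?C q)"
    by (auto simp: is_zero_def simps grades_outside inj_sum_simps)
  \<comment> \<open>There are no generators in degree \<open>N + 1\<close>.\<close>
  have B0: "Bd (box UNIV (- UNIV) z) (int N) = {0}" for z
    by (auto simp: Bd_def V_def grades_outside d_linear)
      (auto simp: d_def D_def res_def fun_eq_iff grades_outside intro!: image_eqI[of _ _ 0])
  have str: "res (box UNIV (- UNIV) w) (int N) x = str (obj ?C 0) z w x" for z w x
    by (auto simp: simps inj_sum_simps(3) res_def box fun_eq_iff)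
  have scl: "scl (obj ?C q) = (\<lambda>c x j. c * x j)" for q
    by (simp add: simps inj_sum_simps)
  have Z0: "Z (box UNIV (- UNIV) z) (int N) = cycles ?C 0 z" for z
    by (simp add: cyc)
  have Zsub: "cycles ?C 0 z \<subseteq> cmp (obj ?C 0) z" for z
    by (auto simp: cycles_def)
  note DM = persistence_moduleD[OF M] and subZ = subspace_Z[of "box UNIV (- UNIV) _" "int N", unfolded Z0]
  have vs: "vector_space (\<lambda>c (x :: nat \<Rightarrow> 'k) j. c * x j)"
    by (rule vector_space_fun[OF vector_space_mult])
  \<comment> \<open>The cycles as a module in their own right: comparisons and coaugmentations
    become isomorphisms between \<open>K\<close> and \<open>M\<close> in opposite
    directions.\<close>
  define K :: "('k, nat \<Rightarrow> 'k, 'n) pmod" where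
    "K = \<lparr>scl = \<lambda>c x j. c * x j, cmp = cycles ?C 0, str = str (obj ?C 0)\<rparr>"
  have K: "scl K = (\<lambda>c x j. c * x j)" "cmp K = cycles ?C 0" "str K = str (obj ?C 0)"
    by (simp_all add: K_def)
  have strK: "str K z w x \<in> cmp K w" if "z \<le> w" "x \<in> cmp K z" for z w x
    using res_Z[OF compat_box[OF that(1)] that(2)[unfolded K, folded Z0]] unfolding K Z0 str[of w _ z] .
  have compK: "comparison M UNIV (int N) \<psi> \<longleftrightarrow> isomorphism K M \<psi>" for \<psi>
  proof -
    show ?thesis
    proof (cases "\<forall>z. linear_on (\<lambda>c x j. c * x j) (scl M) (cycles ?C 0 z) (cmp M z) (\<psi> z)")
      case True
      then have inj: "inj_on (\<psi> z) (cycles ?C 0 z) \<longleftrightarrow> (\<forall>x\<in>cycles ?C 0 z. \<psi> z x = 0 \<longleftrightarrow> x \<in> {0})" for z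
        using linear_on_inj_on_iff[OF vs subZ spec[OF True]] linear_on_zero[OF spec[OF True]] by auto
      show ?thesis
        unfolding comparison_def isomorphism_def morphism_def bij_betw_def K Z0 B0 all_conj_distrib inj
          str[symmetric]
        by argo
    next
      case False
      then show ?thesis
        unfolding comparison_def isomorphism_def morphism_def K Z0 by argo
    qed
  qed
  have homK: "morphism M (obj ?C 0) h \<and> (\<forall>z. h z ` cmp M z = cycles ?C 0 z \<and> (\<forall>x\<in>cmp M z. h z x = 0 \<longrightarrow> x = 0)) \<longleftrightarrow>
      isomorphism M K h" for h
  proof
    assume L: "morphism M (obj ?C 0) h \<and> (\<forall>z. h z ` cmp M z = cycles ?C 0 z \<and> (\<forall>x\<in>cmp M z. h z x = 0 \<longrightarrow> x = 0))"
    then have h: "morphism M (obj ?C 0) h" and im: "h z ` cmp M z = cycles ?C 0 z"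
      and ker: "\<forall>x\<in>cmp M z. h z x = 0 \<longrightarrow> x = 0" for z
      by simp_all
    have "linear_on (scl M) (scl K) (cmp M z) (cmp K z) (h z)" for z
      using morphismD(1)[OF h, of z] im[of z] by (auto simp: linear_on_def K scl)
    then have "morphism M K h"
      using morphismD(2)[OF h] by (simp add: morphism_def K)
    moreover have "inj_on (h z) (cmp M z)" for z
      using ker linear_on_inj_on_iff[OF DM(1,2) morphismD(1)[OF h]] by simp
    ultimately show "isomorphism M K h"
      using im by (simp add: isomorphism_def bij_betw_def K)
  next
    assume h: "isomorphism M K h"
    then have m: "morphism M K h" and bij: "bij_betw (h z) (cmp M z) (cycles ?C 0 z)" for z
      by (simp_all add: isomorphism_def K)
    have "morphism M (obj ?C 0) h"
      using m linear_on_mono[OF morphismD(1)[OF m, unfolded K] subset_refl Zsub]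
      unfolding morphism_def K scl by simp
    moreover have "\<forall>x\<in>cmp M z. h z x = 0 \<longrightarrow> x = 0" for z
      using linear_on_inj_on_iff[OF DM(1,2) morphismD(1)[OF m]] bij_betw_imp_inj_on[OF bij] by blast
    ultimately show "morphism M (obj ?C 0) h \<and> (\<forall>z. h z ` cmp M z = cycles ?C 0 z \<and> (\<forall>x\<in>cmp M z. h z x = 0 \<longrightarrow> x = 0))"
      using bij_betw_imp_surj_on[OF bij] by simp
  qed
  have "isomorphism M K (\<lambda>z. inv_into (cmp K z) (\<psi> z))" if "isomorphism K M \<psi>" for \<psi>
    using vs subZ strK that by (intro isomorphism_inverse) (simp_all add: K)
  moreover have "isomorphism K M (\<lambda>z. inv_into (cmp M z) (h z))" if "isomorphism M K h" for h
    using linear_onD(1)[OF DM(4)] that by (intro isomorphism_inverse DM) auto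
  ultimately have comp: "(\<exists>\<psi>. comparison M UNIV (int N) \<psi>) \<longleftrightarrow> (\<exists>h. morphism M (obj ?C 0) h \<and>
      (\<forall>z. h z ` cmp M z = cycles ?C 0 z \<and> (\<forall>x\<in>cmp M z. h z x = 0 \<longrightarrow> x = 0)))"
    unfolding compK homK by blast
  have exact: "(\<forall>q z. q \<noteq> int N \<longrightarrow> Z (box UNIV (- UNIV) z) q \<subseteq> Bd (box UNIV (- UNIV) z) q) \<longleftrightarrow>
      (\<forall>q z. q \<noteq> 0 \<longrightarrow> cycles ?C q z \<subseteq> boundaries ?C q z)" (is "(\<forall>q z. ?Z q z) \<longleftrightarrow> (\<forall>q z. ?B q z)")
  proof -
    have eq: "?B q z \<longleftrightarrow> ?Z (int N + q) z" for q z
      by (simp add: cyc bnd)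
    show ?thesis
    proof (intro iffI allI)
      fix q z
      show "?B q z" if "\<forall>q z. ?Z q z"
        using eq[of q z] spec[OF spec[OF that, of "int N + q"], of z] by blast
      show "?Z q z" if "\<forall>q z. ?B q z"
        using eq[of "q - int N" z] spec[OF spec[OF that, of "q - int N"], of z] by simp
    qed
  qed
  have "represents_injective_resolution N W M \<longleftrightarrow> (\<exists>f. quasi_isomorphism f (stalk M) ?C)"
    using grW matchW C zero
    by (simp add: represents_injective_resolution_def injective_resolution_def
        inj_complex_simps(1)[OF matchW] injective_module_inj_sum)
  also have "\<dots> \<longleftrightarrow> resolves M UNIV (int N)"
    unfolding quasi_isomorphism_from_stalk_iff[OF C M zero] resolves_def exact comp ..
  finally show ?thesis .
qed

section \<open>Graded transposes\<close>

lemma gm_transpose_simps [simp]: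
  "rg (gm_transpose A) = rev (map uminus (cg A))" "cg (gm_transpose A) = rev (map uminus (rg A))"
  "ent (gm_transpose A) i j = ent A (length (rg A) - 1 - j) (length (cg A) - 1 - i)"
  by (simp_all add: gm_transpose_def)

lemma rev_map_uminus_nth:
  "j < length gs \<Longrightarrow> rev (map uminus gs) ! j = - (gs ! (length gs - 1 - j) :: int ^ 'n)"
  by (simp add: rev_nth)

lemma graded_matrix_transpose:
  fixes A :: "('k :: field, 'n :: finite) gmat"
  assumes "graded_matrix A"
  shows "graded_matrix (gm_transpose A)"
  unfolding graded_matrix_def
proof (intro allI impI)
  fix i j
  assume "i < length (rg (gm_transpose A))" "j < length (cg (gm_transpose A))"
    and nle: "\<not> rg (gm_transpose A) ! i \<le> cg (gm_transpose A) ! j"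
  then have ij: "i < length (cg A)" "j < length (rg A)" by simp_all
  then have "\<not> rg A ! (length (rg A) - 1 - j) \<le> cg A ! (length (cg A) - 1 - i)"
    using nle by (simp add: rev_map_uminus_nth)
  then show "ent (gm_transpose A) i j = 0"
    using assms ij by (simp add: graded_matrix_def)
qed

text \<open>Transposing reverses all arrows, so the sequence has to be read backwards as well; hence
  the index \<open>N + 1 - q\<close>.\<close>

lemma matching_transpose:
  fixes U :: "nat \<Rightarrow> ('k :: field, 'n :: finite) gmat"
  shows "matching N (\<lambda>q. gm_transpose (U (N + 1 - q))) \<longleftrightarrow> matching N U"
proof -
  have inj: "inj (uminus :: int ^ 'n \<Rightarrow> int ^ 'n)"
    by (simp add: inj_on_def)
  have "matching N (\<lambda>q. gm_transpose (U (N + 1 - q))) \<longleftrightarrow>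
      (\<forall>q. 1 \<le> q \<and> q < N \<longrightarrow> cg (U (N - q)) = rg (U (N + 1 - q)))"
    by (simp add: matching_def inj_map_eq_map[OF inj])
  also have "\<dots> \<longleftrightarrow> (\<forall>q. 1 \<le> q \<and> q < N \<longrightarrow> rg (U (q + 1)) = cg (U q))"
  proof (intro iffI allI impI)
    fix q assume L: "\<forall>q. 1 \<le> q \<and> q < N \<longrightarrow> cg (U (N - q)) = rg (U (N + 1 - q))" and q: "1 \<le> q \<and> q < N"
    have "N - (N - q) = q" "N + 1 - (N - q) = q + 1" using q by auto
    then show "rg (U (q + 1)) = cg (U q)"
      using L[rule_format, of "N - q"] q by auto
  next
    fix q assume R: "\<forall>q. 1 \<le> q \<and> q < N \<longrightarrow> rg (U (q + 1)) = cg (U q)" and q: "1 \<le> q \<and> q < N"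
    have "N + 1 - q = (N - q) + 1" using q by auto
    then show "cg (U (N - q)) = rg (U (N + 1 - q))"
      using R[rule_format, of "N - q"] q by auto
  qed
  finally show ?thesis
    by (simp add: matching_def)
qed

lemma grades_transpose:
  fixes U :: "nat \<Rightarrow> ('k :: field, 'n :: finite) gmat"
  assumes match: "matching N U" and N: "1 \<le> N"
  shows "grades N (\<lambda>q. gm_transpose (U (N + 1 - q))) q = rev (map uminus (grades N U (int N - q)))"
proof -
  consider "q < 0 \<or> q > int N" | "q = 0" | "1 \<le> q" "q \<le> int N" by linarith
  then show ?thesis
  proof cases
    case 1
    then show ?thesis
      using grades_outside[of "int N - q" N U] by (auto simp: grades_outside)
  next
    case 2
    \<comment> \<open>Degree 0 corresponds to degree \<open>N\<close> of the original, whose grades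
      are the columns of \<open>U N\<close> because \<open>N\<close> is positive.\<close>
    then show ?thesis
      using N by (simp add: grades_def)
  next
    case 3
    have "int N + 1 - q = int (N + 1 - nat q)"
      using 3 by auto
    then have "N + 1 - nat q = nat (int N + 1 - q)"
      by linarith
    then have "rg (U (N + 1 - nat q)) = grades N U (int N - q)"
      using grades_matrix(2)[OF match, of "int N + 1 - q"] 3 by simp
    then show ?thesis
      using 3 by (simp add: grades_def)
  qed
qed

section \<open>Duality between free and injective modules\<close>

text \<open>The index is reversed because \<open>gm_transpose\<close> reverses the order of the generators.\<close>

definition pairing :: "(int ^ 'n :: finite) list \<Rightarrow> int ^ 'n \<Rightarrow> (nat \<Rightarrow> 'k :: field) \<Rightarrow> (nat \<Rightarrow> 'k) \<Rightarrow> 'k" where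
  "pairing gs z y = restrict_to (cmp (free_sum (rev (map uminus gs)) :: ('k, nat \<Rightarrow> 'k, 'n) pmod) (- z))
    (\<lambda>x. \<Sum>j<length gs. y j * x (length gs - 1 - j))"

lemma free_sum_rev_mem:
  fixes x :: "nat \<Rightarrow> 'k :: field" and z :: "int ^ 'n :: finite"
  assumes "x \<in> cmp (free_sum (rev (map uminus gs)) :: ('k, nat \<Rightarrow> 'k, 'n) pmod) (- z)" "j < length gs"
    "x (length gs - 1 - j) \<noteq> 0"
  shows "z \<le> gs ! j"
  using assms by (auto simp: free_sum_simps rev_map_uminus_nth)

text \<open>The summand \<open>I g\<close> at \<open>z\<close> and the summand
  \<open>F (- g)\<close> at \<open>- z\<close> are nonzero under the same condition
  \<open>z \<le> g\<close>, so the same coordinates survive on both sides.\<close>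

lemma isomorphism_pairing:
  "isomorphism (inj_sum gs) (dual (free_sum (rev (map uminus gs)))) (pairing gs :: int ^ 'n :: finite \<Rightarrow> (nat \<Rightarrow> 'k :: field) \<Rightarrow> _)"
proof -
  let ?L = "length gs" and ?X = "\<lambda>z. cmp (free_sum (rev (map uminus gs)) :: ('k, nat \<Rightarrow> 'k, 'n) pmod) (- z)"
  let ?s = "\<lambda>c (x :: nat \<Rightarrow> 'k) j. c * x j"
  have scl: "scl (free_sum (rev (map uminus gs)) :: ('k, nat \<Rightarrow> 'k, 'n) pmod) = ?s"
    by (simp add: free_sum_simps)
  have subX: "module.subspace ?s (?X z)" for z
    using persistence_moduleD(2)[OF persistence_module_free_sum] unfolding free_sum_simps(1) .
  have vs: "vector_space ?s"
    by (rule vector_space_fun[OF vector_space_mult])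
  have bij: "bij_betw (pairing gs z) (cmp (inj_sum gs) z) (functionals ?s (?X z))" for z :: "int ^ 'n"
  proof -
    let ?J = "{j. j < ?L \<and> z \<le> gs ! j}" and ?c = "\<lambda>j (x :: nat \<Rightarrow> 'k). x (?L - 1 - j)"
    have "bij_betw (\<lambda>y. restrict_to (?X z) (\<lambda>x. \<Sum>j\<in>?J. y j * ?c j x))
        {y. \<forall>j. j \<notin> ?J \<longrightarrow> y j = 0} (functionals ?s (?X z))"
    proof (rule coordinates_dual_bij[OF vs subX])
      show "finite ?J"
        by (rule finite_subset[of _ "{..<?L}"]) auto
      show "linear_on ?s (*) (?X z) UNIV (?c j)" for j
        by (simp add: linear_on_def)
      show "x = 0" if x: "x \<in> ?X z" "\<forall>j\<in>?J. ?c j x = 0" for x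
      proof
        fix k
        show "x k = 0 k"
        proof (rule ccontr)
          assume "x k \<noteq> 0 k"
          then have k: "k < ?L" "x k \<noteq> 0"
            using x(1) by (auto simp: free_sum_simps)
          then have "?L - 1 - (?L - 1 - k) = k" "?L - 1 - k < ?L" by auto
          with k free_sum_rev_mem[OF x(1), of "?L - 1 - k"] x(2) show False by auto
        qed
      qed
      show "\<exists>x\<in>?X z. ?c j x = 1 \<and> (\<forall>i\<in>?J. i \<noteq> j \<longrightarrow> ?c i x = 0)" if "j \<in> ?J" for j
      proof -
        let ?e = "\<lambda>i. if i = ?L - 1 - j then 1 else 0 :: 'k"
        have "?c i ?e = 0" if "i \<in> ?J" "i \<noteq> j" for i
          using that \<open>j \<in> ?J\<close> by auto
        moreover have "?e \<in> ?X z"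
          using that by (auto simp: free_sum_simps rev_map_uminus_nth)
        ultimately show ?thesis
          by (intro bexI[of _ ?e]) auto
      qed
    qed
    moreover have "{y. \<forall>j. j \<notin> ?J \<longrightarrow> y j = 0} = cmp (inj_sum gs :: ('k, nat \<Rightarrow> 'k, 'n) pmod) z"
      unfolding inj_sum_simps by blast
    \<comment> \<open>The coordinates of \<open>x\<close> paired with the indices outside
      \<open>?J\<close> vanish, so the sum may run over all generators and its formula no longer
      depends on \<open>z\<close>.\<close>
    moreover have "(\<Sum>j\<in>?J. y j * ?c j x) = (\<Sum>j<?L. y j * ?c j x)" if "x \<in> ?X z" for x y
      using free_sum_rev_mem[OF that] by (intro sum.mono_neutral_left) auto
    then have "(\<lambda>y. restrict_to (?X z) (\<lambda>x. \<Sum>j\<in>?J. y j * ?c j x)) = pairing gs z"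
      by (auto simp: pairing_def restrict_to_def fun_eq_iff)
    ultimately show ?thesis by simp
  qed
  have "morphism (inj_sum gs) (dual (free_sum (rev (map uminus gs)))) (pairing gs :: int ^ 'n \<Rightarrow> (nat \<Rightarrow> 'k) \<Rightarrow> _)"
    unfolding morphism_def
  proof (intro conjI allI impI ballI)
    show "linear_on (scl (inj_sum gs)) (scl (dual (free_sum (rev (map uminus gs))))) (cmp (inj_sum gs) z)
        (cmp (dual (free_sum (rev (map uminus gs)))) z) (pairing gs z :: (nat \<Rightarrow> 'k) \<Rightarrow> _)" for z :: "int ^ 'n"
      using bij_betw_imp_surj_on[OF bij[of z]] unfolding linear_on_def dual_simps(1,2) inj_sum_simps(1) scl
      by (auto simp: pairing_def restrict_to_def fun_eq_iff distrib_right sum.distrib sum_distrib_left mult.assoc)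
    fix z w :: "int ^ 'n" and y :: "nat \<Rightarrow> 'k"
    assume zw: "z \<le> w" and y: "y \<in> cmp (inj_sum gs) z"
    have sub: "?X w \<subseteq> ?X z"
      using zw by (auto simp: free_sum_simps intro: order_trans)
    have "(\<Sum>j<?L. str (inj_sum gs) z w y j * x (?L - 1 - j)) = (\<Sum>j<?L. y j * x (?L - 1 - j))" if "x \<in> ?X w" for x
      using free_sum_rev_mem[OF that] by (intro sum.cong) (auto simp: inj_sum_simps)
    then show "pairing gs w (str (inj_sum gs) z w y) =
        str (dual (free_sum (rev (map uminus gs)))) z w (pairing gs z y)"
      using sub by (auto simp: pairing_def dual_simps restrict_to_def fun_eq_iff free_sum_simps(3))
  qed
  then show ?thesis
    using bij unfolding isomorphism_def dual_simps(2) scl by blast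
qed

text \<open>This is the adjunction between a matrix and its transpose. The reversal of rows and
  columns in \<open>gm_transpose\<close> cancels against the reversed index in
  \<open>pairing\<close>.\<close>

lemma pairing_transpose:
  fixes A :: "('k :: field, 'n :: finite) gmat"
  assumes A: "graded_matrix A"
  shows "pairing (rg A) z (inj_map A z y) =
    dual_map (free_sum (cg (gm_transpose A))) (free_map (gm_transpose A)) z (pairing (cg A) z y)"
proof
  fix x
  let ?m = "length (rg A)" and ?l = "length (cg A)"
  show "pairing (rg A) z (inj_map A z y) x =
    dual_map (free_sum (cg (gm_transpose A))) (free_map (gm_transpose A)) z (pairing (cg A) z y) x"
  proof (cases "x \<in> cmp (free_sum (rev (map uminus (rg A))) :: ('k, nat \<Rightarrow> 'k, 'n) pmod) (- z)")
    case True
    have mem: "free_map (gm_transpose A) (- z) x \<in>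
        cmp (free_sum (rev (map uminus (cg A))) :: ('k, nat \<Rightarrow> 'k, 'n) pmod) (- z)"
      using morphismD(3)[OF morphism_free_map[OF graded_matrix_transpose[OF A]], of x "- z"] True by simp
    \<comment> \<open>The rows that \<open>inj_map\<close> clears at \<open>z\<close> are paired
      with vanishing coordinates of \<open>x\<close>.\<close>
    have "(\<Sum>i<?m. inj_map A z y i * x (?m - 1 - i)) = (\<Sum>i<?m. (\<Sum>j<?l. ent A i j * y j) * x (?m - 1 - i))"
      using free_sum_rev_mem[OF True] by (intro sum.cong) (auto simp: inj_map_def)
    also have "\<dots> = (\<Sum>i<?m. \<Sum>j<?l. y j * (ent A i j * x (?m - 1 - i)))"
      by (simp add: sum_distrib_left sum_distrib_right ac_simps)
    also have "\<dots> = (\<Sum>j<?l. \<Sum>i<?m. y j * (ent A i j * x (?m - 1 - i)))"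
      by (rule sum.swap)
    also have "\<dots> = (\<Sum>j<?l. y j * (\<Sum>i<?m. ent A i j * x (?m - 1 - i)))"
      by (simp add: sum_distrib_left)
    also have "\<dots> = (\<Sum>j<?l. y j * free_map (gm_transpose A) (- z) x (?l - 1 - j))"
    proof (rule sum.cong[OF refl])
      fix j assume "j \<in> {..<?l}"
      then have j: "j < ?l" "?l - 1 - (?l - 1 - j) = j" by auto
      have "free_map (gm_transpose A) (- z) x (?l - 1 - j) = (\<Sum>i<?m. ent A (?m - 1 - i) j * x i)"
        using j by (simp add: free_map_def)
      also have "\<dots> = (\<Sum>i<?m. ent A (?m - 1 - (?m - Suc i)) j * x (?m - Suc i))"
        by (rule sum.nat_diff_reindex[symmetric])
      also have "\<dots> = (\<Sum>i<?m. ent A i j * x (?m - 1 - i))"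
        by (intro sum.cong) auto
      finally show "y j * (\<Sum>i<?m. ent A i j * x (?m - 1 - i)) = y j * free_map (gm_transpose A) (- z) x (?l - 1 - j)"
        by simp
    qed
    finally show ?thesis
      using True mem by (simp add: pairing_def dual_map_eq)
  qed (simp add: pairing_def dual_map_eq restrict_to_def)
qed

lemma complex_iso_dual:
  fixes U :: "nat \<Rightarrow> ('k :: field, 'n :: finite) gmat"
  assumes gr: "\<forall>q\<in>{1..N}. graded_matrix (U q)" and match: "matching N U" and N: "1 \<le> N"
  shows "complex_iso (\<lambda>q. pairing (grades N U (int N + q))) (inj_complex N U)
    (dual_complex (free_complex N (\<lambda>q. gm_transpose (U (N + 1 - q)))))"
proof -
  let ?T = "\<lambda>q. gm_transpose (U (N + 1 - q))"
  let ?C = "inj_complex N U" and ?D = "dual_complex (free_complex N ?T)"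
  note gt = grades_transpose[OF match N, folded Suc_eq_plus1]
  have objC: "obj ?C q = inj_sum (grades N U (int N + q))" for q
    by (simp add: inj_complex_def)
  have objD: "obj ?D q = dual (free_sum (rev (map uminus (grades N U (int N + q)))))" for q
    by (simp add: dual_complex_simps free_complex_def gt)
  have iso: "isomorphism (obj ?C q) (obj ?D q) (pairing (grades N U (int N + q)))" for q
    unfolding objC objD by (rule isomorphism_pairing)
  have "pairing (grades N U (int N + (q - 1))) z (bd ?C q z x) = bd ?D q z (pairing (grades N U (int N + q)) z x)"
    for q z x
  proof (cases "1 \<le> int N + q \<and> q \<le> 0")
    case True
    let ?A = "U (nat (int N + q))"
    have A: "graded_matrix ?A"
      using gr nat_in_range[of "int N + q" N] True by simp
    have gr': "cg ?A = grades N U (int N + q)" "rg ?A = grades N U (int N + q - 1)"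
      using grades_matrix[OF match, of "int N + q"] True by auto
    \<comment> \<open>Degree \<open>q\<close> of the dual complex carries the differential of degree
      \<open>1 - q\<close> of the transposed complex, which is the transpose of
      \<open>U (N + q)\<close>.\<close>
    have "int (N + 1 - nat (1 - q)) = int N + q"
      using True by auto
    then have "N + 1 - nat (1 - q) = nat (int N + q)"
      by linarith
    then have "bd ?D q = dual_map (free_sum (cg (gm_transpose ?A))) (free_map (gm_transpose ?A))"
      using True gr' by (simp add: dual_complex_simps free_complex_def gt algebra_simps)
    moreover have "bd ?C q = inj_map ?A"
      using True by (simp add: inj_complex_def)
    ultimately show ?thesis
      using pairing_transpose[OF A, of z x] gr' by (simp add: add_diff_eq)
  next
    case False
    then have "bd ?C q = (\<lambda>z x. 0)"
      by (auto simp: inj_complex_def)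
    moreover have "bd (free_complex N ?T) (1 - q) = (\<lambda>z x. 0)"
      using False by (auto simp: free_complex_def)
    ultimately show ?thesis
      by (auto simp: dual_complex_simps dual_map_eq pairing_def restrict_to_def fun_eq_iff)
  qed
  with iso show ?thesis
    by (simp add: complex_iso_def chain_map_def isomorphism_def)
qed

section \<open>The Nakayama functor on free modules\<close>

definition unit_vec :: "nat \<Rightarrow> nat \<Rightarrow> 'k :: field" where
  "unit_vec j i = (if i = j then 1 else 0)"

lemma unit_vec_mem:
  "j < length gs \<Longrightarrow> gs ! j \<le> z \<Longrightarrow> unit_vec j \<in> cmp (free_sum gs :: ('k :: field, nat \<Rightarrow> 'k, 'n :: finite) pmod) z"
  by (simp add: free_sum_simps unit_vec_def)

lemma scl_Hom: "scl (Hom (free_sum gs :: ('k :: field, nat \<Rightarrow> 'k, 'n :: finite) pmod) (F 0)) = (\<lambda>c f w x. c * f w x)"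
  by (simp add: Hom_def F_def)

text \<open>Structure maps act as identities on the free sum and on \<open>F 0\<close>, so a
  morphism is a family of functionals agreeing along inclusions. Vanishing off the component and
  vanishing where the target is zero are merged into one condition.\<close>

lemma Hom_free_mem_iff:
  fixes \<phi> :: "int ^ 'n :: finite \<Rightarrow> (nat \<Rightarrow> 'k :: field) \<Rightarrow> 'k"
  shows "\<phi> \<in> cmp (Hom (free_sum gs) (F 0)) t \<longleftrightarrow>
    (\<forall>w. linear_on (\<lambda>c x j. c * x j) (*) (cmp (free_sum gs) w) UNIV (\<phi> w)) \<and>
    (\<forall>w x. \<phi> w x \<noteq> 0 \<longrightarrow> x \<in> cmp (free_sum gs) w \<and> 0 \<le> t + w) \<and>
    (\<forall>z w. z \<le> w \<longrightarrow> (\<forall>x\<in>cmp (free_sum gs) z. \<phi> w x = \<phi> z x))"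
proof -
  have lin: "linear_on s t V (if P then UNIV else {0}) f \<longleftrightarrow> linear_on s t V UNIV f \<and> (\<not> P \<longrightarrow> (\<forall>x\<in>V. f x = 0))"
    for s t and V :: "(nat \<Rightarrow> 'k) set" and P and f :: "(nat \<Rightarrow> 'k) \<Rightarrow> 'k"
    by (auto simp: linear_on_def)
  have mem: "\<phi> \<in> cmp (Hom (free_sum gs) (F 0)) t \<longleftrightarrow>
      (\<forall>w. linear_on (\<lambda>c x j. c * x j) (*) (cmp (free_sum gs) w) (if 0 \<le> t + w then UNIV else {0}) (\<phi> w)) \<and>
      (\<forall>z w. z \<le> w \<longrightarrow> (\<forall>x\<in>cmp (free_sum gs) z. \<phi> w x = \<phi> z x)) \<and>
      (\<forall>w x. x \<notin> cmp (free_sum gs) w \<longrightarrow> \<phi> w x = 0)"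
    by (simp add: Hom_def morphism_def shift_def F_def free_sum_simps(1,3))
  have eq: "(\<forall>w. \<not> P w \<longrightarrow> (\<forall>x\<in>S w. f w x = 0)) \<and> (\<forall>w x. x \<notin> S w \<longrightarrow> f w x = 0) \<longleftrightarrow>
      (\<forall>w x. f w x \<noteq> 0 \<longrightarrow> x \<in> S w \<and> P w)"
    for P and S :: "int ^ 'n \<Rightarrow> (nat \<Rightarrow> 'k) set" and f :: "int ^ 'n \<Rightarrow> (nat \<Rightarrow> 'k) \<Rightarrow> 'k"
    by auto
  have aux: "(\<forall>w. L w \<and> (\<not> P w \<longrightarrow> V w)) \<and> X \<and> Y \<longleftrightarrow> (\<forall>w. L w) \<and> Z \<and> X"
    if "(\<forall>w. \<not> P w \<longrightarrow> V w) \<and> Y \<longleftrightarrow> Z" for L P V :: "int ^ 'n \<Rightarrow> bool" and X Y Z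
    unfolding that[symmetric] by blast
  show ?thesis
    unfolding mem lin by (rule aux[OF eq])
qed

lemma Hom_freeD:
  fixes \<phi> :: "int ^ 'n :: finite \<Rightarrow> (nat \<Rightarrow> 'k :: field) \<Rightarrow> 'k"
  assumes "\<phi> \<in> cmp (Hom (free_sum gs) (F 0)) t"
  shows "linear_on (\<lambda>c x j. c * x j) (*) (cmp (free_sum gs) w) UNIV (\<phi> w)"
    "\<phi> w x \<noteq> 0 \<Longrightarrow> x \<in> cmp (free_sum gs) w" "\<phi> w x \<noteq> 0 \<Longrightarrow> 0 \<le> t + w"
    "z \<le> w \<Longrightarrow> x \<in> cmp (free_sum gs) z \<Longrightarrow> \<phi> w x = \<phi> z x"
proof -
  note h = assms[unfolded Hom_free_mem_iff]
  show "linear_on (\<lambda>c x j. c * x j) (*) (cmp (free_sum gs) w) UNIV (\<phi> w)"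
    using conjunct1[OF h] by simp
  show "\<phi> w x \<noteq> 0 \<Longrightarrow> x \<in> cmp (free_sum gs) w" "\<phi> w x \<noteq> 0 \<Longrightarrow> 0 \<le> t + w"
    using conjunct1[OF conjunct2[OF h], rule_format, of w x] by simp_all
  show "z \<le> w \<Longrightarrow> x \<in> cmp (free_sum gs) z \<Longrightarrow> \<phi> w x = \<phi> z x"
    using conjunct2[OF conjunct2[OF h], rule_format, of z w x] by simp
qed

lemma Hom_free_mono:
  fixes z w :: "int ^ 'n :: finite"
  assumes "z \<le> w"
  shows "cmp (Hom (free_sum gs :: ('k :: field, nat \<Rightarrow> 'k, 'n) pmod) (F 0)) z \<subseteq> cmp (Hom (free_sum gs) (F 0)) w"
proof
  fix \<phi> :: "int ^ 'n \<Rightarrow> (nat \<Rightarrow> 'k) \<Rightarrow> 'k"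
  assume \<phi>: "\<phi> \<in> cmp (Hom (free_sum gs) (F 0)) z"
  have "0 \<le> w + u" if "0 \<le> z + u" for u
    using that assms by (auto simp: less_eq_vec_def intro: order_trans[OF _ add_right_mono])
  then show "\<phi> \<in> cmp (Hom (free_sum gs) (F 0)) w"
    unfolding Hom_free_mem_iff using Hom_freeD[OF \<phi>] by (intro conjI allI impI ballI) simp_all
qed

lemma str_Hom_free:
  fixes \<phi> :: "int ^ 'n :: finite \<Rightarrow> (nat \<Rightarrow> 'k :: field) \<Rightarrow> 'k"
  assumes "\<phi> \<in> cmp (Hom (free_sum gs) (F 0)) t"
  shows "str (Hom (free_sum gs) (F 0)) z w \<phi> = \<phi>"
proof (intro ext)
  fix u x
  show "str (Hom (free_sum gs) (F 0)) z w \<phi> u x = \<phi> u x"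
    using Hom_freeD(2)[OF assms, of u x] by (auto simp: Hom_def F_def)
qed

text \<open>A morphism on a free module is determined by its values on the generators, each taken at
  its own grade and carried along the structure maps.\<close>

lemma Hom_free_expand:
  fixes \<phi> :: "int ^ 'n :: finite \<Rightarrow> (nat \<Rightarrow> 'k :: field) \<Rightarrow> 'k"
  assumes \<phi>: "\<phi> \<in> cmp (Hom (free_sum gs) (F 0)) t"
    and x: "x \<in> cmp (free_sum gs :: ('k, nat \<Rightarrow> 'k, 'n) pmod) w"
  shows "\<phi> w x = (\<Sum>j<length gs. x j * \<phi> (gs ! j) (unit_vec j))"
proof -
  let ?J = "{j. j < length gs \<and> gs ! j \<le> w}"
  have fin: "finite ?J"
    by (rule finite_subset[of _ "{..<length gs}"]) auto
  have sum: "(\<Sum>j\<in>S. (\<lambda>i. x j * unit_vec j i)) i = (\<Sum>j\<in>S. x j * unit_vec j i)" for S i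
    by (induction S rule: infinite_finite_induct) auto
  have x_eq: "x = (\<Sum>j\<in>?J. (\<lambda>i. x j * unit_vec j i))"
  proof
    fix i
    have "(\<Sum>j\<in>?J. x j * unit_vec j i) = (\<Sum>j\<in>?J. if j = i then x j else 0)"
      by (intro sum.cong) (auto simp: unit_vec_def)
    also have "\<dots> = x i"
      using x fin by (auto simp: free_sum_simps)
    finally show "x i = (\<Sum>j\<in>?J. (\<lambda>i. x j * unit_vec j i)) i"
      by (simp add: sum)
  qed
  have sub: "module.subspace (\<lambda>c x j. c * x j) (cmp (free_sum gs :: ('k, nat \<Rightarrow> 'k, 'n) pmod) w)"
    using persistence_moduleD(2)[OF persistence_module_free_sum] unfolding free_sum_simps(1) .
  have "\<phi> w x = \<phi> w (\<Sum>j\<in>?J. (\<lambda>i. x j * unit_vec j i))"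
    using x_eq by simp
  also have "\<dots> = (\<Sum>j\<in>?J. x j * \<phi> w (unit_vec j))"
    using linear_on_sum_scale[OF Hom_freeD(1)[OF \<phi>] vector_space_fun[OF vector_space_mult]
        vector_space_mult sub fin, of unit_vec x] unit_vec_mem by blast
  also have "\<dots> = (\<Sum>j\<in>?J. x j * \<phi> (gs ! j) (unit_vec j))"
  proof (rule sum.cong[OF refl])
    fix j assume j: "j \<in> ?J"
    then have "unit_vec j \<in> cmp (free_sum gs :: ('k, nat \<Rightarrow> 'k, 'n) pmod) (gs ! j)"
      by (simp add: unit_vec_mem)
    then show "x j * \<phi> w (unit_vec j) = x j * \<phi> (gs ! j) (unit_vec j)"
      using Hom_freeD(4)[OF \<phi>] j by simp
  qed
  also have "\<dots> = (\<Sum>j<length gs. x j * \<phi> (gs ! j) (unit_vec j))"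
    using x by (intro sum.mono_neutral_left) (auto simp: free_sum_simps)
  finally show ?thesis .
qed

text \<open>Generator \<open>j\<close> of the injective sum corresponds to evaluation of morphisms
  at generator \<open>j\<close> of the free sum; this is the identification of \<open>I g\<close>
  with \<open>nu (F g)\<close>, extended to sums.\<close>

definition nu_pairing ::
  "(int ^ 'n :: finite) list \<Rightarrow> int ^ 'n \<Rightarrow> (nat \<Rightarrow> 'k :: field) \<Rightarrow> (int ^ 'n \<Rightarrow> (nat \<Rightarrow> 'k) \<Rightarrow> 'k) \<Rightarrow> 'k"
where
  "nu_pairing gs z y = restrict_to (cmp (Hom (free_sum gs) (F 0)) (- z))
    (\<lambda>\<phi>. \<Sum>j<length gs. y j * \<phi> (gs ! j) (unit_vec j))"

lemma vec_zero_le_diff: "0 \<le> - z + w \<longleftrightarrow> z \<le> (w :: int ^ 'n)"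
  by (simp add: less_eq_vec_def)

lemma vec_add_le_iff: "e + z \<le> g \<longleftrightarrow> z \<le> g - (e :: int ^ 'n)"
  by (auto simp: less_eq_vec_def algebra_simps)

lemma nu_simps:
  fixes gs :: "(int ^ 'n :: finite) list" and e :: "int ^ 'n"
  defines "N \<equiv> shift e (nu (free_sum gs :: ('k :: field, nat \<Rightarrow> 'k, 'n) pmod))"
  shows "scl N = (\<lambda>c p \<phi>. c * p \<phi>)"
    "cmp N z = functionals (\<lambda>c f w x. c * f w x) (cmp (Hom (free_sum gs) (F 0)) (- (e + z)))"
    "z \<le> w \<Longrightarrow> str N z w p = restrict_to (cmp (Hom (free_sum gs) (F 0)) (- (e + w))) p"
proof -
  show "scl N = (\<lambda>c p \<phi>. c * p \<phi>)"
    "cmp N z = functionals (\<lambda>c f w x. c * f w x) (cmp (Hom (free_sum gs) (F 0)) (- (e + z)))"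
    by (simp_all add: N_def shift_def nu_def dual_simps scl_Hom)
  show "str N z w p = restrict_to (cmp (Hom (free_sum gs) (F 0)) (- (e + w))) p"
    by (auto simp: N_def shift_def nu_def dual_simps restrict_to_def fun_eq_iff str_Hom_free)
qed

text \<open>Morphisms from \<open>F g\<close> to \<open>F 0\<close> shifted by \<open>- z\<close>
  form a line if \<open>z \<le> g\<close> and are zero otherwise, which is the dimension of
  \<open>I g\<close> at \<open>z\<close>. The values on the generators alive at this grade are
  coordinates on the whole space of morphisms.\<close>

lemma isomorphism_nu_pairing:
  fixes gs :: "(int ^ 'n :: finite) list"
  shows "isomorphism (inj_sum (map (\<lambda>g. g - e) gs)) (shift e (nu (free_sum gs)))
    (\<lambda>z. nu_pairing gs (e + z) :: (nat \<Rightarrow> 'k :: field) \<Rightarrow> _)"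
proof -
  let ?L = "length gs" and ?gs = "map (\<lambda>g. g - e) gs"
  let ?X = "\<lambda>z. cmp (Hom (free_sum gs :: ('k, nat \<Rightarrow> 'k, 'n) pmod) (F 0)) (- (e + z))"
  let ?s = "\<lambda>c (\<phi> :: int ^ 'n \<Rightarrow> (nat \<Rightarrow> 'k) \<Rightarrow> 'k) w x. c * \<phi> w x"
  have vs: "vector_space ?s"
    by (rule vector_space_fun[OF vector_space_fun[OF vector_space_mult]])
  have nonzero: "z \<le> gs ! j - e" if "\<phi> \<in> ?X z" "\<phi> (gs ! j) x \<noteq> 0" for \<phi> z x j
    using Hom_freeD(3)[OF that] unfolding vec_zero_le_diff vec_add_le_iff .
  have subX: "module.subspace ?s (?X z)" for z
  proof -
    interpret vector_space ?s by (rule vs)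
    show ?thesis
    proof (rule subspaceI)
      show "0 \<in> ?X z"
        unfolding Hom_free_mem_iff by (simp add: linear_on_def)
    next
      fix f g assume f: "f \<in> ?X z" and g: "g \<in> ?X z"
      show "f + g \<in> ?X z"
        unfolding Hom_free_mem_iff
      proof (intro conjI allI impI ballI)
        show "linear_on (\<lambda>c x j. c * x j) (*) (cmp (free_sum gs) w) UNIV ((f + g) w)" for w
          using Hom_freeD(1)[OF f, of w] Hom_freeD(1)[OF g, of w] by (auto simp: linear_on_def algebra_simps)
        fix w x assume "(f + g) w x \<noteq> 0"
        then consider "f w x \<noteq> 0" | "g w x \<noteq> 0" by force
        then show "x \<in> cmp (free_sum gs) w" "0 \<le> - (e + z) + w"
          using Hom_freeD(2,3)[OF f, of w x] Hom_freeD(2,3)[OF g, of w x] by (cases; simp)+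
      qed (use Hom_freeD(4)[OF f] Hom_freeD(4)[OF g] in simp)
    next
      fix c f assume f: "f \<in> ?X z"
      show "(\<lambda>w x. c * f w x) \<in> ?X z"
        unfolding Hom_free_mem_iff
      proof (intro conjI allI impI ballI)
        show "linear_on (\<lambda>c x j. c * x j) (*) (cmp (free_sum gs) w) UNIV (\<lambda>x. c * f w x)" for w
          using Hom_freeD(1)[OF f, of w] by (auto simp: linear_on_def algebra_simps)
        fix w x assume "c * f w x \<noteq> 0"
        then have "f w x \<noteq> 0" by auto
        then show "x \<in> cmp (free_sum gs) w" "0 \<le> - (e + z) + w"
          by (rule Hom_freeD(2,3)[OF f])+
      qed (use Hom_freeD(4)[OF f] in simp)
    qed
  qed
  have bij: "bij_betw (nu_pairing gs (e + z)) (cmp (inj_sum ?gs) z) (functionals ?s (?X z))" for z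
  proof -
    let ?J = "{j. j < ?L \<and> z \<le> gs ! j - e}"
    let ?c = "\<lambda>j (\<phi> :: int ^ 'n \<Rightarrow> (nat \<Rightarrow> 'k) \<Rightarrow> 'k). \<phi> (gs ! j) (unit_vec j)"
    have "bij_betw (\<lambda>y. restrict_to (?X z) (\<lambda>\<phi>. \<Sum>j\<in>?J. y j * ?c j \<phi>))
        {y. \<forall>j. j \<notin> ?J \<longrightarrow> y j = 0} (functionals ?s (?X z))"
    proof (rule coordinates_dual_bij[OF vs subX])
      show "finite ?J"
        by (rule finite_subset[of _ "{..<?L}"]) auto
      show "linear_on ?s (*) (?X z) UNIV (?c j)" for j
        by (simp add: linear_on_def)
      show "\<phi> = 0" if \<phi>: "\<phi> \<in> ?X z" "\<forall>j\<in>?J. ?c j \<phi> = 0" for \<phi>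
      proof (intro ext)
        fix w x
        have "?c j \<phi> = 0" if "j < ?L" for j
          using nonzero[OF \<phi>(1), of j "unit_vec j"] \<phi>(2) that by auto
        then have "\<phi> w x = 0" if "x \<in> cmp (free_sum gs) w"
          using Hom_free_expand[OF \<phi>(1) that] by simp
        then show "\<phi> w x = 0 w x"
          using Hom_freeD(2)[OF \<phi>(1), of w x] by auto
      qed
      show "\<exists>\<phi>\<in>?X z. ?c j \<phi> = 1 \<and> (\<forall>i\<in>?J. i \<noteq> j \<longrightarrow> ?c i \<phi> = 0)" if j: "j \<in> ?J" for j
      proof -
        \<comment> \<open>The coordinate function \<open>j\<close>; it lands in the shifted
          \<open>F 0\<close> because \<open>j\<close> belongs to \<open>?J\<close>.\<close>
        define \<phi> :: "int ^ 'n \<Rightarrow> (nat \<Rightarrow> 'k) \<Rightarrow> 'k" where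
          "\<phi> w x = (if x \<in> cmp (free_sum gs :: ('k, nat \<Rightarrow> 'k, 'n) pmod) w then x j else 0)" for w x
        have mono: "cmp (free_sum gs :: ('k, nat \<Rightarrow> 'k, 'n) pmod) u \<subseteq> cmp (free_sum gs) w" if "u \<le> w" for u w
          using that by (auto simp: free_sum_simps intro: order_trans)
        have "linear_on (\<lambda>c x j. c * x j) (*) (cmp (free_sum gs) w) UNIV (\<phi> w)" for w
          unfolding linear_on_def \<phi>_def free_sum_simps by force
        moreover have "x \<in> cmp (free_sum gs) w \<and> 0 \<le> - (e + z) + w" if "\<phi> w x \<noteq> 0" for w x
        proof
          show x: "x \<in> cmp (free_sum gs) w"
            using that by (auto simp: \<phi>_def split: if_splits)
          then have "gs ! j \<le> w"
            using that by (auto simp: \<phi>_def free_sum_simps)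
          moreover have "e + z \<le> gs ! j"
            using j by (simp add: vec_add_le_iff)
          ultimately show "0 \<le> - (e + z) + w"
            unfolding vec_zero_le_diff by (rule order_trans[rotated])
        qed
        moreover have "\<phi> w x = \<phi> u x" if "u \<le> w" "x \<in> cmp (free_sum gs) u" for u w x
          using mono[OF that(1)] that(2) by (auto simp: \<phi>_def)
        ultimately have "\<phi> \<in> ?X z"
          unfolding Hom_free_mem_iff by blast
        moreover have "?c i \<phi> = (if i = j then 1 else 0)" if "i < ?L" for i
          using unit_vec_mem[OF that, of "gs ! i", where 'k = 'k] by (simp add: \<phi>_def) (simp add: unit_vec_def)
        ultimately show ?thesis
          using j by (intro bexI[of _ \<phi>]) auto
      qed
    qed
    moreover have "{y. \<forall>j. j \<notin> ?J \<longrightarrow> y j = 0} = cmp (inj_sum ?gs :: ('k, nat \<Rightarrow> 'k, 'n) pmod) z"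
    proof -
      have "j < length ?gs \<and> z \<le> ?gs ! j \<longleftrightarrow> j \<in> ?J" for j by auto
      then show ?thesis
        unfolding inj_sum_simps by blast
    qed
    moreover have "(\<Sum>j\<in>?J. y j * ?c j \<phi>) = (\<Sum>j<?L. y j * ?c j \<phi>)" if "\<phi> \<in> ?X z" for \<phi> y
      using nonzero[OF that] by (intro sum.mono_neutral_left) auto
    then have "(\<lambda>y. restrict_to (?X z) (\<lambda>\<phi>. \<Sum>j\<in>?J. y j * ?c j \<phi>)) = nu_pairing gs (e + z)"
      by (auto simp: nu_pairing_def restrict_to_def fun_eq_iff)
    ultimately show ?thesis by simp
  qed
  have "morphism (inj_sum ?gs) (shift e (nu (free_sum gs))) (\<lambda>z. nu_pairing gs (e + z) :: (nat \<Rightarrow> 'k) \<Rightarrow> _)"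
    unfolding morphism_def
  proof (intro conjI allI impI ballI)
    show "linear_on (scl (inj_sum ?gs)) (scl (shift e (nu (free_sum gs)))) (cmp (inj_sum ?gs) z)
        (cmp (shift e (nu (free_sum gs))) z) (nu_pairing gs (e + z) :: (nat \<Rightarrow> 'k) \<Rightarrow> _)" for z
      using bij_betw_imp_surj_on[OF bij[of z]] unfolding linear_on_def nu_simps(1,2) inj_sum_simps(1)
      by (auto simp: nu_pairing_def restrict_to_def fun_eq_iff distrib_right sum.distrib sum_distrib_left mult.assoc)
    fix z w :: "int ^ 'n" and y :: "nat \<Rightarrow> 'k"
    assume zw: "z \<le> w"
    have "- (e + w) \<le> - (e + z)"
      using zw by (simp add: less_eq_vec_def)
    then have sub: "?X w \<subseteq> ?X z"
      by (rule Hom_free_mono)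
    have "(\<Sum>j<?L. str (inj_sum ?gs) z w y j * \<phi> (gs ! j) (unit_vec j)) = (\<Sum>j<?L. y j * \<phi> (gs ! j) (unit_vec j))"
      if "\<phi> \<in> ?X w" for \<phi>
      using nonzero[OF that] by (intro sum.cong) (auto simp: inj_sum_simps)
    then show "nu_pairing gs (e + w) (str (inj_sum ?gs) z w y) =
        str (shift e (nu (free_sum gs))) z w (nu_pairing gs (e + z) y)"
      unfolding nu_simps(3)[OF zw] using sub by (auto simp: nu_pairing_def restrict_to_def fun_eq_iff)
  qed
  then show ?thesis
    using bij unfolding isomorphism_def nu_simps(2) by blast
qed

text \<open>A morphism composed with the matrix takes on generator \<open>j\<close> the combination
  of its values on the rows with coefficients from column \<open>j\<close>. Interchanging the two
  sums, the same matrix acts on \<open>y\<close>.\<close>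

lemma nu_pairing_map:
  fixes A :: "('k :: field, 'n :: finite) gmat"
  assumes A: "graded_matrix A"
  shows "nu_pairing (rg A) (e + z) (inj_map (gm_shift e A) z y) =
    nu_map (free_sum (cg A)) (free_sum (rg A)) (free_map A) (e + z) (nu_pairing (cg A) (e + z) y)"
proof
  fix \<phi> :: "int ^ 'n \<Rightarrow> (nat \<Rightarrow> 'k) \<Rightarrow> 'k"
  let ?m = "length (rg A)" and ?l = "length (cg A)"
  let ?X = "cmp (Hom (free_sum (rg A) :: ('k, nat \<Rightarrow> 'k, 'n) pmod) (F 0)) (- (e + z))"
  let ?M = "free_sum (cg A) :: ('k, nat \<Rightarrow> 'k, 'n) pmod"
  let ?\<phi>' = "Hom_map ?M (free_map A) (- (e + z)) \<phi>"
  note m = morphism_free_map[OF A]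
  show "nu_pairing (rg A) (e + z) (inj_map (gm_shift e A) z y) \<phi> =
    nu_map ?M (free_sum (rg A)) (free_map A) (e + z) (nu_pairing (cg A) (e + z) y) \<phi>"
  proof (cases "\<phi> \<in> ?X")
    case True
    have \<phi>': "?\<phi>' \<in> cmp (Hom ?M (F 0)) (- (e + z))"
      unfolding Hom_free_mem_iff
    proof (intro conjI allI impI ballI)
      have sub: "module.subspace (\<lambda>c x j. c * x j) (cmp ?M w)" for w
        using persistence_moduleD(2)[OF persistence_module_free_sum] unfolding free_sum_simps(1) .
      show "linear_on (\<lambda>c x j. c * x j) (*) (cmp ?M w) UNIV (?\<phi>' w)" for w
        using linear_on_cong[OF linear_on_comp[OF morphismD(1)[OF m, unfolded free_sum_simps(1)] Hom_freeD(1)[OF True]]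
            _ vector_space_fun[OF vector_space_mult] sub, of w "?\<phi>' w"]
        by (simp add: Hom_map_def)
      fix w x assume "?\<phi>' w x \<noteq> 0"
      then show "x \<in> cmp ?M w" "0 \<le> - (e + z) + w"
        using Hom_freeD(3)[OF True] by (auto simp: Hom_map_def split: if_splits)
    next
      fix u w x assume uw: "u \<le> w" and x: "x \<in> cmp ?M u"
      then have "x \<in> cmp ?M w"
        by (auto simp: free_sum_simps intro: order_trans)
      moreover have "free_map A w x = free_map A u x"
        by (simp add: free_map_def fun_eq_iff)
      ultimately show "?\<phi>' w x = ?\<phi>' u x"
        using x Hom_freeD(4)[OF True uw morphismD(3)[OF m x]] by (simp add: Hom_map_def)
    qed
    have val: "?\<phi>' (cg A ! j) (unit_vec j) = (\<Sum>i<?m. ent A i j * \<phi> (rg A ! i) (unit_vec i))" if j: "j < ?l" for j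
    proof -
      have u: "unit_vec j \<in> cmp ?M (cg A ! j)"
        using j by (simp add: unit_vec_mem)
      have "free_map A (cg A ! j) (unit_vec j) i = ent A i j" if "i < ?m" for i
        using that j by (simp add: free_map_def unit_vec_def if_distrib[of "\<lambda>x. _ * x"] cong: if_cong)
      then show ?thesis
        using u Hom_free_expand[OF True morphismD(3)[OF m u]] by (simp add: Hom_map_def)
    qed
    have nonzero: "z \<le> rg A ! i - e" if "\<phi> (rg A ! i) x \<noteq> 0" for i x
      using Hom_freeD(3)[OF True that] unfolding vec_zero_le_diff vec_add_le_iff .
    have "(\<Sum>i<?m. inj_map (gm_shift e A) z y i * \<phi> (rg A ! i) (unit_vec i)) =
        (\<Sum>i<?m. (\<Sum>j<?l. ent A i j * y j) * \<phi> (rg A ! i) (unit_vec i))"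
      using nonzero by (intro sum.cong) (auto simp: inj_map_def)
    also have "\<dots> = (\<Sum>i<?m. \<Sum>j<?l. y j * (ent A i j * \<phi> (rg A ! i) (unit_vec i)))"
      by (simp add: sum_distrib_left sum_distrib_right ac_simps)
    also have "\<dots> = (\<Sum>j<?l. \<Sum>i<?m. y j * (ent A i j * \<phi> (rg A ! i) (unit_vec i)))"
      by (rule sum.swap)
    also have "\<dots> = (\<Sum>j<?l. y j * ?\<phi>' (cg A ! j) (unit_vec j))"
      by (intro sum.cong) (simp_all only: lessThan_iff val sum_distrib_left)
    finally show ?thesis
      using True \<phi>' by (simp add: nu_pairing_def nu_map_def dual_map_eq)
  qed (simp add: nu_pairing_def nu_map_def dual_map_eq restrict_to_def)
qed

lemma complex_iso_nu:
  fixes U :: "nat \<Rightarrow> ('k :: field, 'n :: finite) gmat"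
  assumes gr: "\<forall>q\<in>{1..N}. graded_matrix (U q)" and match: "matching N U"
  shows "complex_iso (\<lambda>q z. nu_pairing (grades N U (int N + q)) (e + z)) (inj_complex N (\<lambda>q. gm_shift e (U q)))
    (translate (int N) (shift_complex e (nu_complex (free_complex N U))))"
proof -
  let ?C = "inj_complex N (\<lambda>q. gm_shift e (U q))"
  let ?D = "translate (int N) (shift_complex e (nu_complex (free_complex N U)))"
  let ?f = "\<lambda>q z. nu_pairing (grades N U (int N + q)) (e + z)"
  have objC: "obj ?C q = inj_sum (map (\<lambda>g. g - e) (grades N U (int N + q)))" for q
    by (simp add: inj_complex_def grades_shift)
  have objD: "obj ?D q = shift e (nu (free_sum (grades N U (int N + q))))" for q
    by (simp add: translate_def shift_complex_def nu_complex_def free_complex_def add.commute)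
  have bdD: "bd ?D q z = nu_map (free_sum (grades N U (int N + q))) (free_sum (grades N U (int N + q - 1)))
      (bd (free_complex N U) (int N + q)) (e + z)" for q z
    by (simp add: translate_def shift_complex_def nu_complex_def free_complex_def add.commute)
  have iso: "isomorphism (obj ?C q) (obj ?D q) (?f q)" for q
    unfolding objC objD by (rule isomorphism_nu_pairing)
  have "?f (q - 1) z (bd ?C q z x) = bd ?D q z (?f q z x)" for q z x
  proof (cases "1 \<le> int N + q \<and> q \<le> 0")
    case True
    let ?A = "U (nat (int N + q))"
    have A: "graded_matrix ?A"
      using gr nat_in_range[of "int N + q" N] True by simp
    have gr': "cg ?A = grades N U (int N + q)" "rg ?A = grades N U (int N + q - 1)"
      using grades_matrix[OF match, of "int N + q"] True by auto
    have "bd (free_complex N U) (int N + q) = free_map ?A"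
      using True by (simp add: free_complex_def)
    moreover have "bd ?C q = inj_map (gm_shift e ?A)"
      using True by (simp add: inj_complex_def)
    ultimately show ?thesis
      using nu_pairing_map[OF A, of e z x] gr' by (simp add: bdD add_diff_eq)
  next
    case False
    then have "bd ?C q = (\<lambda>z x. 0)" "bd (free_complex N U) (int N + q) = (\<lambda>z x. 0)"
      by (auto simp: inj_complex_def free_complex_def)
    note bd0 = this
    \<comment> \<open>Outside the range of the matrices, precomposing with the zero differential
      evaluates morphisms at 0.\<close>
    have zero: "\<phi> w 0 = 0" if "\<phi> \<in> cmp (Hom (free_sum gs :: ('k, nat \<Rightarrow> 'k, 'n) pmod) (F 0)) t" for \<phi> w gs t
      using linear_on_zero[OF Hom_freeD(1)[OF that] persistence_module_zero_mem[OF persistence_module_free_sum]] .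
    show ?thesis
    proof
      fix \<phi>
      show "?f (q - 1) z (bd ?C q z x) \<phi> = bd ?D q z (?f q z x) \<phi>"
        unfolding bdD bd0
        by (auto simp: nu_map_def dual_map_eq nu_pairing_def restrict_to_def Hom_map_def zero add_diff_eq
            intro!: sum.neutral)
    qed
  qed
  with iso show ?thesis
    by (simp add: complex_iso_def chain_map_def isomorphism_def)
qed

text \<open>The vanishing of the squared differential is transported along the bijections, so it can
  be decided before either side is known to be a complex.\<close>

lemma complex_iso_complex_iff:
  assumes PC: "\<And>q. persistence_module (obj C q)" "\<And>q. morphism (obj C q) (obj C (q - 1)) (bd C q)"
    and PD: "\<And>q. persistence_module (obj D q)" "\<And>q. morphism (obj D q) (obj D (q - 1)) (bd D q)"
    and iso: "complex_iso h C D"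
  shows "complex C \<longleftrightarrow> complex D"
proof -
  have h: "chain_map h C D" "\<And>q z. bij_betw (h q z) (cmp (obj C q) z) (cmp (obj D q) z)"
    using iso by (auto simp: complex_iso_def isomorphism_def)
  have hdd: "h (q - 1 - 1) z (bd C (q - 1) z (bd C q z x)) = bd D (q - 1) z (bd D q z (h q z x))"
    if "x \<in> cmp (obj C q) z" for q z x
    using chain_mapD(2)[OF h(1) morphismD(3)[OF PC(2) that]] chain_mapD(2)[OF h(1) that]
    by (simp only:)
  have h0: "h q z 0 = 0" for q z
    using morphism_zero[OF PC(1) chain_mapD(1)[OF h(1)]] .
  have "bd C (q - 1) z (bd C q z x) = 0 \<longleftrightarrow> bd D (q - 1) z (bd D q z (h q z x)) = 0"
    if x: "x \<in> cmp (obj C q) z" for q z x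
  proof -
    have "bd C (q - 1) z (bd C q z x) \<in> cmp (obj C (q - 1 - 1)) z"
      using morphismD(3)[OF PC(2) morphismD(3)[OF PC(2) x]] .
    then have "bd C (q - 1) z (bd C q z x) = 0 \<longleftrightarrow> h (q - 1 - 1) z (bd C (q - 1) z (bd C q z x)) = h (q - 1 - 1) z 0"
      using inj_on_eq_iff[OF bij_betw_imp_inj_on[OF h(2)] _ persistence_module_zero_mem[OF PC(1)]] by blast
    then show ?thesis
      unfolding hdd[OF x] h0 .
  qed
  then have "(\<forall>x\<in>cmp (obj C q) z. bd C (q - 1) z (bd C q z x) = 0) \<longleftrightarrow>
      (\<forall>y\<in>cmp (obj D q) z. bd D (q - 1) z (bd D q z y) = 0)" for q z
    unfolding bij_betw_imp_surj_on[OF h(2), of q z, symmetric] by simp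
  then show ?thesis
    using PC PD by (simp add: complex_def)
qed

section \<open>Equivalence of the three conditions\<close>

lemma represents_injective_iff_dual:
  fixes U :: "nat \<Rightarrow> ('k :: field, 'n :: finite) gmat" and M :: "('k, 'v :: ab_group_add, 'n) pmod"
  assumes gr: "\<forall>q\<in>{1..N}. graded_matrix (U q)" and M: "persistence_module M" and N: "1 \<le> N"
  shows "represents_injective_resolution N U M \<longleftrightarrow>
    represents_free_resolution N (\<lambda>q. gm_transpose (U (N + 1 - q))) (dual M)"
proof (cases "matching N U")
  case match: True
  let ?T = "\<lambda>q. gm_transpose (U (N + 1 - q))"
  let ?I = "inj_complex N U" and ?C = "free_complex N ?T"
  have matchT: "matching N ?T"
    using match matching_transpose by blast
  have "graded_matrix (?T q)" if "q \<in> {1..N}" for q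
  proof -
    have "N + 1 - q \<in> {1..N}"
      using that by auto
    then show ?thesis
      using gr graded_matrix_transpose by blast
  qed
  then have grT: "\<forall>q\<in>{1..N}. graded_matrix (?T q)" by blast
  note mC = morphism_bd_free_complex[OF grT matchT]
  have pC: "persistence_module (obj ?C q)" for q
    by (simp add: free_complex_def persistence_module_free_sum)
  have pI: "persistence_module (obj ?I q)" for q
    by (simp add: inj_complex_def persistence_module_inj_sum)
  have pD: "persistence_module (obj (dual_complex ?C) q)" for q
    using persistence_module_dual[OF pC] by (simp add: dual_complex_simps)
  have mD: "morphism (obj (dual_complex ?C) q) (obj (dual_complex ?C) (q - 1)) (bd (dual_complex ?C) q)" for q
    using morphism_dual_map[OF pC mC[of "1 - q"]] by (simp add: dual_complex_simps)
  have fm: "\<forall>q. free_module (obj ?C q)"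
    by (simp add: free_complex_def free_module_free_sum)
  note iso = complex_iso_dual[OF gr match N]
  have cIC: "complex ?I \<longleftrightarrow> complex ?C"
    using complex_iso_complex_iff[OF pI morphism_bd_inj_complex[OF gr match] pD mD iso]
      complex_dual_iff[OF pC mC] by blast
  have zeroC: "\<forall>q<0. is_zero (obj ?C q)"
    by (auto simp: is_zero_def free_complex_def grades_outside free_sum_simps)
  have zeroI: "\<forall>q>0. is_zero (obj ?I q)"
    by (auto simp: is_zero_def inj_complex_def grades_outside inj_sum_simps)
  show ?thesis
  proof (cases "complex ?C")
    case C: True
    then have I: "complex ?I" and D: "complex (dual_complex ?C)"
      using cIC complex_dual_iff[OF pC mC] by blast+
    have "represents_injective_resolution N U M \<longleftrightarrow> (\<exists>f. quasi_isomorphism f (stalk M) ?I)"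
      using gr match I zeroI
      by (simp add: represents_injective_resolution_def injective_resolution_def
          inj_complex_simps(1)[OF match] injective_module_inj_sum)
    also have "\<dots> \<longleftrightarrow> (\<exists>f. quasi_isomorphism f (stalk M) (dual_complex ?C))"
      by (rule quasi_isomorphism_iso_iff[OF complex_stalk[OF M] I D iso])
    also have "\<dots> \<longleftrightarrow> (\<exists>f. quasi_isomorphism f ?C (stalk (dual M)))"
      by (rule quasi_isomorphism_dual_iff[OF C M zeroC, symmetric])
    also have "\<dots> \<longleftrightarrow> represents_free_resolution N ?T (dual M)"
      unfolding represents_free_resolution_def free_resolution_def
      using grT matchT C zeroC fm by argo
    finally show ?thesis .
  next
    case False
    \<comment> \<open>If one of the two is not a complex, neither is the other, and both conditions
      fail.\<close>
    then show ?thesis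
      unfolding represents_injective_resolution_def represents_free_resolution_def
        injective_resolution_def free_resolution_def using cIC by blast
  qed
next
  case False
  then show ?thesis
    unfolding represents_injective_resolution_def represents_free_resolution_def matching_transpose by blast
qed

lemma represents_free_iff_injective:
  fixes U :: "nat \<Rightarrow> ('k :: field, 'n :: finite) gmat" and M :: "('k, 'v :: ab_group_add, 'n) pmod"
  assumes gr: "\<forall>q\<in>{1..CARD('n)}. graded_matrix (U q)" and M: "persistence_module M" and dim: "total_dim M < \<infinity>"
  shows "represents_free_resolution CARD('n) U M \<longleftrightarrow>
    represents_injective_resolution CARD('n) (\<lambda>q. gm_shift (\<chi> i. 1) (U q)) M"
proof (cases "matching CARD('n) U \<and> square_zero CARD('n) U")
  case True
  then have match: "matching CARD('n) U" and sz: "square_zero CARD('n) U" by auto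
  show ?thesis
    unfolding represents_free_resolution_iff[OF gr match M sz] represents_injective_resolution_iff[OF gr match M sz]
    by (rule graded_complex.resolves_empty_iff_UNIV[OF graded_complex_matrices[OF gr match sz] M
          total_dim_finite_support[OF M dim]])
next
  case False
  \<comment> \<open>Mismatched grades or a nonzero product violate both conditions alike, so both
    sides are false.\<close>
  let ?W = "\<lambda>q. gm_shift ((\<chi> i. 1) :: int ^ 'n) (U q)"
  have grW: "\<forall>q\<in>{1..CARD('n)}. graded_matrix (?W q)"
    using gr graded_matrix_shift by blast
  have "\<not> represents_free_resolution CARD('n) U M"
    using False complex_free_iff[OF gr]
    unfolding represents_free_resolution_def free_resolution_def by blast
  moreover have "\<not> represents_injective_resolution CARD('n) ?W M"
    using False complex_inj_iff[OF grW] matching_shift square_zero_shift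
    unfolding represents_injective_resolution_def injective_resolution_def by blast
  ultimately show ?thesis by blast
qed

theorem corollary14:
  fixes M :: "('k :: field, 'v :: ab_group_add, 'n :: finite) pmod"
    and U :: "nat \<Rightarrow> ('k, 'n) gmat"
    and n :: nat and \<epsilon> :: "int ^ 'n"
    and U\<epsilon> U\<epsilon>T :: "nat \<Rightarrow> ('k, 'n) gmat"
  defines "n \<equiv> CARD('n)"
    and "\<epsilon> \<equiv> (\<chi> i. 1)"
    and "U\<epsilon> \<equiv> (\<lambda>q. gm_shift \<epsilon> (U q))"
    and "U\<epsilon>T \<equiv> (\<lambda>q. gm_transpose (U\<epsilon> (n + 1 - q)))"
  assumes "persistence_module M" and "total_dim M < \<infinity>"
    and "\<forall>q\<in>{1..n}. graded_matrix (U q)"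
  shows "(represents_free_resolution n U M \<longleftrightarrow> represents_injective_resolution n U\<epsilon> M) \<and>
    (represents_injective_resolution n U\<epsilon> M \<longleftrightarrow> represents_free_resolution n U\<epsilon>T (dual M)) \<and>
    (represents_free_resolution n U M \<longrightarrow>
      (\<exists>f. complex_iso f (inj_complex n U\<epsilon>)
        (translate (int n) (shift_complex \<epsilon> (nu_complex (free_complex n U))))) \<and>
      (\<exists>g. complex_iso g (inj_complex n U\<epsilon>) (dual_complex (free_complex n U\<epsilon>T))))"
proof (intro conjI impI)
  have gr\<epsilon>: "\<forall>q\<in>{1..n}. graded_matrix (U\<epsilon> q)"
    using assms(7) by (simp add: U\<epsilon>_def graded_matrix_shift)
  \<comment> \<open>Types are nonempty, so there is at least one matrix.\<close>
  have n: "1 \<le> n"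
    by (simp add: n_def Suc_le_eq)
  show "represents_free_resolution n U M \<longleftrightarrow> represents_injective_resolution n U\<epsilon> M"
    using represents_free_iff_injective[OF assms(7)[unfolded n_def] assms(5,6)]
    unfolding n_def U\<epsilon>_def \<epsilon>_def .
  show "represents_injective_resolution n U\<epsilon> M \<longleftrightarrow> represents_free_resolution n U\<epsilon>T (dual M)"
    unfolding U\<epsilon>T_def by (rule represents_injective_iff_dual[OF gr\<epsilon> assms(5) n])
  assume "represents_free_resolution n U M"
  then have match: "matching n U"
    by (simp add: represents_free_resolution_def)
  then have match\<epsilon>: "matching n U\<epsilon>"
    by (simp add: U\<epsilon>_def matching_shift)
  show "\<exists>f. complex_iso f (inj_complex n U\<epsilon>)
      (translate (int n) (shift_complex \<epsilon> (nu_complex (free_complex n U))))"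
    unfolding U\<epsilon>_def using complex_iso_nu[OF assms(7) match] by blast
  show "\<exists>g. complex_iso g (inj_complex n U\<epsilon>) (dual_complex (free_complex n U\<epsilon>T))"
    unfolding U\<epsilon>T_def using complex_iso_dual[OF gr\<epsilon> match\<epsilon> n] by blast
qed

end
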